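(* Let $\mu_0\in H^1(\mathbb{T}^d)$. For $\tau>0$ let $\mu_\tau(t)=\mu^n$ for $(n-1)\tau<t\le n\tau$, where $\mu^0=\mu_0$ and, for $n\ge1$, $$\mu^n=\arg\min_{\mu\in H^1(\mathbb{T}^d)}\ Q(\mu)+\frac1{2\tau}K(\mu,\mu^{n-1})^2 .$$ Then $(\mu^n)_{n\in\mathbb{N}}$ solves, in the $H^1$ weak sense, $$\frac{\mu^n-\mu^{n-1}}{\tau}-\nabla\cdot\big[A_*(\nabla\mu^n+\mu^n\nabla V(x))\big]=0 .$$ Moreover, for all $t\in(0,\infty)$, $$\mu_\tau(t)\to\mu(t)\quad\text{in }L^2(\mathbb{T}^d)\text{ as }\tau\to0,$$ where $\mu(t)$ is the solution, with initial value $\mu_0$, of the effective Fokker-Planck equation $$\frac{\partial\mu}{\partial t}-\nabla\cdot\big[A_*(\nabla\mu+\mu\nabla V(x))\big]=0\quad\text{in }\mathbb{T}^d\times(0,\infty).$$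
   Context: $\mathbb{T}^d=\mathbb{R}^d/\mathbb{Z}^d$ is the flat torus and $\langle\cdot,\cdot\rangle$ is the Euclidean inner product. Standing assumptions on the data: $A:\mathbb{R}^d\to\mathbb{R}^{d\times d}$ is 1-periodic ($A(x+e_j)=A(x)$ for all $x$ and all standard basis vectors $e_j$), of class at least $C^2$, and there are constants $\Lambda_0,\Lambda_1>0$ with $\Lambda_0I\preceq A(x)\preceq\Lambda_1I$ for all $x$ ($\preceq$ is the Loewner order on symmetric matrices, so $A(x)$ is symmetric). There are potentials $V_\varepsilon\in C^1(\mathbb{T}^d)$, $\varepsilon>0$, with $V_\varepsilon\ge0$, and $\lambda>0$ with $V_\varepsilon(x)\le\lambda$ and $|\nabla V_\varepsilon(x)|\le\lambda$ for all $x,\varepsilon$; $V$ is their uniform limit: $\sup_x|V_\varepsilon(x)-V(x)|\to0$ as $\varepsilon\to0$. (So $V$ is Lipschitz and $\nabla V$ is understood almost everywhere.) Put $\pi_*=e^{-V}$ and $$Q(\mu)=\frac12\int_{\mathbb{T}^d}\Big\langle\pi_*(x)A_*\nabla\frac{\mu}{\pi_*},\nabla\frac{\mu}{\pi_*}\Big\rangle dx,\qquad K(\mu,\nu)=\Big[\int_{\mathbb{T}^d}\frac{(\mu-\nu)^2}{\pi_*}dx\Big]^{1/2}.$$ The effective diffusion matrix is $$(A_* )_{jk}=\int_{\mathbb{T}^d}\Big(A_{jk}(x)+\sum_{\ell=1}^dA_{j\ell}(x)\frac{\partial\chi_k}{\partial x_\ell}(x)\Big)dx,$$ where $\chi=(\chi_1,\dots,\chi_d)$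 is the periodic solution, unique up to additive constants, of $-\nabla\cdot(A\nabla\chi)=\nabla\cdot A$, i.e. $-\sum_{j,\ell}\partial_j(A_{j\ell}\partial_\ell\chi_k)=\sum_j\partial_jA_{jk}$ for each $k$. Parabolic equations are understood in the usual weak sense; "$H^1$ weak sense" means tested against all functions in $H^1(\mathbb{T}^d)$ after integration by parts. *)

theory Defs
  imports "HOL-Analysis.Analysis"
begin

text \<open>Functions on the torus are functions on \<open>\<real>\<^sup>d\<close> that are periodic with respect to the standard basis
  vectors; integrals over the torus are Lebesgue integrals over the unit cell.\<close>

definition periodic :: "(real^'d \<Rightarrow> 'b) \<Rightarrow> bool" where
  "periodic f \<longleftrightarrow> (\<forall>x j. f (x + axis j 1) = f x)"

definition torus_integral :: "(real^'d \<Rightarrow> real) \<Rightarrow> real" where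
  "torus_integral f = (LINT x:cbox 0 One|lebesgue. f x)"


subsection \<open>Classical differentiability\<close>

definition pd :: "'d \<Rightarrow> (real^'d \<Rightarrow> real) \<Rightarrow> real^'d \<Rightarrow> real" where
  "pd j f x = frechet_derivative f (at x) (axis j 1)"

definition grad :: "(real^'d \<Rightarrow> real) \<Rightarrow> real^'d \<Rightarrow> real^'d" where
  "grad f x = (\<chi> j. pd j f x)"

primrec Ck :: "nat \<Rightarrow> ('a::euclidean_space \<Rightarrow> real) \<Rightarrow> bool" where
  "Ck 0 f \<longleftrightarrow> continuous_on UNIV f"
| "Ck (Suc k) f \<longleftrightarrow> (\<forall>x. f differentiable (at x)) \<and>
     (\<forall>b\<in>Basis. Ck k (\<lambda>x. frechet_derivative f (at x) b))"

definition smooth :: "('a::euclidean_space \<Rightarrow> real) \<Rightarrow> bool" where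
  "smooth f \<longleftrightarrow> (\<forall>k. Ck k f)"


subsection \<open>\<open>L\<^sup>2\<close> and \<open>H\<^sup>1\<close> on the torus\<close>

text \<open>Elements of \<open>L\<^sup>2\<close> and \<open>H\<^sup>1\<close> are represented by functions, not by classes modulo almost everywhere
  equality. A weak gradient is unique up to null sets, so every integral below is independent of the
  one that \<open>wgrad\<close> chooses.\<close>

definition L2 :: "(real^'d \<Rightarrow> real) set" where
  "L2 = {f. periodic f \<and> f \<in> borel_measurable lebesgue \<and>
            set_integrable lebesgue (cbox 0 One) (\<lambda>x. (f x)\<^sup>2)}"

definition L2_norm :: "(real^'d \<Rightarrow> real) \<Rightarrow> real" where
  "L2_norm f = sqrt (torus_integral (\<lambda>x. (f x)\<^sup>2))"

definition has_weak_grad :: "(real^'d \<Rightarrow> real) \<Rightarrow> (real^'d \<Rightarrow> real^'d) \<Rightarrow> bool" where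
  "has_weak_grad f G \<longleftrightarrow> f \<in> L2 \<and> (\<forall>j. (\<lambda>x. G x $ j) \<in> L2 \<and>
     (\<forall>\<phi>. periodic \<phi> \<and> smooth \<phi> \<longrightarrow>
        torus_integral (\<lambda>x. f x * pd j \<phi> x) = - torus_integral (\<lambda>x. G x $ j * \<phi> x)))"

definition H1 :: "(real^'d \<Rightarrow> real) set" where
  "H1 = {f. \<exists>G. has_weak_grad f G}"

definition wgrad :: "(real^'d \<Rightarrow> real) \<Rightarrow> real^'d \<Rightarrow> real^'d" where
  "wgrad f = (SOME G. has_weak_grad f G)"


subsection \<open>The effective diffusion matrix\<close>

definition loewner_le :: "real^'d^'d \<Rightarrow> real^'d^'d \<Rightarrow> bool" where
  "loewner_le M N \<longleftrightarrow> transpose M = M \<and> transpose N = N \<and>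
     (\<forall>\<xi>. \<xi> \<bullet> (M *v \<xi>) \<le> \<xi> \<bullet> (N *v \<xi>))"

text \<open>For \<open>A\<close> of class \<open>C\<^sup>2\<close> the periodic solutions of the cell problem are of class \<open>C\<^sup>2\<close>, so the
  equation is imposed pointwise.\<close>

definition corrector :: "(real^'d \<Rightarrow> real^'d^'d) \<Rightarrow> (real^'d \<Rightarrow> real^'d) \<Rightarrow> bool" where
  "corrector A X \<longleftrightarrow> periodic X \<and> (\<forall>k. Ck 2 (\<lambda>x. X x $ k) \<and>
     (\<forall>x. - (\<Sum>j\<in>UNIV. \<Sum>l\<in>UNIV. pd j (\<lambda>y. A y $ j $ l * pd l (\<lambda>z. X z $ k) y) x)
          = (\<Sum>j\<in>UNIV. pd j (\<lambda>y. A y $ j $ k) x)))"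

definition effective_matrix :: "(real^'d \<Rightarrow> real^'d^'d) \<Rightarrow> (real^'d \<Rightarrow> real^'d) \<Rightarrow> real^'d^'d" where
  "effective_matrix A X = (\<chi> j k. torus_integral
     (\<lambda>x. A x $ j $ k + (\<Sum>l\<in>UNIV. A x $ j $ l * pd l (\<lambda>z. X z $ k) x)))"


subsection \<open>The minimizing movement scheme\<close>

definition pi_star :: "(real^'d \<Rightarrow> real) \<Rightarrow> real^'d \<Rightarrow> real" where
  "pi_star V x = exp (- V x)"

definition Qfun :: "real^'d^'d \<Rightarrow> (real^'d \<Rightarrow> real) \<Rightarrow> (real^'d \<Rightarrow> real) \<Rightarrow> real" where
  "Qfun As V \<mu> = 1/2 * torus_integral
     (\<lambda>x. (pi_star V x *\<^sub>R (As *v wgrad (\<lambda>y. \<mu> y / pi_star V y) x)) \<bullet>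
          wgrad (\<lambda>y. \<mu> y / pi_star V y) x)"

definition Kdist :: "(real^'d \<Rightarrow> real) \<Rightarrow> (real^'d \<Rightarrow> real) \<Rightarrow> (real^'d \<Rightarrow> real) \<Rightarrow> real" where
  "Kdist V \<mu> \<nu> = sqrt (torus_integral (\<lambda>x. (\<mu> x - \<nu> x)\<^sup>2 / pi_star V x))"

definition min_scheme ::
  "real^'d^'d \<Rightarrow> (real^'d \<Rightarrow> real) \<Rightarrow> (real^'d \<Rightarrow> real) \<Rightarrow> real \<Rightarrow> (nat \<Rightarrow> real^'d \<Rightarrow> real) \<Rightarrow> bool" where
  "min_scheme As V \<mu>0 \<tau> m \<longleftrightarrow> m 0 = \<mu>0 \<and>
     (\<forall>n\<ge>1. is_arg_min (\<lambda>\<mu>. Qfun As V \<mu> + 1 / (2 * \<tau>) * (Kdist V \<mu> (m (n - 1)))\<^sup>2)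
               (\<lambda>\<mu>. \<mu> \<in> H1) (m n))"

text \<open>For \<open>t > 0\<close> the index \<open>nat \<lceil>t / \<tau>\<rceil>\<close> is the \<open>n \<ge> 1\<close> with \<open>(n - 1) \<tau> < t \<le> n \<tau>\<close>.\<close>

definition interpolant :: "real \<Rightarrow> (nat \<Rightarrow> real^'d \<Rightarrow> real) \<Rightarrow> real \<Rightarrow> real^'d \<Rightarrow> real" where
  "interpolant \<tau> m t = m (nat \<lceil>t / \<tau>\<rceil>)"


subsection \<open>Weak solutions\<close>

text \<open>In this section \<open>DV\<close> stands for the almost everywhere defined gradient of the potential.\<close>

definition FP_form ::
  "real^'d^'d \<Rightarrow> (real^'d \<Rightarrow> real^'d) \<Rightarrow> (real^'d \<Rightarrow> real) \<Rightarrow> (real^'d \<Rightarrow> real) \<Rightarrow> real" where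
  "FP_form As DV \<mu> \<phi> =
     torus_integral (\<lambda>x. (As *v (wgrad \<mu> x + \<mu> x *\<^sub>R DV x)) \<bullet> wgrad \<phi> x)"

definition discrete_FP_weak ::
  "real^'d^'d \<Rightarrow> (real^'d \<Rightarrow> real^'d) \<Rightarrow> real \<Rightarrow> (real^'d \<Rightarrow> real) \<Rightarrow> (real^'d \<Rightarrow> real) \<Rightarrow> bool" where
  "discrete_FP_weak As DV \<tau> \<mu> \<nu> \<longleftrightarrow> \<mu> \<in> H1 \<and>
     (\<forall>\<phi>\<in>H1. torus_integral (\<lambda>x. (\<mu> x - \<nu> x) / \<tau> * \<phi> x) + FP_form As DV \<mu> \<phi> = 0)"

text \<open>The solution class is \<open>C([0,\<infinity>); L\<^sup>2) \<inter> L\<^sup>2\<^sub>l\<^sub>o\<^sub>c([0,\<infinity>); H\<^sup>1)\<close>. Measurability of \<open>t \<mapsto> \<mu> t\<close> with values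
  in \<open>H\<^sup>1\<close> follows from continuity with values in \<open>L\<^sup>2\<close>. The last clause says that the distributional
  time derivative, with values in the dual of \<open>H\<^sup>1\<close>, is \<open>- FP_form As DV (\<mu> t)\<close>.\<close>

definition FP_weak_solution ::
  "real^'d^'d \<Rightarrow> (real^'d \<Rightarrow> real^'d) \<Rightarrow> (real^'d \<Rightarrow> real) \<Rightarrow> (real \<Rightarrow> real^'d \<Rightarrow> real) \<Rightarrow> bool" where
  "FP_weak_solution As DV \<mu>0 \<mu> \<longleftrightarrow>
     (\<forall>t\<ge>0. \<mu> t \<in> L2) \<and>
     (\<forall>s\<ge>0. ((\<lambda>t. L2_norm (\<lambda>x. \<mu> t x - \<mu> s x)) \<longlongrightarrow> 0) (at s within {0..})) \<and>
     (AE t in lebesgue. t > 0 \<longrightarrow> \<mu> t \<in> H1) \<and>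
     (\<forall>T>0. set_integrable lebesgue {0..T} (\<lambda>t. torus_integral (\<lambda>x. (norm (wgrad (\<mu> t) x))\<^sup>2))) \<and>
     (AE x in lebesgue. \<mu> 0 x = \<mu>0 x) \<and>
     (\<forall>\<phi>\<in>H1. \<forall>\<eta>::real \<Rightarrow> real. \<forall>a b. smooth \<eta> \<and> 0 < a \<and> (\<forall>t. t \<notin> {a..b} \<longrightarrow> \<eta> t = 0) \<longrightarrow>
        (LINT t:{0<..}|lebesgue. deriv \<eta> t * torus_integral (\<lambda>x. \<mu> t x * \<phi> x)) =
        (LINT t:{0<..}|lebesgue. \<eta> t * FP_form As DV (\<mu> t) \<phi>))"

end

theory Submission
  imports Defs
begin

text \<open>
  In the variable \<open>u = \<mu> / sqrt \<pi>\<^sub>*\<close> the distance \<open>K\<close> becomes the distance of \<open>L\<^sup>2\<close> and \<open>Q\<close> becomes one half of a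
  closed symmetric form \<open>q\<close> with domain corresponding to \<open>H\<^sup>1\<close>; ellipticity of the effective matrix
  gives closedness. The scheme is the iteration of the resolvent \<open>R\<^sub>\<tau> = (1 + \<tau> L)\<^sup>-\<^sup>1\<close> of the operator \<open>L\<close> of \<open>q\<close>, and its
  Euler--Lagrange equation is the weak discrete equation.

  Iterates with different step sizes are compared by the Crandall--Liggett--Kobayashi estimate, which uses only
  the resolvent identity and contractivity. Hence \<open>R\<^sub>\<tau>\<^sup>n u\<^sub>0\<close> with \<open>n = \<lceil>t / \<tau>\<rceil>\<close> converges as \<open>\<tau> \<rightarrow> 0\<close>, and the
  smoothing bound on \<open>L R\<^sub>\<tau>\<^sup>n u\<^sub>0\<close> makes the limit \<open>u\<close> continuous in the form norm for \<open>t > 0\<close>, with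
  \<open>\<langle>u, \<phi>\<rangle>' = - q(u, \<phi>)\<close>.

  A weak solution is only tested with functions of \<open>H\<^sup>1\<close> at fixed time. Testing with \<open>R\<^sub>1 \<psi>\<close> shows that
  \<open>R\<^sub>1 u\<close> is differentiable in time with derivative \<open>R\<^sub>1 u - u\<close>; for the difference \<open>u\<close> of two solutions
  \<open>N = \<langle>R\<^sub>1 u, u\<rangle>\<close> satisfies \<open>N' = 2 (\<langle>R\<^sub>1 u, u\<rangle> - \<langle>u, u\<rangle>) \<le> 0\<close>, so \<open>u = 0\<close>. Every weak solution is therefore the limit of
  the scheme.
\<close>

subsection \<open>Quadratic forms on a subspace\<close>

text \<open>The initial value lies only in the form domain, whereas the comparison of step sizes
  needs a vector in the domain of the operator. Replacing v by its resolvent with parameter l costs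
  at most sqrt (l * q v v) in norm and gives an operator image of norm at most sqrt (q v v / l).
  Balancing l leaves a fourth root: the limit is Hoelder continuous of order 1/2 in time, and at
  fixed t the scheme has an error of order \<tau>^(1/4).

  These estimates are in the norm of the Hilbert space. They pass to the form because q (u - u') (u
  - u') is the inner product of u - u' with the difference of the operator images, so it is small as
  soon as those images stay bounded; the smoothing effect bounds them at positive times.

  On the torus the obstacle is that V is only Lipschitz while weak gradients are tested with smooth
  functions. The product rule for exp (c V) f, on which the change of variables rests, therefore
  requires an extension of the weak identity to Lipschitz test functions whose derivative is known
  almost everywhere.\<close>

lemma linear_part_eq_0:
  fixes b c :: real
  assumes "\<And>t. 0 \<le> t * b + t\<^sup>2 * c"
  shows "b = 0"
proof (rule ccontr)
  assume b: "b \<noteq> 0"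
  \<comment> \<open>Modelled on the minimiser of t b + t^2 |c|; the summand 1 keeps the denominator
    positive, and the value is exactly -(b / (|c| + 1))^2.\<close>
  define t where "t = - b / (\<bar>c\<bar> + 1)"
  have "t * b + t\<^sup>2 * c \<le> t * b + t\<^sup>2 * \<bar>c\<bar>"
    by (simp add: mult_left_mono)
  also have "\<dots> = - (b\<^sup>2 / (\<bar>c\<bar> + 1)\<^sup>2)"
  proof -
    have p: "\<bar>c\<bar> + 1 \<noteq> 0" by linarith
    have "t * b * (\<bar>c\<bar> + 1)\<^sup>2 = - b\<^sup>2 * (\<bar>c\<bar> + 1)"
      using p by (simp add: t_def power2_eq_square field_simps)
    moreover have "t\<^sup>2 * \<bar>c\<bar> * (\<bar>c\<bar> + 1)\<^sup>2 = b\<^sup>2 * \<bar>c\<bar>"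
      using p by (simp add: t_def power_divide)
    ultimately have "(t * b + t\<^sup>2 * \<bar>c\<bar>) * (\<bar>c\<bar> + 1)\<^sup>2 = - b\<^sup>2 * (\<bar>c\<bar> + 1) + b\<^sup>2 * \<bar>c\<bar>"
      by (simp only: distrib_right[of "t * b"])
    also have "\<dots> = - b\<^sup>2" by (simp add: algebra_simps)
    finally have "(t * b + t\<^sup>2 * \<bar>c\<bar>) * (\<bar>c\<bar> + 1)\<^sup>2 = - b\<^sup>2" .
    then show ?thesis using p by (simp add: field_simps)
  qed
  also have "\<dots> < 0" using b by (simp add: zero_less_divide_iff add_nonneg_eq_0_iff)
  finally show False using assms[of t] by linarith
qed

text \<open>The laws are demanded on \<open>D\<close> only: the form used later is built from
  \<open>wgrad\<close>, which has no meaning for a function without a weak gradient.\<close>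

locale sym_form =
  fixes D :: "'a::real_vector set" and q :: "'a \<Rightarrow> 'a \<Rightarrow> real"
  assumes D: "subspace D"
    and q_add_left: "\<lbrakk>x \<in> D; y \<in> D; z \<in> D\<rbrakk> \<Longrightarrow> q (x + y) z = q x z + q y z"
    and q_scale_left: "\<lbrakk>x \<in> D; z \<in> D\<rbrakk> \<Longrightarrow> q (c *\<^sub>R x) z = c * q x z"
    and q_sym: "\<lbrakk>x \<in> D; y \<in> D\<rbrakk> \<Longrightarrow> q x y = q y x"
    and q_nonneg: "x \<in> D \<Longrightarrow> 0 \<le> q x x"
begin

lemmas D_add = subspace_add[OF D]
lemmas D_diff = subspace_diff[OF D]
lemmas D_scale = subspace_scale[OF D]
lemmas D_0 = subspace_0[OF D]

lemma q_diff_left: "\<lbrakk>x \<in> D; y \<in> D; z \<in> D\<rbrakk> \<Longrightarrow> q (x - y) z = q x z - q y z"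
  using q_add_left[of x "(-1) *\<^sub>R y" z] q_scale_left[of y z "-1"] D_scale[of y "-1"] by simp

lemma q_add_right: "\<lbrakk>x \<in> D; y \<in> D; z \<in> D\<rbrakk> \<Longrightarrow> q z (x + y) = q z x + q z y"
  using q_add_left q_sym D_add by metis

lemma q_scale_right: "\<lbrakk>x \<in> D; z \<in> D\<rbrakk> \<Longrightarrow> q z (c *\<^sub>R x) = c * q z x"
  using q_scale_left q_sym D_scale by metis

lemma q_diff_right: "\<lbrakk>x \<in> D; y \<in> D; z \<in> D\<rbrakk> \<Longrightarrow> q z (x - y) = q z x - q z y"
  using q_diff_left q_sym D_diff by metis

lemmas q_simps = q_add_left q_add_right q_diff_left q_diff_right q_scale_left q_scale_right
  D_add D_diff D_scale

lemma q_Cauchy_Schwarz: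
  assumes x: "x \<in> D" and y: "y \<in> D"
  shows "(q x y)\<^sup>2 \<le> q x x * q y y"
proof (cases "q y y = 0")
  case True
  have "0 \<le> q (x + t *\<^sub>R y) (x + t *\<^sub>R y)" for t
    by (intro q_nonneg D_add D_scale x y)
  then have *: "0 \<le> q x x + t * (2 * q x y)" for t
    using x y True q_sym[OF x y] by (simp add: q_simps algebra_simps)
  have "q x y = 0"
  proof (rule ccontr)
    assume "q x y \<noteq> 0"
    \<comment> \<open>This value of \<open>t\<close> makes the right-hand side of \<open>*\<close>
      equal to -1.\<close>
    then show False using *[of "- (q x x + 1) / (2 * q x y)"] by simp
  qed
  then show ?thesis using True by simp
next
  case False
  then have c: "q y y > 0" using q_nonneg[OF y] by simp
  define t where "t = - q x y / q y y"
  have "0 \<le> q (x + t *\<^sub>R y) (x + t *\<^sub>R y)"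
    by (intro q_nonneg D_add D_scale x y)
  then have "0 \<le> q x x + 2 * t * q x y + t * t * q y y"
    using x y q_sym[OF x y] by (simp add: q_simps algebra_simps)
  also have "\<dots> = q x x - (q x y)\<^sup>2 / q y y"
    using c by (simp add: t_def power2_eq_square field_simps)
  finally show ?thesis using c by (simp add: field_simps)
qed

lemma abs_q_le:
  assumes "x \<in> D" "y \<in> D"
  shows "\<bar>q x y\<bar> \<le> sqrt (q x x) * sqrt (q y y)"
  using real_sqrt_le_mono[OF q_Cauchy_Schwarz[OF assms]] by (simp add: real_sqrt_mult)

lemma q_tendsto:
  assumes X: "\<And>n. X n \<in> D" and x: "x \<in> D" and y: "y \<in> D"
    and lim: "((\<lambda>n. q (X n - x) (X n - x)) \<longlongrightarrow> 0) F"
  shows "((\<lambda>n. q (X n) y) \<longlongrightarrow> q x y) F" "((\<lambda>n. q (X n) (X n)) \<longlongrightarrow> q x x) F"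
proof -
  have *: "((\<lambda>n. q (X n) y) \<longlongrightarrow> q x y) F" if y: "y \<in> D" for y
  proof -
    have l: "((\<lambda>n. sqrt (q (X n - x) (X n - x)) * sqrt (q y y)) \<longlongrightarrow> sqrt 0 * sqrt (q y y)) F"
      by (intro tendsto_intros lim)
    have "((\<lambda>n. q (X n) y - q x y) \<longlongrightarrow> 0) F"
    proof (rule tendsto_rabs_zero_cancel, rule tendsto_sandwich[where f = "\<lambda>_. 0"])
      show "\<forall>\<^sub>F n in F. \<bar>q (X n) y - q x y\<bar> \<le> sqrt (q (X n - x) (X n - x)) * sqrt (q y y)"
        using abs_q_le[OF D_diff[OF X x] y] by (simp add: q_diff_left X x y)
    qed (use l in auto)
    then show ?thesis by (rule LIM_zero_cancel)
  qed
  show "((\<lambda>n. q (X n) y) \<longlongrightarrow> q x y) F" by (rule *[OF y])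
  \<comment> \<open>Expanding the square expresses q (X n) (X n) through the seminorm distance and a
    term linear in X n, and both converge.\<close>
  have "((\<lambda>n. q (X n - x) (X n - x) + 2 * q (X n) x - q x x) \<longlongrightarrow> 0 + 2 * q x x - q x x) F"
    by (intro tendsto_intros lim *[OF x])
  moreover have "q (X n - x) (X n - x) + 2 * q (X n) x - q x x = q (X n) (X n)" for n
    using q_sym[OF X x] by (simp add: q_simps X x)
  ultimately show "((\<lambda>n. q (X n) (X n)) \<longlongrightarrow> q x x) F" by simp
qed

end

subsection \<open>Resolvents of a closed form\<close>

text \<open>Closedness says that \<open>D\<close> is complete for the graph norm. The Cauchy
  condition is split into norm and form, as \<open>q\<close> alone is only a seminorm.\<close>

locale closed_form = sym_form D q for D :: "'h::{real_inner, complete_space} set" and q +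
  assumes complete: "\<lbrakk>\<And>n. X n \<in> D; Cauchy X;
      \<And>e. e > 0 \<Longrightarrow> \<exists>N. \<forall>m\<ge>N. \<forall>n\<ge>N. q (X m - X n) (X m - X n) < e\<rbrakk>
    \<Longrightarrow> \<exists>x\<in>D. X \<longlonglongrightarrow> x \<and> (\<lambda>n. q (X n - x) (X n - x)) \<longlonglongrightarrow> 0"
begin

text \<open>The weak form of u + \<tau> L u = v, which makes sense before any operator L has been
  constructed.\<close>

definition is_res :: "real \<Rightarrow> 'h \<Rightarrow> 'h \<Rightarrow> bool" where
  "is_res \<tau> v u \<longleftrightarrow> u \<in> D \<and> (\<forall>w\<in>D. (v - u) \<bullet> w = \<tau> * q u w)"

text \<open>Its infimum over \<open>D\<close> is the Moreau envelope of 1/2 q; minimising it is one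
  implicit Euler step of size \<tau> from v.\<close>

definition moreau :: "real \<Rightarrow> 'h \<Rightarrow> 'h \<Rightarrow> real" where
  "moreau \<tau> v u = 1/2 * q u u + 1 / (2 * \<tau>) * (norm (u - v))\<^sup>2"

text \<open>On the line u + t w the functional is a quadratic polynomial in t with its minimum at t
  = 0, so the linear coefficient vanishes.\<close>

lemma is_arg_min_imp_is_res:
  assumes \<tau>: "\<tau> > 0" and min: "is_arg_min (moreau \<tau> v) (\<lambda>u. u \<in> D) u"
  shows "is_res \<tau> v u"
proof -
  have u: "u \<in> D" and le: "\<And>w. w \<in> D \<Longrightarrow> moreau \<tau> v u \<le> moreau \<tau> v w"
    using min by (auto simp: is_arg_min_linorder)
  have "(v - u) \<bullet> w = \<tau> * q u w" if w: "w \<in> D" for w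
  proof -
    have "0 \<le> t * (q u w + (u - v) \<bullet> w / \<tau>) + t\<^sup>2 * (q w w / 2 + (norm w)\<^sup>2 / (2 * \<tau>))" for t
    proof -
      have "moreau \<tau> v (u + t *\<^sub>R w) - moreau \<tau> v u
          = t * (q u w + (u - v) \<bullet> w / \<tau>) + t\<^sup>2 * (q w w / 2 + (norm w)\<^sup>2 / (2 * \<tau>))"
        using \<tau> q_sym[OF u w] unfolding moreau_def power2_norm_eq_inner power2_eq_square[of t]
        by (simp add: q_simps u w inner_simps inner_commute field_simps)
      moreover have "moreau \<tau> v u \<le> moreau \<tau> v (u + t *\<^sub>R w)" by (intro le D_add D_scale u w)
      ultimately show ?thesis by linarith
    qed
    then have "q u w + (u - v) \<bullet> w / \<tau> = 0" by (rule linear_part_eq_0)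
    then show ?thesis using \<tau> by (simp add: field_simps inner_diff_left)
  qed
  then show ?thesis using u by (simp add: is_res_def)
qed

text \<open>Strong convexity takes the place of weak compactness: the parallelogram identity forces
  a minimising sequence to be Cauchy in norm and in form, and closedness supplies the
  minimiser.\<close>

lemma ex_arg_min:
  assumes \<tau>: "\<tau> > 0"
  shows "\<exists>u. is_arg_min (moreau \<tau> v) (\<lambda>u. u \<in> D) u"
proof -
  let ?J = "moreau \<tau> v"
  define I where "I = Inf (?J ` D)"
  have J0: "0 \<le> ?J u" if "u \<in> D" for u using q_nonneg[OF that] \<tau> by (simp add: moreau_def)
  have bdd: "bdd_below (?J ` D)" by (intro bdd_belowI2[of _ 0] J0)
  have ne: "?J ` D \<noteq> {}" using D_0 by auto
  have I: "I \<le> ?J u" if "u \<in> D" for u unfolding I_def using bdd that by (simp add: cInf_lower)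
  have "\<exists>u\<in>D. ?J u < I + inverse (real (Suc n))" for n
    using cInf_lessD[OF ne, of "I + inverse (real (Suc n))"] by (auto simp: I_def)
  then obtain X where X: "\<And>n. X n \<in> D" and JX: "\<And>n. ?J (X n) < I + inverse (real (Suc n))"
    by metis
  \<comment> \<open>The parallelogram law for both quadratic terms. The midpoint lies in
    \<open>D\<close>, so its value is at least the infimum \<open>I\<close>.\<close>
  have mid: "q (x - y) (x - y) + (norm (x - y))\<^sup>2 / \<tau> \<le> 4 * (?J x - I) + 4 * (?J y - I)"
    if "x \<in> D" "y \<in> D" for x y
  proof -
    have "q (x - y) (x - y) + (norm (x - y))\<^sup>2 / \<tau>
        = 4 * ?J x + 4 * ?J y - 8 * ?J ((1/2) *\<^sub>R (x + y))"
      using \<tau> q_sym[OF that] unfolding moreau_def power2_norm_eq_inner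
      by (simp add: q_simps that inner_simps inner_commute field_simps)
    also have "\<dots> \<le> 4 * ?J x + 4 * ?J y - 8 * I"
      using I[of "(1/2) *\<^sub>R (x + y)"] that by (simp add: q_simps)
    finally show ?thesis by simp
  qed
  have small: "\<exists>N. \<forall>m\<ge>N. \<forall>n\<ge>N. q (X m - X n) (X m - X n) + (norm (X m - X n))\<^sup>2 / \<tau> < e" if "e > 0" for e
  proof -
    \<comment> \<open>Each of the two excesses in \<open>mid\<close> carries the weight 4.\<close>
    have "e / 8 > 0" using that by simp
    then obtain N where N: "inverse (real (Suc N)) < e / 8" using reals_Archimedean by blast
    have "q (X m - X n) (X m - X n) + (norm (X m - X n))\<^sup>2 / \<tau> < e" if "m \<ge> N" "n \<ge> N" for m n
    proof -
      have "inverse (real (Suc m)) \<le> inverse (real (Suc N))" "inverse (real (Suc n)) \<le> inverse (real (Suc N))"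
        using that by (simp_all add: le_imp_inverse_le)
      then have "?J (X m) - I < e / 8" "?J (X n) - I < e / 8"
        using order_less_le_trans[OF JX[of m]] order_less_le_trans[OF JX[of n]] N
        by (smt (verit))+
      then have "4 * (?J (X m) - I) + 4 * (?J (X n) - I) < e" by simp
      then show ?thesis using mid[OF X X, of m n] by (rule le_less_trans[rotated])
    qed
    then show ?thesis by blast
  qed
  have "Cauchy X"
  proof (rule CauchyI)
    fix e :: real assume e: "e > 0"
    obtain N where N: "\<And>m n. m \<ge> N \<Longrightarrow> n \<ge> N \<Longrightarrow> q (X m - X n) (X m - X n) + (norm (X m - X n))\<^sup>2 / \<tau> < e\<^sup>2 / \<tau>"
      using small[of "e\<^sup>2 / \<tau>"] e \<tau> by auto
    have "norm (X m - X n) < e" if "m \<ge> N" "n \<ge> N" for m n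
    proof -
      have "(norm (X m - X n))\<^sup>2 / \<tau> < e\<^sup>2 / \<tau>"
        using N[OF that] q_nonneg[OF D_diff[OF X X], of m n] by linarith
      then show ?thesis using \<tau> e by (simp add: divide_less_cancel power2_less_imp_less)
    qed
    then show "\<exists>N. \<forall>m\<ge>N. \<forall>n\<ge>N. norm (X m - X n) < e" by blast
  qed
  moreover have "\<exists>N. \<forall>m\<ge>N. \<forall>n\<ge>N. q (X m - X n) (X m - X n) < e" if "e > 0" for e
  proof -
    have "q (X m - X n) (X m - X n) \<le> q (X m - X n) (X m - X n) + (norm (X m - X n))\<^sup>2 / \<tau>" for m n
      using \<tau> by simp
    then show ?thesis using small[OF that] by (meson le_less_trans)
  qed
  ultimately obtain x where x: "x \<in> D" and Xx: "X \<longlonglongrightarrow> x" and qx: "(\<lambda>n. q (X n - x) (X n - x)) \<longlonglongrightarrow> 0"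
    using complete[of X] X by blast
  have "(\<lambda>n. ?J (X n)) \<longlonglongrightarrow> ?J x"
    unfolding moreau_def by (intro tendsto_intros q_tendsto(2)[OF X x x qx] Xx)
  moreover have "(\<lambda>n. I + inverse (real (Suc n))) \<longlonglongrightarrow> I + 0"
    by (intro tendsto_intros LIMSEQ_inverse_real_of_nat)
  ultimately have "?J x \<le> I + 0"
    by (rule LIMSEQ_le) (use JX less_imp_le in blast)
  then have "?J x \<le> I" by simp
  then show ?thesis using x I by (auto simp: is_arg_min_linorder intro: order_trans)
qed

lemma is_res_unique:
  assumes \<tau>: "\<tau> > 0" and u: "is_res \<tau> v u" and w: "is_res \<tau> v w"
  shows "u = w"
proof -
  have D: "u \<in> D" "w \<in> D" "u - w \<in> D" using u w D_diff by (auto simp: is_res_def)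
  have "(v - u) \<bullet> (u - w) = \<tau> * q u (u - w)" "(v - w) \<bullet> (u - w) = \<tau> * q w (u - w)"
    using u w D by (auto simp: is_res_def)
  then have "(u - w) \<bullet> (u - w) = - \<tau> * q (u - w) (u - w)"
    using D by (simp add: q_diff_left algebra_simps)
  also have "\<dots> \<le> 0" using \<tau> q_nonneg[OF D(3)] by simp
  finally have "u - w = 0" by (meson inner_gt_zero_iff linorder_not_le)
  then show ?thesis by simp
qed

section \<open>Algebra of the resolvents\<close>

definition res :: "real \<Rightarrow> 'h \<Rightarrow> 'h" where
  "res \<tau> v = (THE u. is_res \<tau> v u)"

lemma res: assumes "\<tau> > 0" shows "is_res \<tau> v (res \<tau> v)"
proof -
  obtain u where u: "is_res \<tau> v u" using ex_arg_min[OF assms] is_arg_min_imp_is_res[OF assms] by blast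
  show ?thesis unfolding res_def by (rule theI[of _ u]) (use u is_res_unique[OF assms] in auto)
qed

lemma res_eqI: "\<tau> > 0 \<Longrightarrow> is_res \<tau> v u \<Longrightarrow> res \<tau> v = u"
  using res is_res_unique by blast

text \<open>For the implication from right to left: some minimiser exists, it is a resolvent vector,
  and resolvent vectors are unique.\<close>

lemma is_arg_min_eq_res: "\<tau> > 0 \<Longrightarrow> is_arg_min (moreau \<tau> v) (\<lambda>u. u \<in> D) u \<longleftrightarrow> u = res \<tau> v"
  using is_arg_min_imp_is_res[of \<tau> v] ex_arg_min[of \<tau> v] res_eqI[of \<tau> v] by blast

lemma res_D: "\<tau> > 0 \<Longrightarrow> res \<tau> v \<in> D"
  and res_eq: "\<tau> > 0 \<Longrightarrow> w \<in> D \<Longrightarrow> (v - res \<tau> v) \<bullet> w = \<tau> * q (res \<tau> v) w"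
  using res by (auto simp: is_res_def)

lemma res_add: assumes "\<tau> > 0" shows "res \<tau> (x + y) = res \<tau> x + res \<tau> y"
proof (rule res_eqI[OF assms])
  have "(x + y - (res \<tau> x + res \<tau> y)) \<bullet> w = (x - res \<tau> x) \<bullet> w + (y - res \<tau> y) \<bullet> w" for w
    by (simp add: inner_simps)
  then show "is_res \<tau> (x + y) (res \<tau> x + res \<tau> y)"
    using assms by (simp add: is_res_def res_D res_eq q_simps distrib_left)
qed

lemma res_scale: assumes "\<tau> > 0" shows "res \<tau> (c *\<^sub>R x) = c *\<^sub>R res \<tau> x"
proof (rule res_eqI[OF assms])
  have "(c *\<^sub>R x - c *\<^sub>R res \<tau> x) \<bullet> w = c * ((x - res \<tau> x) \<bullet> w)" for w
    by (simp add: inner_simps algebra_simps)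
  then show "is_res \<tau> (c *\<^sub>R x) (c *\<^sub>R res \<tau> x)"
    using assms by (simp add: is_res_def res_D res_eq q_simps)
qed

lemma res_diff: "\<tau> > 0 \<Longrightarrow> res \<tau> (x - y) = res \<tau> x - res \<tau> y"
  using res_add[of \<tau> x "(-1) *\<^sub>R y"] res_scale[of \<tau> "-1" y] by simp

text \<open>Comes from testing the resolvent equation with the resolvent vector itself. It yields
  contractivity and, in the uniqueness proof, the sign of \<open>N\<close>.\<close>

lemma inner_res_nonneg: assumes "\<tau> > 0" shows "(norm (res \<tau> x))\<^sup>2 \<le> res \<tau> x \<bullet> x"
proof -
  have "0 \<le> (x - res \<tau> x) \<bullet> res \<tau> x"
    using res_eq[OF assms res_D[OF assms], of x x] q_nonneg[OF res_D[OF assms], of x] assms by simp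
  then show ?thesis by (simp add: power2_norm_eq_inner inner_diff_left inner_commute[of x])
qed

lemma norm_res_le: assumes "\<tau> > 0" shows "norm (res \<tau> x) \<le> norm x"
proof -
  have "(norm (res \<tau> x))\<^sup>2 \<le> norm (res \<tau> x) * norm x"
    by (rule order_trans[OF inner_res_nonneg[OF assms] norm_cauchy_schwarz])
  then show ?thesis by (cases "norm (res \<tau> x) = 0") (auto simp: power2_eq_square)
qed

lemma res_contraction: "\<tau> > 0 \<Longrightarrow> norm (res \<tau> x - res \<tau> y) \<le> norm (x - y)"
  using norm_res_le[of \<tau> "x - y"] by (simp add: res_diff)

lemma res_symmetric: assumes "\<tau> > 0" shows "res \<tau> x \<bullet> y = x \<bullet> res \<tau> y"
  using res_eq[OF assms res_D[OF assms], of x y] res_eq[OF assms res_D[OF assms], of y x]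
    q_sym[OF res_D[OF assms] res_D[OF assms], of x y]
  by (simp add: inner_simps inner_commute)

text \<open>If u + \<tau> L u = v, then u + \<sigma> L u = u + (\<sigma>/\<tau>) (v - u). For
  \<sigma> \<le> \<tau> the right-hand side is a convex combination of v and u, which is what the
  comparison of step sizes exploits.\<close>

lemma resolvent_identity:
  assumes "0 < \<tau>" "0 < \<sigma>"
  shows "res \<tau> v = res \<sigma> ((\<sigma>/\<tau>) *\<^sub>R v + (1 - \<sigma>/\<tau>) *\<^sub>R res \<tau> v)"
proof (rule res_eqI[symmetric, OF assms(2)])
  have "((\<sigma>/\<tau>) *\<^sub>R v + (1 - \<sigma>/\<tau>) *\<^sub>R res \<tau> v - res \<tau> v) \<bullet> w = (\<sigma>/\<tau>) * ((v - res \<tau> v) \<bullet> w)" for w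
    by (simp add: inner_simps algebra_simps)
  then show "is_res \<sigma> ((\<sigma>/\<tau>) *\<^sub>R v + (1 - \<sigma>/\<tau>) *\<^sub>R res \<tau> v) (res \<tau> v)"
    using assms by (simp add: is_res_def res_D res_eq)
qed

text \<open>\<open>gen v z\<close> says that \<open>v\<close> belongs to the domain of the self-adjoint operator of \<open>q\<close>, which maps it to \<open>z\<close>.\<close>

definition gen :: "'h \<Rightarrow> 'h \<Rightarrow> bool" where
  "gen v z \<longleftrightarrow> v \<in> D \<and> (\<forall>w\<in>D. q v w = z \<bullet> w)"

lemma gen_res: "\<tau> > 0 \<Longrightarrow> gen (res \<tau> v) ((v - res \<tau> v) /\<^sub>R \<tau>)"
  by (simp add: gen_def res_D res_eq)

lemma res_gen: "\<tau> > 0 \<Longrightarrow> gen v z \<Longrightarrow> res \<tau> (v + \<tau> *\<^sub>R z) = v"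
  by (rule res_eqI) (auto simp: gen_def is_res_def)

text \<open>Since v is the resolvent of v + \<tau> z, contractivity only has to compare the two
  arguments v and v + \<tau> z.\<close>

lemma norm_res_gen_diff: "\<tau> > 0 \<Longrightarrow> gen v z \<Longrightarrow> norm (res \<tau> v - v) \<le> \<tau> * norm z"
  using res_contraction[of \<tau> v "v + \<tau> *\<^sub>R z"] by (simp add: res_gen)

section \<open>Comparison of iterates with different step sizes\<close>

lemma res_power_contraction: "\<tau> > 0 \<Longrightarrow> norm ((res \<tau> ^^ m) x - (res \<tau> ^^ m) y) \<le> norm (x - y)"
  by (induction m) (auto intro: order_trans[OF res_contraction])

lemma norm_res_power_gen_diff:
  assumes "\<tau> > 0" "gen v z"
  shows "norm ((res \<tau> ^^ m) v - v) \<le> real m * \<tau> * norm z"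
proof (induction m)
  case (Suc m)
  have "norm ((res \<tau> ^^ Suc m) v - v) \<le> norm ((res \<tau> ^^ m) (res \<tau> v) - (res \<tau> ^^ m) v) + norm ((res \<tau> ^^ m) v - v)"
    using norm_triangle_ineq[of "(res \<tau> ^^ m) (res \<tau> v) - (res \<tau> ^^ m) v" "(res \<tau> ^^ m) v - v"]
    by (simp add: funpow_swap1)
  also have "\<dots> \<le> \<tau> * norm z + real m * \<tau> * norm z"
    using Suc norm_res_gen_diff[OF assms] res_power_contraction[OF assms(1), of m "res \<tau> v" v] by linarith
  finally show ?case by (simp add: algebra_simps)
qed simp

text \<open>The double induction of Crandall--Liggett in Kobayashi's form: by the resolvent identity the distances
  \<open>a m n\<close> satisfy \<open>a m n \<le> \<alpha> a (m-1) (n-1) + (1-\<alpha>) a m (n-1)\<close> with \<open>\<alpha> = \<sigma>/\<tau>\<close>, and the square root below is a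
  supersolution of this recursion.\<close>

lemma Kobayashi_le:
  assumes "0 < \<sigma>" "\<sigma> \<le> \<tau>" "gen v z"
  shows "norm ((res \<tau> ^^ m) v - (res \<sigma> ^^ n) v)
    \<le> norm z * sqrt ((real m * \<tau> - real n * \<sigma>)\<^sup>2 + real m * \<tau>\<^sup>2 + real n * \<sigma>\<^sup>2)"
proof (induction n arbitrary: m)
  case 0
  have "real m * \<tau> \<le> sqrt ((real m * \<tau> - real 0 * \<sigma>)\<^sup>2 + real m * \<tau>\<^sup>2 + real 0 * \<sigma>\<^sup>2)"
    by (rule real_le_rsqrt) simp
  then have "real m * \<tau> * norm z \<le> sqrt ((real m * \<tau> - real 0 * \<sigma>)\<^sup>2 + real m * \<tau>\<^sup>2 + real 0 * \<sigma>\<^sup>2) * norm z"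
    by (intro mult_right_mono) auto
  then show ?case
    using norm_res_power_gen_diff[of \<tau> v z m] assms by (simp add: mult.commute)
next
  case (Suc n)
  show ?case
  proof (cases m)
    case 0
    have "real (Suc n) * \<sigma> \<le> sqrt ((real 0 * \<tau> - real (Suc n) * \<sigma>)\<^sup>2 + real 0 * \<tau>\<^sup>2 + real (Suc n) * \<sigma>\<^sup>2)"
      by (rule real_le_rsqrt) simp
    then have "real (Suc n) * \<sigma> * norm z \<le> sqrt ((real 0 * \<tau> - real (Suc n) * \<sigma>)\<^sup>2 + real 0 * \<tau>\<^sup>2 + real (Suc n) * \<sigma>\<^sup>2) * norm z"
      by (intro mult_right_mono) auto
    then show ?thesis
      using norm_res_power_gen_diff[of \<sigma> v z "Suc n"] assms 0 by (simp add: mult.commute norm_minus_commute del: funpow.simps)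
  next
    case (Suc k)
    define \<alpha> where "\<alpha> = \<sigma> / \<tau>"
    have \<tau>: "\<tau> > 0" using assms by simp
    have \<alpha>: "0 \<le> \<alpha>" "\<alpha> \<le> 1" and \<alpha>\<tau>: "\<alpha> * \<tau> = \<sigma>" using assms by (auto simp: \<alpha>_def)
    define y where "y = (res \<tau> ^^ k) v"
    define w where "w = (res \<sigma> ^^ n) v"
    define D1 where "D1 = (real k * \<tau> - real n * \<sigma>)\<^sup>2 + real k * \<tau>\<^sup>2 + real n * \<sigma>\<^sup>2"
    define D2 where "D2 = (real m * \<tau> - real n * \<sigma>)\<^sup>2 + real m * \<tau>\<^sup>2 + real n * \<sigma>\<^sup>2"
    define D3 where "D3 = (real m * \<tau> - real (Suc n) * \<sigma>)\<^sup>2 + real m * \<tau>\<^sup>2 + real (Suc n) * \<sigma>\<^sup>2"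
    have D0: "0 \<le> D1" "0 \<le> D2" by (auto simp: D1_def D2_def)
    have m: "real m = real k + 1" using Suc by simp
    \<comment> \<open>Supersolution property: expanding the squares with \<alpha> \<tau> = \<sigma>,
      the terms in \<tau> \<sigma> from lowering m to k cancel, and a surplus of 2 \<sigma>^2
      remains.\<close>
    have "D3 - (\<alpha> * D1 + (1 - \<alpha>) * D2) = 2 * \<sigma>\<^sup>2"
      unfolding D1_def D2_def D3_def m \<alpha>\<tau>[symmetric] by (simp add: power2_eq_square algebra_simps)
    then have D3: "\<alpha> * D1 + (1 - \<alpha>) * D2 \<le> D3" using zero_le_power2[of \<sigma>] by linarith
    \<comment> \<open>Concavity of the square root, with the defect written as a square.\<close>
    have cvx: "\<alpha> * sqrt D1 + (1 - \<alpha>) * sqrt D2 \<le> sqrt D3"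
    proof (rule real_le_rsqrt)
      have "(\<alpha> * sqrt D1 + (1 - \<alpha>) * sqrt D2)\<^sup>2
          = \<alpha> * (sqrt D1)\<^sup>2 + (1 - \<alpha>) * (sqrt D2)\<^sup>2 - \<alpha> * (1 - \<alpha>) * (sqrt D1 - sqrt D2)\<^sup>2"
        by (simp add: power2_eq_square algebra_simps)
      also have "\<dots> \<le> \<alpha> * D1 + (1 - \<alpha>) * D2" using \<alpha> D0 by simp
      finally show "(\<alpha> * sqrt D1 + (1 - \<alpha>) * sqrt D2)\<^sup>2 \<le> D3" using D3 by linarith
    qed
    \<comment> \<open>The resolvent identity rewrites the last step of size \<tau> as one of size
      \<sigma>, so that contractivity removes one application of \<open>res \<sigma>\<close> on both
      sides.\<close>
    have "norm ((res \<tau> ^^ m) v - (res \<sigma> ^^ Suc n) v) = norm (res \<sigma> (\<alpha> *\<^sub>R y + (1 - \<alpha>) *\<^sub>R res \<tau> y) - res \<sigma> w)"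
      using resolvent_identity[OF \<tau> assms(1), of y] by (simp add: Suc y_def w_def \<alpha>_def)
    also have "\<dots> \<le> norm (\<alpha> *\<^sub>R y + (1 - \<alpha>) *\<^sub>R res \<tau> y - w)" by (rule res_contraction[OF assms(1)])
    also have "\<alpha> *\<^sub>R y + (1 - \<alpha>) *\<^sub>R res \<tau> y - w = \<alpha> *\<^sub>R (y - w) + (1 - \<alpha>) *\<^sub>R (res \<tau> y - w)"
      by (simp add: algebra_simps)
    also have "norm \<dots> \<le> \<alpha> * norm (y - w) + (1 - \<alpha>) * norm (res \<tau> y - w)"
      using norm_triangle_ineq[of "\<alpha> *\<^sub>R (y - w)" "(1 - \<alpha>) *\<^sub>R (res \<tau> y - w)"] \<alpha> by simp
    also have "\<dots> \<le> \<alpha> * (norm z * sqrt D1) + (1 - \<alpha>) * (norm z * sqrt D2)"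
      using Suc.IH[of k] Suc.IH[of m] \<alpha> unfolding y_def w_def D1_def D2_def Suc
      by (intro add_mono mult_left_mono) auto
    also have "\<dots> = norm z * (\<alpha> * sqrt D1 + (1 - \<alpha>) * sqrt D2)" by (simp add: algebra_simps)
    also have "\<dots> \<le> norm z * sqrt D3" by (intro mult_left_mono cvx) auto
    finally show ?thesis by (simp add: D3_def)
  qed
qed

lemma Kobayashi:
  assumes "0 < \<sigma>" "0 < \<tau>" "gen v z"
  shows "norm ((res \<tau> ^^ m) v - (res \<sigma> ^^ n) v)
    \<le> norm z * sqrt ((real m * \<tau> - real n * \<sigma>)\<^sup>2 + real m * \<tau>\<^sup>2 + real n * \<sigma>\<^sup>2)"
proof (cases "\<sigma> \<le> \<tau>")
  case False
  then show ?thesis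
    using Kobayashi_le[of \<tau> \<sigma> v z n m] assms
    by (simp add: norm_minus_commute power2_commute add.commute add.left_commute)
qed (use Kobayashi_le assms in blast)

text \<open>Discrete energy inequality: the loss of energy in one step pays for the squared
  displacement. Testing the resolvent equation with v - u gives \<tau> (q u v - q u u); this is
  nonnegative, hence q u u \<le> q u v, and with 2 q u v \<le> q u u + q v v it follows that q u v
  \<le> q v v.\<close>

lemma norm_res_diff_le:
  assumes "\<tau> > 0" "v \<in> D"
  shows "(norm (v - res \<tau> v))\<^sup>2 \<le> \<tau> * (q v v - q (res \<tau> v) (res \<tau> v))"
proof -
  let ?u = "res \<tau> v"
  have u: "?u \<in> D" by (rule res_D[OF assms(1)])
  have "(norm (v - ?u))\<^sup>2 = \<tau> * (q ?u v - q ?u ?u)"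
    using res_eq[OF assms(1) D_diff[OF assms(2) u]] u assms by (simp add: power2_norm_eq_inner q_diff_right)
  moreover have "2 * q ?u v \<le> q ?u ?u + q v v"
    using q_nonneg[OF D_diff[OF assms(2) u]] q_sym[OF u assms(2)] u assms by (simp add: q_simps)
  moreover have "0 \<le> (norm (v - ?u))\<^sup>2" by simp
  ultimately have "q ?u v - q ?u ?u \<ge> 0" using assms(1) by (simp add: zero_le_mult_iff)
  then have "q ?u v - q ?u ?u \<le> q v v - q ?u ?u"
    using \<open>2 * q ?u v \<le> q ?u ?u + q v v\<close> by linarith
  then show ?thesis using \<open>(norm (v - ?u))\<^sup>2 = \<tau> * (q ?u v - q ?u ?u)\<close> assms(1) by simp
qed

lemma q_res_le: assumes "\<tau> > 0" "v \<in> D" shows "q (res \<tau> v) (res \<tau> v) \<le> q v v"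
proof -
  have "0 \<le> \<tau> * (q v v - q (res \<tau> v) (res \<tau> v))"
    using norm_res_diff_le[OF assms] by (meson order_trans zero_le_power2)
  then show ?thesis using assms(1) by (simp add: zero_le_mult_iff)
qed

text \<open>For \<open>v \<in> D\<close> the Kobayashi estimate is applied to \<open>res \<lambda> v\<close>, with \<open>\<lambda>\<close> chosen to balance the two errors.\<close>

lemma res_power_dist:
  assumes "0 < \<sigma>" "0 < \<tau>" "v \<in> D"
    and \<Delta>: "(real m * \<tau> - real n * \<sigma>)\<^sup>2 + real m * \<tau>\<^sup>2 + real n * \<sigma>\<^sup>2 \<le> \<Delta>"
  shows "norm ((res \<tau> ^^ m) v - (res \<sigma> ^^ n) v) \<le> 3 * sqrt (q v v) * sqrt (sqrt \<Delta>)"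
proof -
  define E where "E = (real m * \<tau> - real n * \<sigma>)\<^sup>2 + real m * \<tau>\<^sup>2 + real n * \<sigma>\<^sup>2"
  have E0: "0 \<le> E" by (auto simp: E_def)
  have "norm ((res \<tau> ^^ m) v - (res \<sigma> ^^ n) v) \<le> 3 * sqrt (q v v) * sqrt (sqrt E)"
  proof (cases "E = 0")
    \<comment> \<open>A vanishing E forces m = n = 0, and both iterates are v. The case is split off
      because the parameter l below has to be positive.\<close>
    case True
    have a: "0 \<le> real m * \<tau>\<^sup>2" "0 \<le> real n * \<sigma>\<^sup>2" "0 \<le> (real m * \<tau> - real n * \<sigma>)\<^sup>2" by auto
    then have "real m * \<tau>\<^sup>2 = 0" "real n * \<sigma>\<^sup>2 = 0" using True unfolding E_def by linarith+
    then show ?thesis using assms E0 q_nonneg[OF assms(3)] by auto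
  next
    case False
    \<comment> \<open>With this choice the Kobayashi bound norm z * sqrt E for z = (v - u) / l
      equals norm (v - u), which also bounds each of the two replacement errors; hence the factor
      3.\<close>
    define l where "l = sqrt E"
    have l: "l > 0" using False E0 by (simp add: l_def)
    define u where "u = res l v"
    have vu: "norm (v - u) \<le> sqrt (l * q v v)"
    proof (rule real_le_rsqrt)
      have "l * (q v v - q u u) \<le> l * q v v"
        using q_nonneg[OF res_D[OF l]] l by (simp add: u_def)
      then show "(norm (v - u))\<^sup>2 \<le> l * q v v"
        using norm_res_diff_le[OF l assms(3)] unfolding u_def by linarith
    qed
    have "norm ((res \<tau> ^^ m) u - (res \<sigma> ^^ n) u) \<le> norm ((v - u) /\<^sub>R l) * l"
      using Kobayashi[OF assms(1,2) gen_res[OF l, of v], of m n] by (simp add: l_def E_def u_def)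
    also have "\<dots> = norm (v - u)" using l by simp
    finally have a: "norm ((res \<tau> ^^ m) u - (res \<sigma> ^^ n) u) \<le> norm (v - u)" .
    have "norm ((res \<tau> ^^ m) v - (res \<sigma> ^^ n) v) = norm (((res \<tau> ^^ m) v - (res \<tau> ^^ m) u)
        + ((res \<tau> ^^ m) u - (res \<sigma> ^^ n) u) + ((res \<sigma> ^^ n) u - (res \<sigma> ^^ n) v))" by simp
    also have "\<dots> \<le> norm ((res \<tau> ^^ m) v - (res \<tau> ^^ m) u) + norm ((res \<tau> ^^ m) u - (res \<sigma> ^^ n) u)
        + norm ((res \<sigma> ^^ n) u - (res \<sigma> ^^ n) v)"
      by (intro norm_triangle_le add_mono norm_triangle_ineq order_refl)
    also have "\<dots> \<le> 3 * norm (v - u)"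
      using res_power_contraction[OF assms(2), of m v u] res_power_contraction[OF assms(1), of n u v] a
      by (simp add: norm_minus_commute)
    also have "\<dots> \<le> 3 * sqrt (l * q v v)" using vu by simp
    finally show ?thesis by (simp add: l_def real_sqrt_mult mult.commute mult.left_commute)
  qed
  also have "\<dots> \<le> 3 * sqrt (q v v) * sqrt (sqrt \<Delta>)"
    using \<Delta> q_nonneg[OF assms(3)] by (intro mult_left_mono) (auto simp: E_def)
  finally show ?thesis .
qed

section \<open>Smoothing by the iterates\<close>

lemma res_power_D: "\<tau> > 0 \<Longrightarrow> v \<in> D \<Longrightarrow> (res \<tau> ^^ n) v \<in> D"
  by (cases n) (auto simp: res_D)

lemma q_res_power_le: "\<tau> > 0 \<Longrightarrow> v \<in> D \<Longrightarrow> q ((res \<tau> ^^ n) v) ((res \<tau> ^^ n) v) \<le> q v v"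
  by (induction n) (auto intro: order_trans[OF q_res_le] simp: res_power_D)

text \<open>Regularisation: the squared speeds sum to at most the initial energy, and the speed does not increase.\<close>

lemma gen_res_power:
  assumes "\<tau> > 0" "v \<in> D" "n \<noteq> 0"
  shows "\<exists>z. gen ((res \<tau> ^^ n) v) z \<and> norm z \<le> sqrt (q v v / (real n * \<tau>))"
proof -
  define d where "d k = norm ((res \<tau> ^^ k) v - (res \<tau> ^^ Suc k) v)" for k
  have anti: "d (Suc k) \<le> d k" for k
    using res_contraction[OF assms(1), of "(res \<tau> ^^ k) v" "(res \<tau> ^^ Suc k) v"] by (simp add: d_def)
  \<comment> \<open>The displacements decrease, so k + 1 copies of the last square are at most the
    sum of all squares, and that sum telescopes to the energy lost.\<close>
  have "real (Suc k) * (d k)\<^sup>2 \<le> \<tau> * (q v v - q ((res \<tau> ^^ Suc k) v) ((res \<tau> ^^ Suc k) v))" for k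
  proof (induction k)
    case 0 then show ?case using norm_res_diff_le[OF assms(1,2)] by (simp add: d_def)
  next
    case (Suc k)
    have "(d (Suc k))\<^sup>2 \<le> (d k)\<^sup>2" using anti by (intro power_mono) (auto simp: d_def)
    then have "real (Suc k) * (d (Suc k))\<^sup>2 \<le> real (Suc k) * (d k)\<^sup>2" by (intro mult_left_mono) auto
    moreover have "(d (Suc k))\<^sup>2 \<le> \<tau> * (q ((res \<tau> ^^ Suc k) v) ((res \<tau> ^^ Suc k) v)
        - q ((res \<tau> ^^ Suc (Suc k)) v) ((res \<tau> ^^ Suc (Suc k)) v))"
      using norm_res_diff_le[OF assms(1) res_power_D[OF assms(1,2)], of "Suc k"] by (simp add: d_def)
    ultimately show ?case using Suc by (simp add: algebra_simps)
  qed
  note that = this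
  have bd: "real (Suc k) * (d k)\<^sup>2 \<le> \<tau> * q v v" for k
  proof -
    have "\<tau> * (q v v - q ((res \<tau> ^^ Suc k) v) ((res \<tau> ^^ Suc k) v)) \<le> \<tau> * q v v"
      using q_nonneg[OF res_power_D[OF assms(1,2)], of "Suc k"] assms(1) by (intro mult_left_mono) auto
    then show ?thesis using that[of k] by linarith
  qed
  obtain k where k: "n = Suc k" using assms(3) not0_implies_Suc by blast
  let ?z = "((res \<tau> ^^ k) v - (res \<tau> ^^ n) v) /\<^sub>R \<tau>"
  have "gen ((res \<tau> ^^ n) v) ?z" using gen_res[OF assms(1), of "(res \<tau> ^^ k) v"] by (simp add: k)
  moreover have "norm ?z \<le> sqrt (q v v / (real n * \<tau>))"
  proof (rule real_le_rsqrt)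
    have "(norm ?z)\<^sup>2 = (d k)\<^sup>2 / \<tau>\<^sup>2" using assms(1) by (simp add: d_def k power_divide divide_inverse mult.commute power_mult_distrib power_inverse)
    also have "\<dots> = (real (Suc k) * (d k)\<^sup>2) / (real n * \<tau>\<^sup>2)" using k by (simp del: of_nat_Suc)
    also have "\<dots> \<le> (\<tau> * q v v) / (real n * \<tau>\<^sup>2)"
      using bd[of k] assms(1) by (intro divide_right_mono) auto
    also have "\<dots> = q v v / (real n * \<tau>)" using assms(1) by (simp add: power2_eq_square)
    finally show "(norm ?z)\<^sup>2 \<le> q v v / (real n * \<tau>)" .
  qed
  ultimately show ?thesis by blast
qed

text \<open>The operator images only have to stay bounded, not to converge; this is how norm
  convergence becomes form convergence.\<close>

lemma q_gen_diff_le: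
  assumes "gen u z" "gen u' z'"
  shows "q (u - u') (u - u') \<le> (norm z + norm z') * norm (u - u')"
proof -
  have "q (u - u') (u - u') = (z - z') \<bullet> (u - u')"
    using assms by (simp add: gen_def q_diff_left D_diff inner_diff_left)
  also have "\<dots> \<le> norm (z - z') * norm (u - u')" by (rule norm_cauchy_schwarz)
  also have "\<dots> \<le> (norm z + norm z') * norm (u - u')" by (intro mult_right_mono norm_triangle_ineq4) auto
  finally show ?thesis .
qed

end

subsection \<open>The limit of the implicit Euler scheme\<close>

lemma nat_ceiling_divide_bounds:
  fixes t \<tau> :: real
  assumes "0 \<le> t" "0 < \<tau>"
  shows "t \<le> real (nat \<lceil>t / \<tau>\<rceil>) * \<tau>" "real (nat \<lceil>t / \<tau>\<rceil>) * \<tau> < t + \<tau>"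
proof -
  have nn: "real (nat \<lceil>t / \<tau>\<rceil>) = of_int \<lceil>t / \<tau>\<rceil>" using assms by simp
  have c: "t / \<tau> \<le> of_int \<lceil>t / \<tau>\<rceil>" "of_int \<lceil>t / \<tau>\<rceil> < t / \<tau> + 1" by linarith+
  show "t \<le> real (nat \<lceil>t / \<tau>\<rceil>) * \<tau>"
    unfolding nn using c(1) assms(2) by (simp only: pos_divide_le_eq)
  show "real (nat \<lceil>t / \<tau>\<rceil>) * \<tau> < t + \<tau>"
    unfolding nn using c(2) assms by (simp add: field_simps)
qed

lemma tendsto_nat_ceiling_divide:
  fixes t :: real
  assumes "0 \<le> t"
  shows "((\<lambda>\<tau>. real (nat \<lceil>t / \<tau>\<rceil>) * \<tau>) \<longlongrightarrow> t) (at_right 0)"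
proof (rule tendsto_sandwich[where f = "\<lambda>_. t" and h = "\<lambda>\<tau>. t + \<tau>"])
  show "\<forall>\<^sub>F \<tau> in at_right 0. t \<le> real (nat \<lceil>t / \<tau>\<rceil>) * \<tau>"
    using nat_ceiling_divide_bounds(1)[OF assms] by (auto simp: eventually_at_filter)
  show "\<forall>\<^sub>F \<tau> in at_right 0. real (nat \<lceil>t / \<tau>\<rceil>) * \<tau> \<le> t + \<tau>"
    using nat_ceiling_divide_bounds(2)[OF assms]
    by (auto simp: eventually_at_filter intro!: always_eventually less_imp_le)
  show "((\<lambda>\<tau>. t + \<tau>) \<longlongrightarrow> t) (at_right 0)" by (auto intro!: tendsto_eq_intros)
qed auto

context closed_form begin

definition euler :: "'h \<Rightarrow> real \<Rightarrow> real \<Rightarrow> 'h" where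
  "euler v \<tau> t = (res \<tau> ^^ nat \<lceil>t / \<tau>\<rceil>) v"

definition Theta :: "real \<Rightarrow> real \<Rightarrow> real \<Rightarrow> real \<Rightarrow> real" where
  "Theta \<tau> t \<sigma> s = (\<bar>t - s\<bar> + \<tau> + \<sigma>)\<^sup>2 + (t + \<tau>) * \<tau> + (s + \<sigma>) * \<sigma>"

lemma euler_dist:
  assumes v: "v \<in> D" and "0 < \<tau>" "0 < \<sigma>" "0 \<le> t" "0 \<le> s"
  shows "norm (euler v \<tau> t - euler v \<sigma> s) \<le> 3 * sqrt (q v v) * sqrt (sqrt (Theta \<tau> t \<sigma> s))"
  unfolding euler_def
proof (rule res_power_dist[OF assms(3,2,1)])
  define m n where "m = real (nat \<lceil>t / \<tau>\<rceil>)" and "n = real (nat \<lceil>s / \<sigma>\<rceil>)"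
  have m: "t \<le> m * \<tau>" "m * \<tau> \<le> t + \<tau>" and n: "s \<le> n * \<sigma>" "n * \<sigma> \<le> s + \<sigma>"
    using nat_ceiling_divide_bounds[of t \<tau>] nat_ceiling_divide_bounds[of s \<sigma>] assms
    by (auto simp: m_def n_def)
  have "(m * \<tau> - n * \<sigma>)\<^sup>2 \<le> (\<bar>t - s\<bar> + \<tau> + \<sigma>)\<^sup>2"
    by (rule abs_le_square_iff[THEN iffD1]) (use m n assms in linarith)
  moreover have "m * \<tau>\<^sup>2 \<le> (t + \<tau>) * \<tau>" "n * \<sigma>\<^sup>2 \<le> (s + \<sigma>) * \<sigma>"
    using mult_right_mono[OF m(2), of \<tau>] mult_right_mono[OF n(2), of \<sigma>] assms
    by (simp_all add: power2_eq_square mult.assoc)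
  ultimately show "(m * \<tau> - n * \<sigma>)\<^sup>2 + m * \<tau>\<^sup>2 + n * \<sigma>\<^sup>2 \<le> Theta \<tau> t \<sigma> s"
    by (simp add: Theta_def)
qed

text \<open>One fixed sequence of steps defines the limit; \<open>euler_tendsto\<close> shows that
  all step sizes tending to 0 give the same one.\<close>

definition flow :: "'h \<Rightarrow> real \<Rightarrow> 'h" where
  "flow v t = lim (\<lambda>n. euler v (inverse (real (Suc n))) t)"

lemma euler_inverse_tendsto:
  assumes v: "v \<in> D" and t: "0 \<le> t"
  shows "(\<lambda>n. euler v (inverse (real (Suc n))) t) \<longlonglongrightarrow> flow v t"
proof -
  let ?X = "\<lambda>n. euler v (inverse (real (Suc n))) t"
  have "Cauchy ?X"
  proof (rule CauchyI)
    fix e :: real assume e: "e > 0"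
    \<comment> \<open>\<open>Theta\<close> is monotone in both step sizes, so g at the step 1 / (N +
      1) bounds all later pairs, and g is continuous at 0 with g 0 = 0.\<close>
    define g where "g r = 3 * sqrt (q v v) * sqrt (sqrt (Theta r t r t))" for r
    have "(g \<longlongrightarrow> g 0) (at 0)" unfolding g_def Theta_def by (intro tendsto_intros)
    moreover have "g 0 = 0" by (simp add: g_def Theta_def)
    ultimately have "\<forall>\<^sub>F r in at 0. g r < e" using e order_tendstoD(2) by metis
    then obtain d where d: "d > 0" "\<And>r. r \<noteq> 0 \<Longrightarrow> \<bar>r\<bar> < d \<Longrightarrow> g r < e"
      by (auto simp: eventually_at dist_real_def)
    obtain N where N: "inverse (real (Suc N)) < d" using reals_Archimedean[OF d(1)] by blast
    have "norm (?X m - ?X n) < e" if "m \<ge> N" "n \<ge> N" for m n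
    proof -
      let ?r = "inverse (real (Suc N))"
      have r: "inverse (real (Suc m)) \<le> ?r" "inverse (real (Suc n)) \<le> ?r"
        using that by (simp_all add: le_imp_inverse_le)
      have "Theta (inverse (real (Suc m))) t (inverse (real (Suc n))) t \<le> Theta ?r t ?r t"
        unfolding Theta_def using r t by (intro add_mono mult_mono power_mono) (auto intro!: add_nonneg_nonneg)
      then have "3 * sqrt (q v v) * sqrt (sqrt (Theta (inverse (real (Suc m))) t (inverse (real (Suc n))) t)) \<le> g ?r"
        unfolding g_def using q_nonneg[OF v] by (intro mult_left_mono real_sqrt_le_mono) auto
      moreover have "g ?r < e" using N by (intro d(2)) auto
      ultimately show ?thesis
        using euler_dist[OF v, of "inverse (real (Suc m))" "inverse (real (Suc n))" t t] t by auto
    qed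
    then show "\<exists>N. \<forall>m\<ge>N. \<forall>n\<ge>N. norm (?X m - ?X n) < e" by blast
  qed
  then show ?thesis unfolding flow_def using Cauchy_convergent convergent_LIMSEQ_iff by blast
qed

lemma euler_flow_dist:
  assumes v: "v \<in> D" and "0 < \<tau>" "0 \<le> t" "0 \<le> s"
  shows "norm (euler v \<tau> t - flow v s) \<le> 3 * sqrt (q v v) * sqrt (sqrt (Theta \<tau> t 0 s))"
proof (rule tendsto_le[OF sequentially_bot])
  show "(\<lambda>n. norm (euler v \<tau> t - euler v (inverse (real (Suc n))) s)) \<longlonglongrightarrow> norm (euler v \<tau> t - flow v s)"
    by (intro tendsto_intros euler_inverse_tendsto v assms)
  show "(\<lambda>n. 3 * sqrt (q v v) * sqrt (sqrt (Theta \<tau> t (inverse (real (Suc n))) s)))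
      \<longlonglongrightarrow> 3 * sqrt (q v v) * sqrt (sqrt (Theta \<tau> t 0 s))"
    unfolding Theta_def by (intro tendsto_intros LIMSEQ_inverse_real_of_nat)
  show "\<forall>\<^sub>F n in sequentially. norm (euler v \<tau> t - euler v (inverse (real (Suc n))) s)
      \<le> 3 * sqrt (q v v) * sqrt (sqrt (Theta \<tau> t (inverse (real (Suc n))) s))"
    using assms by (intro always_eventually allI euler_dist) auto
qed

lemma euler_tendsto:
  assumes v: "v \<in> D" and t: "0 \<le> t"
  shows "((\<lambda>\<tau>. euler v \<tau> t) \<longlongrightarrow> flow v t) (at_right 0)"
proof (rule Lim_null[THEN iffD2], rule tendsto_norm_zero_cancel, rule tendsto_sandwich[where f = "\<lambda>_. 0"])
  show "\<forall>\<^sub>F \<tau> in at_right 0. norm (euler v \<tau> t - flow v t) \<le> 3 * sqrt (q v v) * sqrt (sqrt (Theta \<tau> t 0 t))"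
    using euler_flow_dist[OF v _ t t] by (auto simp: eventually_at_filter)
  have "((\<lambda>\<tau>. 3 * sqrt (q v v) * sqrt (sqrt (Theta \<tau> t 0 t))) \<longlongrightarrow> 3 * sqrt (q v v) * sqrt (sqrt (Theta 0 t 0 t))) (at_right 0)"
    unfolding Theta_def by (intro tendsto_intros)
  then show "((\<lambda>\<tau>. 3 * sqrt (q v v) * sqrt (sqrt (Theta \<tau> t 0 t))) \<longlongrightarrow> 0) (at_right 0)"
    by (simp add: Theta_def)
qed auto

lemma flow_0: "v \<in> D \<Longrightarrow> flow v 0 = v"
  using euler_inverse_tendsto[of v 0] LIMSEQ_unique[of "\<lambda>_. v"] by (simp add: euler_def)

lemma flow_dist:
  assumes v: "v \<in> D" and "0 \<le> t" "0 \<le> s"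
  shows "norm (flow v t - flow v s) \<le> 3 * sqrt (q v v) * sqrt \<bar>t - s\<bar>"
proof (rule tendsto_le[OF sequentially_bot])
  show "(\<lambda>n. norm (euler v (inverse (real (Suc n))) t - flow v s)) \<longlonglongrightarrow> norm (flow v t - flow v s)"
    by (intro tendsto_intros euler_inverse_tendsto v assms)
  have "(\<lambda>n. 3 * sqrt (q v v) * sqrt (sqrt (Theta (inverse (real (Suc n))) t 0 s)))
      \<longlonglongrightarrow> 3 * sqrt (q v v) * sqrt (sqrt (Theta 0 t 0 s))"
    unfolding Theta_def by (intro tendsto_intros LIMSEQ_inverse_real_of_nat)
  \<comment> \<open>With both steps equal to 0, \<open>Theta\<close> is the square of t - s, so the
    two roots leave sqrt |t - s|.\<close>
  then show "(\<lambda>n. 3 * sqrt (q v v) * sqrt (sqrt (Theta (inverse (real (Suc n))) t 0 s)))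
      \<longlonglongrightarrow> 3 * sqrt (q v v) * sqrt \<bar>t - s\<bar>"
    by (simp add: Theta_def)
  show "\<forall>\<^sub>F n in sequentially. norm (euler v (inverse (real (Suc n))) t - flow v s)
      \<le> 3 * sqrt (q v v) * sqrt (sqrt (Theta (inverse (real (Suc n))) t 0 s))"
    using assms by (intro always_eventually allI euler_flow_dist) auto
qed

lemma continuous_on_flow:
  assumes v: "v \<in> D" shows "continuous_on {0..} (flow v)"
  unfolding continuous_on_def
proof
  fix s :: real assume s: "s \<in> {0..}"
  show "(flow v \<longlongrightarrow> flow v s) (at s within {0..})"
  proof (rule Lim_null[THEN iffD2], rule tendsto_norm_zero_cancel, rule tendsto_sandwich[where f = "\<lambda>_. 0"])
    show "\<forall>\<^sub>F t in at s within {0..}. norm (flow v t - flow v s) \<le> 3 * sqrt (q v v) * sqrt \<bar>t - s\<bar>"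
      using flow_dist[OF v, of _ s] s by (auto simp: eventually_at_filter)
    have "((\<lambda>t. 3 * sqrt (q v v) * sqrt \<bar>t - s\<bar>) \<longlongrightarrow> 3 * sqrt (q v v) * sqrt \<bar>s - s\<bar>) (at s within {0..})"
      by (intro tendsto_intros)
    then show "((\<lambda>t. 3 * sqrt (q v v) * sqrt \<bar>t - s\<bar>) \<longlongrightarrow> 0) (at s within {0..})" by simp
  qed auto
qed

section \<open>Convergence in the form norm at positive times\<close>

lemma gen_euler:
  assumes "v \<in> D" "0 < \<tau>" "0 < t"
  shows "\<exists>z. gen (euler v \<tau> t) z \<and> norm z \<le> sqrt (q v v / t)"
proof -
  let ?n = "nat \<lceil>t / \<tau>\<rceil>"
  \<comment> \<open>Rounding up makes n \<tau> at least t, so the smoothing bound becomes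
    independent of the step size; t > 0 also excludes n = 0.\<close>
  have n: "t \<le> real ?n * \<tau>" using nat_ceiling_divide_bounds(1)[of t \<tau>] assms by simp
  then have "?n \<noteq> 0" using assms by (metis mult_zero_left not_le of_nat_0)
  then obtain z where z: "gen (euler v \<tau> t) z" "norm z \<le> sqrt (q v v / (real ?n * \<tau>))"
    using gen_res_power[OF assms(2,1)] unfolding euler_def by blast
  have "sqrt (q v v / (real ?n * \<tau>)) \<le> sqrt (q v v / t)"
    using n assms q_nonneg[OF assms(1)] by (intro real_sqrt_le_mono divide_left_mono) auto
  then show ?thesis using z by (meson order_trans)
qed

lemma q_euler_dist:
  assumes v: "v \<in> D" and "0 < \<tau>" "0 < \<sigma>" "0 < \<delta>" "\<delta> \<le> t" "\<delta> \<le> s"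
  shows "q (euler v \<tau> t - euler v \<sigma> s) (euler v \<tau> t - euler v \<sigma> s)
    \<le> 2 * sqrt (q v v / \<delta>) * norm (euler v \<tau> t - euler v \<sigma> s)"
proof -
  obtain z where z: "gen (euler v \<tau> t) z" "norm z \<le> sqrt (q v v / t)" using gen_euler[of v \<tau> t] assms by auto
  obtain z' where z': "gen (euler v \<sigma> s) z'" "norm z' \<le> sqrt (q v v / s)" using gen_euler[of v \<sigma> s] assms by auto
  have "sqrt (q v v / t) \<le> sqrt (q v v / \<delta>)" "sqrt (q v v / s) \<le> sqrt (q v v / \<delta>)"
    using assms q_nonneg[OF v] by (auto intro!: real_sqrt_le_mono divide_left_mono)
  then have "(norm z + norm z') * norm (euler v \<tau> t - euler v \<sigma> s)
      \<le> 2 * sqrt (q v v / \<delta>) * norm (euler v \<tau> t - euler v \<sigma> s)"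
    using z z' by (intro mult_right_mono norm_ge_zero) linarith
  then show ?thesis using q_gen_diff_le[OF z(1) z'(1)] by linarith
qed

lemma euler_D: "v \<in> D \<Longrightarrow> 0 < \<tau> \<Longrightarrow> euler v \<tau> t \<in> D"
  unfolding euler_def by (rule res_power_D)

text \<open>At t > 0 the operator images of the Euler approximations are bounded, so their Cauchy
  property in norm carries over to the form and closedness applies. Its limit must be the norm limit
  already known.\<close>

lemma flow_D_approx:
  assumes v: "v \<in> D" and t: "0 < t"
  shows "flow v t \<in> D"
    and "(\<lambda>n. q (euler v (inverse (real (Suc n))) t - flow v t) (euler v (inverse (real (Suc n))) t - flow v t)) \<longlonglongrightarrow> 0"
proof -
  let ?X = "\<lambda>n. euler v (inverse (real (Suc n))) t"
  have X: "?X n \<in> D" for n by (rule euler_D[OF v]) simp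
  have lim: "?X \<longlonglongrightarrow> flow v t" using euler_inverse_tendsto[OF v] t by simp
  have C: "Cauchy ?X" by (rule LIMSEQ_imp_Cauchy[OF lim])
  have small: "\<exists>N. \<forall>m\<ge>N. \<forall>n\<ge>N. q (?X m - ?X n) (?X m - ?X n) < e" if e: "e > 0" for e
  proof -
    \<comment> \<open>The summand 1 covers q v v = 0, since K is divided by.\<close>
    define K where "K = 2 * sqrt (q v v / t) + 1"
    have K: "K > 0" using q_nonneg[OF v] t by (simp add: K_def add_nonneg_pos)
    obtain N where N: "\<And>m n. m \<ge> N \<Longrightarrow> n \<ge> N \<Longrightarrow> norm (?X m - ?X n) < e / K"
      using CauchyD[OF C, of "e / K"] e K by auto
    have "q (?X m - ?X n) (?X m - ?X n) < e" if "m \<ge> N" "n \<ge> N" for m n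
    proof -
      have "q (?X m - ?X n) (?X m - ?X n) \<le> 2 * sqrt (q v v / t) * norm (?X m - ?X n)"
        using t by (intro q_euler_dist[OF v]) auto
      also have "\<dots> \<le> K * norm (?X m - ?X n)" by (intro mult_right_mono) (auto simp: K_def)
      also have "\<dots> < e" using N[OF that] K by (simp add: field_simps)
      finally show ?thesis .
    qed
    then show ?thesis by blast
  qed
  obtain x where x: "x \<in> D" "?X \<longlonglongrightarrow> x" "(\<lambda>n. q (?X n - x) (?X n - x)) \<longlonglongrightarrow> 0"
    using complete[of ?X, OF X C small] by blast
  have "x = flow v t" using LIMSEQ_unique[OF x(2) lim] .
  then show "flow v t \<in> D" "(\<lambda>n. q (?X n - flow v t) (?X n - flow v t)) \<longlonglongrightarrow> 0"
    using x by auto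
qed

lemma q_euler_flow_dist:
  assumes v: "v \<in> D" and "0 < \<tau>" "0 < \<delta>" "\<delta> \<le> t" "\<delta> \<le> s"
  shows "q (euler v \<tau> t - flow v s) (euler v \<tau> t - flow v s)
    \<le> 2 * sqrt (q v v / \<delta>) * norm (euler v \<tau> t - flow v s)"
proof -
  have s: "0 < s" using assms by simp
  let ?X = "\<lambda>n. euler v (inverse (real (Suc n))) s"
  have XD: "?X n \<in> D" for n by (rule euler_D[OF v]) simp
  have e: "euler v \<tau> t \<in> D" by (rule euler_D[OF v assms(2)])
  note S = flow_D_approx[OF v s]
  show ?thesis
  proof (rule tendsto_le[OF sequentially_bot])
    show "(\<lambda>n. q (euler v \<tau> t - ?X n) (euler v \<tau> t - ?X n)) \<longlonglongrightarrow> q (euler v \<tau> t - flow v s) (euler v \<tau> t - flow v s)"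
    proof (rule q_tendsto(2)[OF _ _ D_0])
      have "(euler v \<tau> t - ?X n) - (euler v \<tau> t - flow v s) = (-1) *\<^sub>R (?X n - flow v s)" for n by simp
      then have "q ((euler v \<tau> t - ?X n) - (euler v \<tau> t - flow v s)) ((euler v \<tau> t - ?X n) - (euler v \<tau> t - flow v s))
          = q (?X n - flow v s) (?X n - flow v s)" for n
        using D_diff[OF XD S(1), of n] D_scale[OF D_diff[OF XD S(1)], of "-1" n]
        by (simp only: q_scale_left q_scale_right)
      then show "(\<lambda>n. q ((euler v \<tau> t - ?X n) - (euler v \<tau> t - flow v s)) ((euler v \<tau> t - ?X n) - (euler v \<tau> t - flow v s))) \<longlonglongrightarrow> 0"
        using S(2) by simp
    qed (use D_diff e XD S(1) in auto)
    show "(\<lambda>n. 2 * sqrt (q v v / \<delta>) * norm (euler v \<tau> t - ?X n)) \<longlonglongrightarrow> 2 * sqrt (q v v / \<delta>) * norm (euler v \<tau> t - flow v s)"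
      using s by (intro tendsto_intros euler_inverse_tendsto v) auto
    show "\<forall>\<^sub>F n in sequentially. q (euler v \<tau> t - ?X n) (euler v \<tau> t - ?X n) \<le> 2 * sqrt (q v v / \<delta>) * norm (euler v \<tau> t - ?X n)"
      using assms by (intro always_eventually allI q_euler_dist) auto
  qed
qed

lemma q_flow_dist:
  assumes v: "v \<in> D" and "0 < \<delta>" "\<delta> \<le> t" "\<delta> \<le> s"
  shows "q (flow v t - flow v s) (flow v t - flow v s)
    \<le> 2 * sqrt (q v v / \<delta>) * norm (flow v t - flow v s)"
proof -
  have t: "0 < t" and s: "0 < s" using assms by simp_all
  let ?X = "\<lambda>n. euler v (inverse (real (Suc n))) t"
  have XD: "?X n \<in> D" for n by (rule euler_D[OF v]) simp
  note T = flow_D_approx[OF v t] and S = flow_D_approx[OF v s]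
  show ?thesis
  proof (rule tendsto_le[OF sequentially_bot])
    show "(\<lambda>n. q (?X n - flow v s) (?X n - flow v s)) \<longlonglongrightarrow> q (flow v t - flow v s) (flow v t - flow v s)"
      by (rule q_tendsto(2)[OF _ _ D_0]) (use D_diff XD S(1) T in auto)
    show "(\<lambda>n. 2 * sqrt (q v v / \<delta>) * norm (?X n - flow v s)) \<longlonglongrightarrow> 2 * sqrt (q v v / \<delta>) * norm (flow v t - flow v s)"
      using t by (intro tendsto_intros euler_inverse_tendsto v) auto
    show "\<forall>\<^sub>F n in sequentially. q (?X n - flow v s) (?X n - flow v s) \<le> 2 * sqrt (q v v / \<delta>) * norm (?X n - flow v s)"
      using assms by (intro always_eventually allI q_euler_flow_dist) auto
  qed
qed

lemma q_flow_le:
  assumes v: "v \<in> D" and t: "0 < t" shows "q (flow v t) (flow v t) \<le> q v v"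
proof (rule tendsto_upperbound[OF q_tendsto(2)[OF _ _ D_0]])
  show "\<forall>\<^sub>F n in sequentially. q (euler v (inverse (real (Suc n))) t) (euler v (inverse (real (Suc n))) t) \<le> q v v"
    unfolding euler_def using v by (intro always_eventually allI q_res_power_le) auto
qed (use flow_D_approx[OF v t] in \<open>auto intro!: euler_D v\<close>)

lemma flow_q_tendsto:
  assumes v: "v \<in> D" and s: "0 < s"
  shows "((\<lambda>t. q (flow v t - flow v s) (flow v t - flow v s)) \<longlongrightarrow> 0) (at s)"
proof (rule tendsto_sandwich[where f = "\<lambda>_. 0"])
  \<comment> \<open>Times near s exceed s / 2, which serves as the lower bound \<delta> of
    \<open>q_flow_dist\<close>.\<close>
  have ev: "\<forall>\<^sub>F t in at s. s / 2 < t" using s by (intro order_tendstoD(1)[OF tendsto_ident_at]) simp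
  show "\<forall>\<^sub>F t in at s. 0 \<le> q (flow v t - flow v s) (flow v t - flow v s)"
    using ev by eventually_elim (use s flow_D_approx(1)[OF v] in \<open>auto intro!: q_nonneg D_diff\<close>)
  show "\<forall>\<^sub>F t in at s. q (flow v t - flow v s) (flow v t - flow v s)
      \<le> 2 * sqrt (q v v / (s/2)) * norm (flow v t - flow v s)"
    using ev by eventually_elim (use s in \<open>intro q_flow_dist[OF v]; simp\<close>)
  have "isCont (flow v) s"
    using continuous_on_interior[OF continuous_on_flow[OF v]] s by (simp add: interior_real_atLeast)
  then have "(flow v \<longlongrightarrow> flow v s) (at s)" by (simp add: isCont_def)
  then have "((\<lambda>t. 2 * sqrt (q v v / (s/2)) * norm (flow v t - flow v s)) \<longlongrightarrow>
      2 * sqrt (q v v / (s/2)) * norm (flow v s - flow v s)) (at s)"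
    by (intro tendsto_intros)
  then show "((\<lambda>t. 2 * sqrt (q v v / (s/2)) * norm (flow v t - flow v s)) \<longlongrightarrow> 0) (at s)" by simp
qed auto

text \<open>Sums the resolvent equation tested with \<open>w\<close>: each step changes the inner
  product by -\<tau> q(u_k, w). The resulting Riemann sum is compared with the constant integrand
  \<open>c\<close>.\<close>

lemma res_power_increment:
  assumes "0 < \<tau>" "v \<in> D" "w \<in> D" "m \<le> n"
    and "\<And>k. m < k \<Longrightarrow> k \<le> n \<Longrightarrow> \<bar>q ((res \<tau> ^^ k) v) w - c\<bar> \<le> G"
  shows "\<bar>((res \<tau> ^^ n) v - (res \<tau> ^^ m) v) \<bullet> w + (real n - real m) * \<tau> * c\<bar> \<le> (real n - real m) * \<tau> * G"
  using assms(4,5)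
proof (induction n rule: dec_induct)
  case (step n)
  have "((res \<tau> ^^ Suc n) v - (res \<tau> ^^ n) v) \<bullet> w = - \<tau> * q ((res \<tau> ^^ Suc n) v) w"
    using res_eq[OF assms(1,3), of "(res \<tau> ^^ n) v"] by (simp add: inner_diff_left)
  then have eq: "((res \<tau> ^^ Suc n) v - (res \<tau> ^^ m) v) \<bullet> w + (real (Suc n) - real m) * \<tau> * c
      = (((res \<tau> ^^ n) v - (res \<tau> ^^ m) v) \<bullet> w + (real n - real m) * \<tau> * c) - \<tau> * (q ((res \<tau> ^^ Suc n) v) w - c)"
    by (simp add: inner_diff_left algebra_simps)
  have "\<bar>\<tau> * (q ((res \<tau> ^^ Suc n) v) w - c)\<bar> \<le> \<tau> * G"
    using step.prems[of "Suc n"] step.hyps assms(1) unfolding abs_mult by simp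
  then show ?case unfolding eq using step.IH step.prems
    by (simp add: algebra_simps del: funpow.simps)
qed simp

text \<open>The derivative is found on the level of the scheme, where the equation holds exactly: on
  a short interval around \<open>t0\<close> the integrand q(u_k, w) is close to q (flow v t0) w, and
  only then does the step tend to 0. Two free times s and t cover increments on both sides of
  \<open>t0\<close>.\<close>

lemma flow_increment:
  assumes v: "v \<in> D" and w: "w \<in> D" and t0: "0 < t0" and e: "0 < e"
  shows "\<exists>d>0. \<forall>s t. t0 - d < s \<longrightarrow> s \<le> t \<longrightarrow> t < t0 + d \<longrightarrow>
     \<bar>(flow v t - flow v s) \<bullet> w + (t - s) * q (flow v t0) w\<bar> \<le> (t - s) * e"
proof -
  define c where "c = q (flow v t0) w"
  \<comment> \<open>Keeps every time involved away from 0, where the bound on the operator images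
    degenerates.\<close>
  define \<delta> where "\<delta> = t0 / 2"
  define K where "K = 2 * sqrt (q v v / \<delta>)"
  \<comment> \<open>Bounds |q(u_k, w) - c| by means of \<open>q_euler_flow_dist\<close> and
    \<open>euler_flow_dist\<close>; d + 2 \<tau> and t0 + d + 2 \<tau> are the largest values that
    |r - t0| + \<tau> and r + \<tau> take in \<open>Theta\<close> for the grid times r
    below.\<close>
  define g where "g d \<tau> = sqrt (K * (3 * sqrt (q v v) * sqrt (sqrt ((d + 2 * \<tau>)\<^sup>2 + (t0 + d + 2 * \<tau>) * \<tau>)))) * sqrt (q w w)" for d \<tau>
  have K0: "0 \<le> K" using q_nonneg[OF v] t0 by (simp add: K_def \<delta>_def)
  have "((\<lambda>d. g d 0) \<longlongrightarrow> g 0 0) (at_right 0)" unfolding g_def by (intro tendsto_intros)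
  moreover have "g 0 0 = 0" by (simp add: g_def)
  ultimately have "\<forall>\<^sub>F d in at_right 0. g d 0 < e" using e order_tendstoD(2) by metis
  then obtain b where b: "b > 0" "\<And>d. 0 < d \<Longrightarrow> d < b \<Longrightarrow> g d 0 < e"
    by (auto simp: eventually_at_right_field)
  define d where "d = min (b / 2) \<delta>"
  have d: "0 < d" "d \<le> \<delta>" "g d 0 < e" using b t0 by (auto simp: d_def \<delta>_def)
  have "\<bar>(flow v t - flow v s) \<bullet> w + (t - s) * c\<bar> \<le> (t - s) * g d 0"
    if st: "t0 - d < s" "s \<le> t" "t < t0 + d" for s t
  proof (rule tendsto_le[OF trivial_limit_at_right_real])
    have pos: "0 \<le> s" "0 \<le> t" using st d t0 by (auto simp: \<delta>_def)
    let ?n = "\<lambda>t \<tau>. nat \<lceil>t / \<tau>\<rceil>"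
    have "((\<lambda>\<tau>. (euler v \<tau> t - euler v \<tau> s) \<bullet> w + (real (?n t \<tau>) * \<tau> - real (?n s \<tau>) * \<tau>) * c) \<longlongrightarrow>
       (flow v t - flow v s) \<bullet> w + (t - s) * c) (at_right 0)"
      by (intro tendsto_intros tendsto_nat_ceiling_divide euler_tendsto v pos)
    then show "((\<lambda>\<tau>. \<bar>(euler v \<tau> t - euler v \<tau> s) \<bullet> w + (real (?n t \<tau>) * \<tau> - real (?n s \<tau>) * \<tau>) * c\<bar>) \<longlongrightarrow>
       \<bar>(flow v t - flow v s) \<bullet> w + (t - s) * c\<bar>) (at_right 0)"
      by (rule tendsto_rabs)
    have "((\<lambda>\<tau>. g d \<tau>) \<longlongrightarrow> g d 0) (at_right 0)" unfolding g_def by (intro tendsto_intros)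
    then show "((\<lambda>\<tau>. (real (?n t \<tau>) * \<tau> - real (?n s \<tau>) * \<tau>) * g d \<tau>) \<longlongrightarrow> (t - s) * g d 0) (at_right 0)"
      by (intro tendsto_intros tendsto_nat_ceiling_divide pos)
    have "\<bar>(euler v \<tau> t - euler v \<tau> s) \<bullet> w + (real (?n t \<tau>) * \<tau> - real (?n s \<tau>) * \<tau>) * c\<bar>
        \<le> (real (?n t \<tau>) * \<tau> - real (?n s \<tau>) * \<tau>) * g d \<tau>" if \<tau>: "\<tau> > 0" for \<tau>
    proof -
      have "\<bar>q ((res \<tau> ^^ k) v) w - c\<bar> \<le> g d \<tau>" if k: "?n s \<tau> < k" "k \<le> ?n t \<tau>" for k
      proof -
        \<comment> \<open>At its own grid time the ceiling is exact, so the k-th iterate is the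
          Euler approximation at r.\<close>
        define r where "r = real k * \<tau>"
        have uk: "(res \<tau> ^^ k) v = euler v \<tau> r" using \<tau> by (simp add: euler_def r_def)
        have r1: "s < r"
        proof -
          have "real (?n s \<tau>) * \<tau> < r" using k \<tau> by (simp add: r_def)
          then show ?thesis using nat_ceiling_divide_bounds(1)[OF pos(1) \<tau>] by linarith
        qed
        have r2: "r < t + \<tau>"
        proof -
          have "r \<le> real (?n t \<tau>) * \<tau>" using k \<tau> by (simp add: r_def)
          then show ?thesis using nat_ceiling_divide_bounds(2)[OF pos(2) \<tau>] by linarith
        qed
        have r: "\<bar>r - t0\<bar> \<le> d + \<tau>" "\<delta> \<le> r" "r \<le> t0 + d + \<tau>"
          using r1 r2 st d \<tau> unfolding \<delta>_def by (auto simp: abs_le_iff)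
        have \<delta>: "0 < \<delta>" "\<delta> \<le> t0" "0 \<le> r" "0 \<le> t0" using t0 r by (auto simp: \<delta>_def)
        have "norm (euler v \<tau> r - flow v t0) \<le> 3 * sqrt (q v v) * sqrt (sqrt (Theta \<tau> r 0 t0))"
          by (rule euler_flow_dist[OF v \<tau> \<delta>(3,4)])
        also have "\<dots> \<le> 3 * sqrt (q v v) * sqrt (sqrt ((d + 2 * \<tau>)\<^sup>2 + (t0 + d + 2 * \<tau>) * \<tau>))"
        proof -
          have "Theta \<tau> r 0 t0 \<le> (d + 2 * \<tau>)\<^sup>2 + (t0 + d + 2 * \<tau>) * \<tau>"
            unfolding Theta_def using r \<tau> by (simp add: add_mono power_mono mult_right_mono)
          then show ?thesis using q_nonneg[OF v] by (intro mult_left_mono real_sqrt_le_mono) auto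
        qed
        finally have nb: "norm (euler v \<tau> r - flow v t0) \<le> 3 * sqrt (q v v) * sqrt (sqrt ((d + 2 * \<tau>)\<^sup>2 + (t0 + d + 2 * \<tau>) * \<tau>))" .
        have ED: "euler v \<tau> r \<in> D" "flow v t0 \<in> D"
          using euler_D[OF v \<tau>] flow_D_approx(1)[OF v t0] by auto
        have "\<bar>q (euler v \<tau> r) w - c\<bar> = \<bar>q (euler v \<tau> r - flow v t0) w\<bar>"
          by (simp add: c_def q_diff_left ED w)
        also have "\<dots> \<le> sqrt (q (euler v \<tau> r - flow v t0) (euler v \<tau> r - flow v t0)) * sqrt (q w w)"
          by (intro abs_q_le D_diff ED w)
        also have "\<dots> \<le> sqrt (K * norm (euler v \<tau> r - flow v t0)) * sqrt (q w w)"
          unfolding K_def using q_euler_flow_dist[OF v \<tau> \<delta>(1) r(2) \<delta>(2)] q_nonneg[OF w]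
          by (intro mult_right_mono real_sqrt_le_mono) auto
        also have "\<dots> \<le> g d \<tau>"
          unfolding g_def using nb q_nonneg[OF w] K0 by (intro mult_right_mono real_sqrt_le_mono mult_left_mono) auto
        finally show ?thesis unfolding uk .
      qed
      moreover have "?n s \<tau> \<le> ?n t \<tau>" using st \<tau> by (intro nat_mono ceiling_mono divide_right_mono) auto
      ultimately show ?thesis
        using res_power_increment[OF \<tau> v w, of "?n s \<tau>" "?n t \<tau>" c "g d \<tau>"]
        by (simp add: euler_def left_diff_distrib)
    qed
    then show "\<forall>\<^sub>F \<tau> in at_right 0. \<bar>(euler v \<tau> t - euler v \<tau> s) \<bullet> w + (real (?n t \<tau>) * \<tau> - real (?n s \<tau>) * \<tau>) * c\<bar>
        \<le> (real (?n t \<tau>) * \<tau> - real (?n s \<tau>) * \<tau>) * g d \<tau>"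
      by (auto simp: eventually_at_filter)
  qed
  moreover have "(t - s) * g d 0 \<le> (t - s) * e" if "s \<le> t" for s t
    using d(3) that by (intro mult_left_mono) auto
  ultimately show ?thesis using d(1) unfolding c_def by (meson order_trans)
qed

lemma flow_has_real_derivative:
  assumes v: "v \<in> D" and w: "w \<in> D" and t0: "0 < t0"
  shows "((\<lambda>t. flow v t \<bullet> w) has_real_derivative - q (flow v t0) w) (at t0)"
  unfolding has_field_derivative_def
proof (rule has_derivativeI[OF bounded_linear_mult_right], rule tendstoI)
  fix e :: real assume e: "0 < e"
  let ?c = "q (flow v t0) w"
  obtain d where d: "d > 0" "\<And>s t. t0 - d < s \<Longrightarrow> s \<le> t \<Longrightarrow> t < t0 + d \<Longrightarrow>
     \<bar>(flow v t - flow v s) \<bullet> w + (t - s) * ?c\<bar> \<le> (t - s) * (e / 2)"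
    using flow_increment[OF v w t0, of "e/2"] e by auto
  have *: "\<bar>(flow v t - flow v t0) \<bullet> w + (t - t0) * ?c\<bar> \<le> \<bar>t - t0\<bar> * (e / 2)" if "\<bar>t - t0\<bar> < d" for t
  proof (cases "t0 \<le> t")
    case True then show ?thesis using d(2)[of t0 t] that d(1) by auto
  next
    case False
    have "(flow v t - flow v t0) \<bullet> w + (t - t0) * ?c = - ((flow v t0 - flow v t) \<bullet> w + (t0 - t) * ?c)"
      by (simp add: inner_diff_left algebra_simps)
    then show ?thesis using d(2)[of t t0] that d(1) False by (simp only: abs_minus_cancel) simp
  qed
  have "norm ((flow v t \<bullet> w - flow v t0 \<bullet> w - - ?c * (t - t0)) /\<^sub>R norm (t - t0)) < e"
    if t: "t \<noteq> t0" "\<bar>t - t0\<bar> < d" for t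
  proof -
    have "\<bar>flow v t \<bullet> w - flow v t0 \<bullet> w - - ?c * (t - t0)\<bar> \<le> \<bar>t - t0\<bar> * (e / 2)"
      using *[OF t(2)] by (simp add: inner_diff_left algebra_simps)
    also have "\<dots> < \<bar>t - t0\<bar> * e" using e t by simp
    finally show ?thesis using t by (simp add: field_simps)
  qed
  then show "\<forall>\<^sub>F t in at t0. dist ((flow v t \<bullet> w - flow v t0 \<bullet> w - - ?c * (t - t0)) /\<^sub>R norm (t - t0)) 0 < e"
    using d(1) by (auto simp: eventually_at dist_real_def)
qed

subsection \<open>Uniqueness\<close>

text \<open>With \<open>R = res 1\<close>, every solution satisfies \<open>(R u)' = R u - u\<close> tested with arbitrary vectors, so
  \<open>N = R u \<bullet> u\<close> is differentiable although \<open>u\<close> need not be, and \<open>N' = 2 (R u \<bullet> u - u \<bullet> u) \<le> 0\<close>.\<close>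

lemma evolution_unique:
  fixes u :: "real \<Rightarrow> 'h"
  assumes cont: "continuous_on {0..} u" and u0: "u 0 = 0"
    and deriv: "\<And>s w. s > 0 \<Longrightarrow>
      ((\<lambda>t. res 1 (u t) \<bullet> w) has_real_derivative - ((u s - res 1 (u s)) \<bullet> w)) (at s)"
    and t: "0 \<le> t"
  shows "u t = 0"
proof -
  let ?R = "res 1"
  have R: "bounded_linear ?R"
    by (rule bounded_linear_intro[where K = 1]) (auto simp: res_add res_scale norm_res_le)
  define k where "k s = u s - ?R (u s)" for s
  define N where "N s = ?R (u s) \<bullet> u s" for s
  have isC: "isCont u s" if "s > 0" for s
    using continuous_on_interior[OF cont, of s] that by (simp add: interior_real_atLeast)
  have isCk: "isCont k s" if "s > 0" for s
    unfolding k_def by (intro continuous_intros isC that bounded_linear.isCont[OF R])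
  \<comment> \<open>Passes from weak to norm differentiability. The mean value bound holds for every
    test vector, hence also for w equal to the remainder itself, and then f t - f s is the squared
    norm of the remainder.\<close>
  have strong: "((\<lambda>t. (?R (u t) - ?R (u s)) /\<^sub>R (t - s)) \<longlongrightarrow> - k s) (at s)" if s: "s > 0" for s
  proof (rule tendstoI)
    fix e :: real assume e: "0 < e"
    obtain d0 where d0: "d0 > 0" "\<And>r. \<bar>r - s\<bar> < d0 \<Longrightarrow> norm (k r - k s) < e / 2"
      using isCk[OF s] e unfolding continuous_at_eps_delta dist_norm real_norm_def by (meson half_gt_zero)
    define d where "d = min d0 s"
    have d: "d > 0" using d0 s by (simp add: d_def)
    have "dist ((?R (u t) - ?R (u s)) /\<^sub>R (t - s)) (- k s) < e" if t: "t \<noteq> s" "\<bar>t - s\<bar> < d" for t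
    proof -
      define w where "w = ?R (u t) - ?R (u s) + (t - s) *\<^sub>R k s"
      define f where "f r = ?R (u r) \<bullet> w + (r - s) * (k s \<bullet> w)" for r
      have fd: "(f has_real_derivative - ((k r - k s) \<bullet> w)) (at r)" if "r > 0" for r
        unfolding f_def using deriv[OF that, of w]
        by (auto intro!: derivative_eq_intros simp: k_def inner_diff_left algebra_simps)
      have "norm (f t - f s) \<le> e / 2 * norm w * norm (t - s)"
      proof (rule field_differentiable_bound[where S = "ball s d" and f' = "\<lambda>r. - ((k r - k s) \<bullet> w)"])
        fix r assume r: "r \<in> ball s d"
        then have r': "\<bar>r - s\<bar> < d0" "r > 0" by (auto simp: d_def dist_real_def)
        show "(f has_field_derivative - ((k r - k s) \<bullet> w)) (at r within ball s d)"
          using fd[OF r'(2)] by (rule has_field_derivative_at_within)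
        have "\<bar>(k r - k s) \<bullet> w\<bar> \<le> norm (k r - k s) * norm w" by (rule Cauchy_Schwarz_ineq2)
        also have "\<dots> \<le> e / 2 * norm w" using d0(2)[OF r'(1)] by (intro mult_right_mono) auto
        finally show "norm (- ((k r - k s) \<bullet> w)) \<le> e / 2 * norm w" by simp
      qed (use t d in \<open>auto simp: dist_real_def\<close>)
      moreover have "f t - f s = w \<bullet> w" by (simp add: f_def w_def inner_diff_left inner_add_left)
      ultimately have "norm w * norm w \<le> norm w * (e / 2 * \<bar>t - s\<bar>)"
        by (simp add: power2_norm_eq_inner[symmetric] power2_eq_square algebra_simps)
      then have nw: "norm w \<le> e / 2 * \<bar>t - s\<bar>"
        using e by (cases "norm w = 0") (auto simp: mult_le_cancel_left)
      have "(?R (u t) - ?R (u s)) /\<^sub>R (t - s) - - k s = w /\<^sub>R (t - s)"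
        using t by (simp add: w_def scaleR_add_right)
      then have "dist ((?R (u t) - ?R (u s)) /\<^sub>R (t - s)) (- k s) = norm w / \<bar>t - s\<bar>"
        by (simp add: dist_norm divide_inverse mult.commute)
      also have "\<dots> \<le> e / 2" using nw t by (simp add: field_simps)
      also have "\<dots> < e" using e by simp
      finally show ?thesis .
    qed
    then show "\<forall>\<^sub>F t in at s. dist ((?R (u t) - ?R (u s)) /\<^sub>R (t - s)) (- k s) < e"
      using d by (auto simp: eventually_at dist_real_def)
  qed
  \<comment> \<open>By symmetry of R the increment of N is the increment of R u paired with u t + u
    s, so u itself enters only through its continuity.\<close>
  have N': "(N has_real_derivative - 2 * (k s \<bullet> u s)) (at s)" if s: "s > 0" for s
    unfolding has_field_derivative_iff
  proof -
    have "((\<lambda>t. ((?R (u t) - ?R (u s)) /\<^sub>R (t - s)) \<bullet> (u t + u s)) \<longlongrightarrow> - k s \<bullet> (u s + u s)) (at s)"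
      by (intro tendsto_intros strong s isC[OF s, unfolded isCont_def])
    moreover have "((?R (u t) - ?R (u s)) /\<^sub>R (t - s)) \<bullet> (u t + u s) = (N t - N s) / (t - s)" for t
    proof -
      have "?R (u t) \<bullet> u s = ?R (u s) \<bullet> u t"
        using res_symmetric[of 1 "u t" "u s"] by (simp add: inner_commute)
      then have "(?R (u t) - ?R (u s)) \<bullet> (u t + u s) = N t - N s"
        by (simp add: N_def inner_simps)
      then show ?thesis by (simp add: divide_inverse mult.commute)
    qed
    ultimately show "((\<lambda>t. (N t - N s) / (t - s)) \<longlongrightarrow> - 2 * (k s \<bullet> u s)) (at s)"
      by (simp add: inner_simps algebra_simps)
  qed
  have le: "0 \<le> k s \<bullet> u s" for s
  proof -
    have "?R (u s) \<bullet> u s \<le> norm (u s) * norm (u s)"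
      by (rule order_trans[OF norm_cauchy_schwarz]) (simp add: mult_right_mono norm_res_le)
    then show ?thesis by (simp add: k_def inner_diff_left power2_norm_eq_inner[symmetric] power2_eq_square)
  qed
  have N0: "N s = 0" if s: "0 \<le> s" for s
  proof (rule antisym)
    have "N s \<le> N 0"
    proof (cases "s = 0")
      case False
      show ?thesis
      proof (rule DERIV_nonpos_imp_decreasing_open[of 0 s N])
        show "\<exists>y. (N has_real_derivative y) (at x) \<and> y \<le> 0" if "0 < x" "x < s" for x
          using N'[OF that(1)] le[of x] by (intro exI[of _ "- 2 * (k x \<bullet> u x)"]) auto
        have "continuous_on {0..s} u" by (rule continuous_on_subset[OF cont]) auto
        then show "continuous_on {0..s} N"
          unfolding N_def by (intro continuous_intros bounded_linear.continuous_on[OF R])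
      qed (use s False in auto)
    qed simp
    then show "N s \<le> 0" by (simp add: N_def u0)
    show "0 \<le> N s" unfolding N_def using inner_res_nonneg[of 1 "u s"] by (meson order_trans zero_le_power2 zero_less_one)
  qed
  show ?thesis
  proof (cases "t = 0")
    case False
    then have t: "t > 0" using t by simp
    \<comment> \<open>N vanishes at all positive times, so the derivative found above is 0 and k t
      is orthogonal to u t; as R u is orthogonal to u as well, u \<bullet> u = 0.\<close>
    have "(N has_real_derivative 0) (at t)"
    proof (rule DERIV_cong_ev[THEN iffD2, OF refl _ refl])
      have "\<forall>\<^sub>F x in nhds t. x \<in> {0<..}" using t by (intro eventually_nhds_in_open) auto
      then show "\<forall>\<^sub>F x in nhds t. N x = 0" by eventually_elim (simp add: N0)
      show "((\<lambda>_. 0) has_real_derivative 0) (at t)" by simp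
    qed
    then have "- 2 * (k t \<bullet> u t) = 0" by (rule DERIV_unique[OF N'[OF t]])
    then have "k t \<bullet> u t = 0" by simp
    then have "u t \<bullet> u t = 0" using N0[of t] t by (simp add: k_def N_def inner_diff_left)
    then show ?thesis by simp
  qed (simp add: u0)
qed

end

subsection \<open>The space \<open>L\<^sup>2\<close> of the torus as a Hilbert space\<close>

abbreviation cell :: "(real^'d) measure" where
  "cell \<equiv> lebesgue_on (cbox 0 One)"

lemma torus_integral_eq: "torus_integral f = integral\<^sup>L cell f"
  unfolding torus_integral_def set_lebesgue_integral_def
  by (subst integral_restrict_space) auto

lemma emeasure_cell: "emeasure cell (space (cell :: (real^'d) measure)) = 1"
proof -
  have "emeasure lborel (cbox 0 One :: (real^'d) set) = ennreal (prod ((\<bullet>) (One - 0 :: real^'d)) Basis)"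
    by (rule emeasure_lborel_cbox) simp
  also have "prod ((\<bullet>) (One - 0 :: real^'d)) Basis = prod (\<lambda>_. 1) (Basis :: (real^'d) set)"
    by (rule prod.cong) (auto simp: inner_sum_left inner_Basis)
  finally show ?thesis by (simp add: emeasure_restrict_space)
qed

interpretation cell: finite_measure "cell :: (real^'d) measure"
  by (rule finite_measureI) (simp only: emeasure_cell, simp)

lemma measure_cell: "measure cell (space (cell :: (real^'d) measure)) = 1"
  by (simp only: measure_def emeasure_cell) simp

lemma AE_cell: "(AE x in lebesgue. P x) \<Longrightarrow> (AE x in cell. P x)"
  by (subst AE_restrict_space_iff) auto

lemma measurable_cell [measurable (raw)]: "f \<in> borel_measurable lebesgue \<Longrightarrow> f \<in> borel_measurable cell"
  by (rule measurable_restrict_space1)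

lemma L2_iff: "f \<in> L2 \<longleftrightarrow> periodic f \<and> f \<in> borel_measurable lebesgue \<and> integrable cell (\<lambda>x. (f x)\<^sup>2)"
  unfolding L2_def set_integrable_def
  by (subst integrable_restrict_space) auto

lemma L2D:
  assumes "f \<in> L2"
  shows "periodic f" "f \<in> borel_measurable lebesgue" "f \<in> borel_measurable cell" "integrable cell (\<lambda>x. (f x)\<^sup>2)"
  using assms by (auto simp: L2_iff intro: measurable_cell)

lemma L2_mult_integrable:
  assumes "f \<in> L2" "g \<in> L2"
  shows "integrable cell (\<lambda>x. f x * g x)"
proof (rule Bochner_Integration.integrable_bound)
  show "integrable cell (\<lambda>x. (f x)\<^sup>2 + (g x)\<^sup>2)" using assms[THEN L2D(4)] by simp
  show "(\<lambda>x. f x * g x) \<in> borel_measurable cell" using assms[THEN L2D(3)] by simp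
  have "\<bar>a * b\<bar> \<le> a\<^sup>2 + b\<^sup>2" for a b :: real
  proof -
    have "0 \<le> (\<bar>a\<bar> - \<bar>b\<bar>)\<^sup>2" by simp
    then have "2 * (\<bar>a\<bar> * \<bar>b\<bar>) \<le> a\<^sup>2 + b\<^sup>2" by (simp add: power2_eq_square algebra_simps)
    moreover have "0 \<le> \<bar>a\<bar> * \<bar>b\<bar>" by simp
    ultimately show ?thesis unfolding abs_mult by linarith
  qed
  then show "AE x in cell. norm (f x * g x) \<le> norm ((f x)\<^sup>2 + (g x)\<^sup>2)" by simp
qed

lemma L2_add: assumes "f \<in> L2" "g \<in> L2" shows "(\<lambda>x. f x + g x) \<in> L2"
proof -
  have "integrable cell (\<lambda>x. (f x)\<^sup>2 + 2 * (f x * g x) + (g x)\<^sup>2)"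
    using L2_mult_integrable[OF assms] assms[THEN L2D(4)] by simp
  then show ?thesis using assms by (auto simp: L2_iff power2_sum periodic_def algebra_simps)
qed

lemma L2_scale: "f \<in> L2 \<Longrightarrow> (\<lambda>x. c * f x) \<in> L2"
  by (auto simp: L2_iff periodic_def power_mult_distrib)

lemma L2_zero: "(\<lambda>x. 0) \<in> L2"
  by (auto simp: L2_iff periodic_def)

lemma L2_uminus: "f \<in> L2 \<Longrightarrow> (\<lambda>x. - f x) \<in> L2"
  using L2_scale[of f "-1"] by simp

lemma L2_diff: "f \<in> L2 \<Longrightarrow> g \<in> L2 \<Longrightarrow> (\<lambda>x. f x - g x) \<in> L2"
  using L2_add[OF _ L2_uminus] by fastforce

lemma L2_mult_bounded:
  assumes "f \<in> L2" "periodic h" "h \<in> borel_measurable lebesgue" "AE x in lebesgue. \<bar>h x\<bar> \<le> C"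
  shows "(\<lambda>x. h x * f x) \<in> L2"
  unfolding L2_iff
proof (intro conjI)
  show "integrable cell (\<lambda>x. (h x * f x)\<^sup>2)"
  proof (rule Bochner_Integration.integrable_bound)
    show "integrable cell (\<lambda>x. C\<^sup>2 * (f x)\<^sup>2)" using assms(1) L2D(4) by auto
    show "(\<lambda>x. (h x * f x)\<^sup>2) \<in> borel_measurable cell"
      using measurable_cell[OF assms(3)] L2D(3)[OF assms(1)] by simp
    show "AE x in cell. norm ((h x * f x)\<^sup>2) \<le> norm (C\<^sup>2 * (f x)\<^sup>2)"
      using AE_cell[OF assms(4)]
    proof eventually_elim
      case (elim x)
      then have "(h x)\<^sup>2 \<le> C\<^sup>2" by (metis abs_ge_zero power2_abs power_mono)
      then show ?case by (simp add: power_mult_distrib mult_right_mono)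
    qed
  qed
qed (use assms L2D[OF assms(1)] in \<open>auto simp: periodic_def\<close>)

lemma L2_bounded:
  assumes "periodic h" "h \<in> borel_measurable lebesgue" "AE x in lebesgue. \<bar>h x\<bar> \<le> C"
  shows "h \<in> L2"
proof -
  have "(\<lambda>x. 1) \<in> L2" by (auto simp: L2_iff periodic_def)
  from L2_mult_bounded[OF this assms] show ?thesis by simp
qed

text \<open>A partial equivalence whose reflexive elements are the members of \<open>L2\<close>, so
  the quotient contains classes of \<open>L2\<close> functions only. A separate type is formed
  because \<open>closed_form\<close> asks for a Hilbert space as a type class instance.\<close>

definition l2_rel :: "(real^'d \<Rightarrow> real) \<Rightarrow> (real^'d \<Rightarrow> real) \<Rightarrow> bool" where
  "l2_rel f g \<longleftrightarrow> f \<in> L2 \<and> g \<in> L2 \<and> (AE x in cell. f x = g x)"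

quotient_type (overloaded) 'd l2 = "real^('d::finite) \<Rightarrow> real" / partial: l2_rel
proof (rule part_equivpI)
  show "\<exists>f. l2_rel f (f :: real^'d \<Rightarrow> real)" using L2_zero by (auto simp: l2_rel_def)
  show "symp (l2_rel :: (real^'d \<Rightarrow> real) \<Rightarrow> _)" by (auto simp: symp_def l2_rel_def)
  show "transp (l2_rel :: (real^'d \<Rightarrow> real) \<Rightarrow> _)"
    by (rule transpI) (auto simp: l2_rel_def elim: eventually_elim2)
qed

lemma torus_integral_mult_cong:
  assumes "l2_rel f f'" "l2_rel g g'"
  shows "torus_integral (\<lambda>x. f x * g x) = torus_integral (\<lambda>x. f' x * g' x)"
  unfolding torus_integral_eq
proof (rule integral_cong_AE)
  show "AE x in cell. f x * g x = f' x * g' x"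
    using assms unfolding l2_rel_def by (auto elim: eventually_elim2)
qed (use assms in \<open>unfold l2_rel_def, blast intro: borel_measurable_times L2D(3)\<close>)+

instantiation l2 :: (finite) real_vector
begin

lift_definition zero_l2 :: "'a l2" is "\<lambda>x. 0"
  by (auto simp: l2_rel_def L2_zero)

lift_definition plus_l2 :: "'a l2 \<Rightarrow> 'a l2 \<Rightarrow> 'a l2" is "\<lambda>f g x. f x + g x"
  by (auto simp: l2_rel_def L2_add elim: eventually_elim2)

lift_definition uminus_l2 :: "'a l2 \<Rightarrow> 'a l2" is "\<lambda>f x. - f x"
  by (auto simp: l2_rel_def L2_uminus elim: eventually_mono)

lift_definition minus_l2 :: "'a l2 \<Rightarrow> 'a l2 \<Rightarrow> 'a l2" is "\<lambda>f g x. f x - g x"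
  by (auto simp: l2_rel_def L2_diff elim: eventually_elim2)

lift_definition scaleR_l2 :: "real \<Rightarrow> 'a l2 \<Rightarrow> 'a l2" is "\<lambda>c f x. c * f x"
  by (auto simp: l2_rel_def L2_scale elim: eventually_mono)

instance
proof
  fix u v w :: "'a l2" and a b :: real
  show "u + v + w = u + (v + w)" by transfer (auto simp: l2_rel_def L2_add algebra_simps)
  show "u + v = v + u" by transfer (auto simp: l2_rel_def L2_add algebra_simps)
  show "0 + u = u" by transfer (auto simp: l2_rel_def)
  show "- u + u = 0" by transfer (auto simp: l2_rel_def L2_zero)
  show "u - v = u + - v" by transfer (auto simp: l2_rel_def L2_diff)
  show "a *\<^sub>R (u + v) = a *\<^sub>R u + a *\<^sub>R v"
    by transfer (auto simp: l2_rel_def L2_add L2_scale[OF L2_add] L2_scale distrib_left)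
  show "(a + b) *\<^sub>R u = a *\<^sub>R u + b *\<^sub>R u"
    by transfer (auto simp: l2_rel_def L2_add L2_scale distrib_right)
  show "a *\<^sub>R b *\<^sub>R u = (a * b) *\<^sub>R u"
    by transfer (auto simp: l2_rel_def L2_scale[OF L2_scale] L2_scale mult.assoc)
  show "1 *\<^sub>R u = u" by transfer (auto simp: l2_rel_def)
qed

end

instantiation l2 :: (finite) real_inner
begin

lift_definition inner_l2 :: "'a l2 \<Rightarrow> 'a l2 \<Rightarrow> real" is "\<lambda>f g. torus_integral (\<lambda>x. f x * g x)"
  by (rule torus_integral_mult_cong)

definition norm_l2 :: "'a l2 \<Rightarrow> real" where "norm_l2 u = sqrt (u \<bullet> u)"
definition dist_l2 :: "'a l2 \<Rightarrow> 'a l2 \<Rightarrow> real" where "dist_l2 u v = norm (u - v)"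
definition sgn_l2 :: "'a l2 \<Rightarrow> 'a l2" where "sgn_l2 u = u /\<^sub>R norm u"
definition uniformity_l2 :: "('a l2 \<times> 'a l2) filter" where
  "uniformity_l2 = (INF e\<in>{0<..}. principal {(x, y). dist x y < e})"
definition open_l2 :: "'a l2 set \<Rightarrow> bool" where
  "open_l2 U \<longleftrightarrow> (\<forall>x\<in>U. \<forall>\<^sub>F (x', y) in uniformity. x' = x \<longrightarrow> y \<in> U)"

instance
proof
  fix u v w :: "'a l2" and a :: real
  show "dist u v = norm (u - v)" by (simp add: dist_l2_def)
  show "sgn u = u /\<^sub>R norm u" by (simp add: sgn_l2_def)
  show "(uniformity :: ('a l2 \<times> 'a l2) filter) = (INF e\<in>{0<..}. principal {(x, y). dist x y < e})"
    by (simp add: uniformity_l2_def)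
  show "open U \<longleftrightarrow> (\<forall>x\<in>U. \<forall>\<^sub>F (x', y) in uniformity. x' = x \<longrightarrow> y \<in> U)" for U :: "'a l2 set"
    by (simp add: open_l2_def)
  show "u \<bullet> v = v \<bullet> u" by transfer (simp add: mult.commute)
  show "(u + v) \<bullet> w = u \<bullet> w + v \<bullet> w"
    by transfer (simp add: l2_rel_def torus_integral_eq distrib_right L2_mult_integrable)
  show "(a *\<^sub>R u) \<bullet> v = a * (u \<bullet> v)"
    by transfer (simp add: torus_integral_eq mult.assoc)
  show "0 \<le> u \<bullet> u" by transfer (auto simp: torus_integral_eq)
  show "u \<bullet> u = 0 \<longleftrightarrow> u = 0"
    by transfer
      (simp add: l2_rel_def torus_integral_eq L2_zero power2_eq_square[symmetric] L2D integral_nonneg_eq_0_iff_AE)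
  show "norm u = sqrt (u \<bullet> u)" by (simp add: norm_l2_def)
qed

end

lemma abs_l2_rep: "abs_l2 (rep_l2 u) = u"
  by (rule Quotient3_abs_rep[OF Quotient3_l2])

lemma l2_rel_rep: "l2_rel (rep_l2 u) (rep_l2 u)"
  by (rule Quotient3_rep_reflp[OF Quotient3_l2])

lemma rep_l2_in_L2 [simp]: "rep_l2 u \<in> L2"
  using l2_rel_rep[of u] by (simp add: l2_rel_def)

lemma abs_l2_eq_iff: "f \<in> L2 \<Longrightarrow> g \<in> L2 \<Longrightarrow> abs_l2 f = abs_l2 g \<longleftrightarrow> (AE x in cell. f x = g x)"
  using Quotient3_rel[OF Quotient3_l2, of f g] by (auto simp: l2_rel_def)

lemma rep_abs_l2: assumes "f \<in> L2" shows "AE x in cell. rep_l2 (abs_l2 f) x = f x"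
  using abs_l2_eq_iff[of "rep_l2 (abs_l2 f)" f] assms by (simp add: abs_l2_rep)

lemma inner_abs_l2: "f \<in> L2 \<Longrightarrow> g \<in> L2 \<Longrightarrow> abs_l2 f \<bullet> abs_l2 g = torus_integral (\<lambda>x. f x * g x)"
  by (rule inner_l2.abs_eq) (auto simp: l2_rel_def)

lemma norm_abs_l2: "f \<in> L2 \<Longrightarrow> norm (abs_l2 f) = L2_norm f"
  by (simp add: norm_l2_def inner_abs_l2 L2_norm_def power2_eq_square)

lemma abs_l2_add: "f \<in> L2 \<Longrightarrow> g \<in> L2 \<Longrightarrow> abs_l2 f + abs_l2 g = abs_l2 (\<lambda>x. f x + g x)"
  by (rule plus_l2.abs_eq) (auto simp: l2_rel_def)

lemma abs_l2_diff: "f \<in> L2 \<Longrightarrow> g \<in> L2 \<Longrightarrow> abs_l2 f - abs_l2 g = abs_l2 (\<lambda>x. f x - g x)"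
  by (rule minus_l2.abs_eq) (auto simp: l2_rel_def)

lemma abs_l2_scale: "f \<in> L2 \<Longrightarrow> c *\<^sub>R abs_l2 f = abs_l2 (\<lambda>x. c * f x)"
  by (rule scaleR_l2.abs_eq) (auto simp: l2_rel_def)

lemma abs_l2_zero: "abs_l2 (\<lambda>x. 0) = 0"
  by (simp add: zero_l2_def)

text \<open>The increments are summable in \<open>L\<^sup>1\<close> because the cell has measure 1, so the sequence converges almost
  everywhere; Fatou's lemma bounds the distance to the limit.\<close>

lemma L2_complete:
  fixes f :: "nat \<Rightarrow> real^'d \<Rightarrow> real"
  assumes f: "\<And>n. f n \<in> L2" and small: "\<And>m n. m \<le> n \<Longrightarrow> L2_norm (\<lambda>x. f n x - f m x) \<le> (1/2)^m"
  shows "\<exists>g\<in>L2. \<forall>m. L2_norm (\<lambda>x. g x - f m x) \<le> (1/2)^m"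
proof -
  have df: "(\<lambda>x. f n x - f m x) \<in> L2" for m n by (intro L2_diff f)
  have meas [measurable]: "f n \<in> borel_measurable cell" "f n \<in> borel_measurable lebesgue" for n
    using L2D[OF f] by auto
  have L2n: "(\<integral>\<^sup>+x. ennreal ((f n x - f m x)\<^sup>2) \<partial>cell) \<le> ennreal (((1/2)^m)\<^sup>2)" if "m \<le> n" for m n
  proof -
    have "(\<integral>\<^sup>+x. ennreal ((f n x - f m x)\<^sup>2) \<partial>cell) = ennreal (torus_integral (\<lambda>x. (f n x - f m x)\<^sup>2))"
      unfolding torus_integral_eq using L2D(4)[OF df] by (intro nn_integral_eq_integral) auto
    also have "torus_integral (\<lambda>x. (f n x - f m x)\<^sup>2) = (L2_norm (\<lambda>x. f n x - f m x))\<^sup>2"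
      by (simp add: L2_norm_def torus_integral_eq)
    also have "ennreal \<dots> \<le> ennreal (((1/2)^m)\<^sup>2)"
      by (intro ennreal_leI power_mono small that) (simp add: L2_norm_def torus_integral_eq)
    finally show ?thesis .
  qed
  define d where "d n x = \<bar>f (Suc n) x - f n x\<bar>" for n x
  have d1: "(\<integral>\<^sup>+x. ennreal (d n x) \<partial>cell) \<le> ennreal ((1/2)^n)" for n
  proof -
    have int: "integrable cell (\<lambda>x. \<bar>f (Suc n) x - f n x\<bar> * 1)"
      using L2_mult_integrable[OF df[of "Suc n" n] L2_bounded[of "\<lambda>_. 1" 1]] 
      by (auto simp: periodic_def dest: integrable_abs)
    \<comment> \<open>Young's inequality with weight 2^n, which balances a squared norm of at most
      4^(-n) against the constant 2^(-n).\<close>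
    have "\<bar>f (Suc n) x - f n x\<bar> \<le> (2^n * (f (Suc n) x - f n x)\<^sup>2 + (1/2)^n) / 2" for x
    proof -
      have "0 \<le> (2^n * \<bar>f (Suc n) x - f n x\<bar> - 1)\<^sup>2 * (1/2)^n" by simp
      also have "\<dots> = ((2^n * \<bar>f (Suc n) x - f n x\<bar>)\<^sup>2 - 2 * (2^n * \<bar>f (Suc n) x - f n x\<bar>) + 1) * (1/2)^n"
        by (simp add: power2_diff)
      also have "\<dots> = 2^n * (f (Suc n) x - f n x)\<^sup>2 - 2 * \<bar>f (Suc n) x - f n x\<bar> + (1/2)^n"
        by (simp add: power_mult_distrib power_one_over algebra_simps power2_eq_square)
      finally show ?thesis by simp
    qed
    then have "integral\<^sup>L cell (\<lambda>x. d n x) \<le> integral\<^sup>L cell (\<lambda>x. (2^n * (f (Suc n) x - f n x)\<^sup>2 + (1/2)^n) / 2)"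
      unfolding d_def using int L2D(4)[OF df, of "Suc n" n] by (intro integral_mono) auto
    also have "\<dots> = (2^n * (L2_norm (\<lambda>x. f (Suc n) x - f n x))\<^sup>2 + (1/2)^n) / 2"
      using L2D(4)[OF df, of "Suc n" n] measure_cell by (simp add: L2_norm_def torus_integral_eq)
    also have "\<dots> \<le> (2^n * ((1/2)^n)\<^sup>2 + (1/2)^n) / 2"
      by (intro divide_right_mono add_right_mono mult_left_mono power_mono small) (auto simp: L2_norm_def torus_integral_eq)
    also have "\<dots> = (1/2)^n" by (simp add: power2_eq_square power_one_over)
    finally have le: "integral\<^sup>L cell (\<lambda>x. d n x) \<le> (1/2)^n" .
    have "(\<integral>\<^sup>+x. ennreal (d n x) \<partial>cell) = ennreal (integral\<^sup>L cell (\<lambda>x. d n x))"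
      using int by (intro nn_integral_eq_integral) (auto simp: d_def)
    then show ?thesis using le by (simp add: ennreal_leI)
  qed
  have "(\<integral>\<^sup>+x. (\<Sum>n. ennreal (d n x)) \<partial>cell) = (\<Sum>n. \<integral>\<^sup>+x. ennreal (d n x) \<partial>cell)"
    unfolding d_def by (intro nn_integral_suminf) auto
  also have "\<dots> \<le> (\<Sum>n. ennreal ((1/2)^n))" by (intro suminf_le d1) auto
  also have "\<dots> = ennreal (\<Sum>n. (1/2)^n)" by (intro suminf_ennreal2) (auto intro: summable_geometric)
  also have "\<dots> < \<infinity>" by simp
  finally have "(\<integral>\<^sup>+x. (\<Sum>n. ennreal (d n x)) \<partial>cell) \<noteq> \<infinity>" by simp
  then have "AE x in cell. (\<Sum>n. ennreal (d n x)) \<noteq> \<infinity>"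
    by (intro nn_integral_noteq_infinite) (auto simp: d_def)
  then have conv: "AE x in cell. convergent (\<lambda>n. f n x)"
  proof eventually_elim
    case (elim x)
    have "summable (\<lambda>n. d n x)" using elim by (intro summable_suminf_not_top) (auto simp: d_def)
    then have "summable (\<lambda>n. f (Suc n) x - f n x)" by (auto simp: d_def intro: summable_rabs_cancel)
    then have "convergent (\<lambda>n. \<Sum>i<n. f (Suc i) x - f i x)" by (simp add: summable_iff_convergent)
    moreover have "(\<Sum>i<n. f (Suc i) x - f i x) = f n x - f 0 x" for n
      by (rule sum_lessThan_telescope)
    ultimately have "convergent (\<lambda>n. f n x - f 0 x)" by simp
    then have "convergent (\<lambda>n. (f n x - f 0 x) + f 0 x)" by (intro convergent_add convergent_const)
    then show ?case by simp
  qed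
  \<comment> \<open>The limit is taken at every point. Where it fails to exist, \<open>lim\<close>
    still depends on the sequence of values alone, so \<open>g\<close> is periodic
    everywhere.\<close>
  define g where "g x = lim (\<lambda>n. f n x)" for x
  have g [measurable]: "g \<in> borel_measurable lebesgue"
    unfolding g_def by (rule borel_measurable_lim_metric) auto
  have per: "periodic g" using L2D(1)[OF f] by (auto simp: periodic_def g_def)
  have conv': "AE x in cell. (\<lambda>n. f n x) \<longlonglongrightarrow> g x"
    using conv by eventually_elim (simp add: g_def convergent_LIMSEQ_iff)
  have Fatou: "(\<integral>\<^sup>+x. ennreal ((g x - f m x)\<^sup>2) \<partial>cell) \<le> ennreal (((1/2)^m)\<^sup>2)" for m
  proof -
    have "(\<integral>\<^sup>+x. ennreal ((g x - f m x)\<^sup>2) \<partial>cell) = (\<integral>\<^sup>+x. liminf (\<lambda>n. ennreal ((f n x - f m x)\<^sup>2)) \<partial>cell)"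
    proof (rule nn_integral_cong_AE, use conv' in eventually_elim)
      fix x assume "(\<lambda>n. f n x) \<longlonglongrightarrow> g x"
      then have "(\<lambda>n. ennreal ((f n x - f m x)\<^sup>2)) \<longlonglongrightarrow> ennreal ((g x - f m x)\<^sup>2)"
        by (intro tendsto_intros)
      then show "ennreal ((g x - f m x)\<^sup>2) = liminf (\<lambda>n. ennreal ((f n x - f m x)\<^sup>2))"
        using lim_imp_Liminf[of sequentially] by (metis sequentially_bot)
    qed
    also have "\<dots> \<le> liminf (\<lambda>n. \<integral>\<^sup>+x. ennreal ((f n x - f m x)\<^sup>2) \<partial>cell)"
      by (rule nn_integral_liminf) auto
    also have "\<dots> \<le> ennreal (((1/2)^m)\<^sup>2)"
    proof (rule Liminf_le)
      show "\<forall>\<^sub>F n in sequentially. (\<integral>\<^sup>+x. ennreal ((f n x - f m x)\<^sup>2) \<partial>cell) \<le> ennreal (((1/2)^m)\<^sup>2)"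
        using eventually_ge_at_top[of m] by eventually_elim (rule L2n)
    qed auto
    finally show ?thesis .
  qed
  have gf: "integrable cell (\<lambda>x. (g x - f m x)\<^sup>2)" for m
  proof (rule integrableI_nonneg)
    show "(\<integral>\<^sup>+x. ennreal ((g x - f m x)\<^sup>2) \<partial>cell) < \<infinity>" using Fatou[of m] by (simp add: le_less_trans)
    show "(\<lambda>x. (g x - f m x)\<^sup>2) \<in> borel_measurable cell" using measurable_cell[OF g] by simp
  qed auto
  have gfL2: "(\<lambda>x. g x - f m x) \<in> L2" for m
    using gf[of m] per L2D(1)[OF f, of m] by (auto simp: L2_iff periodic_def)
  have "g \<in> L2" using L2_add[OF gfL2[of 0] f[of 0]] by simp
  moreover have "L2_norm (\<lambda>x. g x - f m x) \<le> (1/2)^m" for m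
  proof -
    have "ennreal (torus_integral (\<lambda>x. (g x - f m x)\<^sup>2)) \<le> ennreal (((1/2)^m)\<^sup>2)"
      using Fatou[of m] nn_integral_eq_integral[OF gf, of m] by (simp add: torus_integral_eq)
    then have "torus_integral (\<lambda>x. (g x - f m x)\<^sup>2) \<le> ((1/2)^m)\<^sup>2" by (simp add: ennreal_le_iff)
    then show ?thesis unfolding L2_norm_def by (intro real_le_lsqrt) auto
  qed
  ultimately show ?thesis by blast
qed

instance l2 :: (finite) complete_space
proof
  fix X :: "nat \<Rightarrow> 'a l2" assume X: "Cauchy X"
  have "\<exists>N. \<forall>m\<ge>N. \<forall>n\<ge>N. norm (X m - X n) < (1/2)^k" for k by (rule CauchyD[OF X]) simp
  then obtain N where N: "\<And>k m n. m \<ge> N k \<Longrightarrow> n \<ge> N k \<Longrightarrow> norm (X m - X n) < (1/2)^k" by metis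
  \<comment> \<open>Partial sums dominate \<open>N k\<close> and increase with k, so the subsequence
    has the geometric increments that \<open>L2_complete\<close> expects.\<close>
  define M where "M k = (\<Sum>i\<le>k. N i)" for k
  have M: "N m \<le> M n" if "m \<le> n" for m n
    unfolding M_def using that by (intro member_le_sum) auto
  define f where "f k = rep_l2 (X (M k))" for k
  have Xf: "X (M k) = abs_l2 (f k)" for k by (simp add: f_def abs_l2_rep)
  have fL2: "f k \<in> L2" for k by (simp add: f_def)
  have "L2_norm (\<lambda>x. f n x - f m x) \<le> (1/2)^m" if "m \<le> n" for m n
    using N[of m "M n" "M m"] M[OF that] M[of m m] less_imp_le
    by (simp add: Xf abs_l2_diff fL2 norm_abs_l2 L2_diff)
  from L2_complete[OF fL2 this] obtain g where g: "g \<in> L2" "\<And>m. L2_norm (\<lambda>x. g x - f m x) \<le> (1/2)^m" by blast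
  have gX: "norm (abs_l2 g - X (M k)) \<le> (1/2)^k" for k
    using g(2)[of k] by (simp add: Xf abs_l2_diff fL2 g(1) norm_abs_l2 L2_diff)
  have "X \<longlonglongrightarrow> abs_l2 g"
  proof (rule LIMSEQ_I)
    fix e :: real assume "e > 0"
    then obtain k where k: "(1/2)^k < e / 2" using real_arch_pow_inv[of "e/2" "1/2"] by auto
    have "norm (X n - abs_l2 g) < e" if "n \<ge> N k" for n
    proof -
      have "norm (X n - abs_l2 g) \<le> norm (X n - X (M k)) + norm (abs_l2 g - X (M k))"
        using norm_triangle_ineq4[of "X n - X (M k)" "abs_l2 g - X (M k)"] by simp
      also have "\<dots> < e" using N[OF that M[of k k]] gX[of k] k by simp
      finally show ?thesis .
    qed
    then show "\<exists>N. \<forall>n\<ge>N. norm (X n - abs_l2 g) < e" by blast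
  qed
  then show "convergent X" by (rule convergentI)
qed

subsection \<open>Periodic functions\<close>

lemma periodic_int:
  assumes "periodic f"
  shows "f (x + (\<chi> j. of_int (n j))) = f x"
proof -
  have nat: "f (y + real k *\<^sub>R axis j 1) = f y" for y j k
  proof (induction k)
    case (Suc k)
    have "f (y + real (Suc k) *\<^sub>R axis j 1) = f ((y + real k *\<^sub>R axis j 1) + axis j 1)"
      by (simp add: algebra_simps)
    then show ?case using assms Suc by (simp add: periodic_def)
  qed simp
  have int: "f (y + of_int k *\<^sub>R axis j 1) = f y" for y j k
  proof (cases "k \<ge> 0")
    case True then show ?thesis using nat[of y "nat k" j] by simp
  next
    case False
    then show ?thesis using nat[of "y + of_int k *\<^sub>R axis j 1" "nat (- k)" j] by simp
  qed
  have "f (x + (\<Sum>j\<in>J. of_int (n j) *\<^sub>R axis j 1)) = f x" if "finite J" for J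
    using that
  proof (induction J rule: finite_induct)
    case (insert j J)
    then show ?case using int[of "x + (\<Sum>j\<in>J. of_int (n j) *\<^sub>R axis j 1)" "n j" j]
      by (simp add: algebra_simps)
  qed simp
  moreover have "(\<Sum>j\<in>UNIV. of_int (n j) *\<^sub>R axis j (1::real)) = (\<chi> j. of_int (n j))"
    by (simp add: vec_eq_iff axis_def if_distrib cong: if_cong)
  ultimately show ?thesis by (metis finite)
qed

definition frac_vec :: "real^'d \<Rightarrow> real^'d" where
  "frac_vec x = (\<chi> j. frac (x $ j))"

lemma One_nth: "(One :: real^'d) $ j = 1"
proof -
  have "(One :: real^'d) \<bullet> axis j 1 = 1"
    by (simp add: inner_sum_left inner_Basis axis_in_Basis_iff del: inner_axis)
  then show ?thesis by (simp only: inner_axis) simp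
qed

lemma mem_unit_cbox: "(x::real^'d) \<in> cbox 0 One \<longleftrightarrow> (\<forall>j. 0 \<le> x $ j \<and> x $ j \<le> 1)"
  by (simp only: mem_box_cart One_nth zero_index)

lemma mem_unit_box: "(x::real^'d) \<in> box 0 One \<longleftrightarrow> (\<forall>j. 0 < x $ j \<and> x $ j < 1)"
  by (simp only: mem_box_cart One_nth zero_index)

lemma frac_vec_cell: "frac_vec x \<in> cbox 0 One"
  by (auto simp: mem_unit_cbox frac_vec_def intro: less_imp_le[OF frac_lt_1])

lemma periodic_frac_vec: assumes "periodic f" shows "f (frac_vec x) = f x"
proof -
  have "x = frac_vec x + (\<chi> j. of_int \<lfloor>x $ j\<rfloor>)"
    by (simp add: vec_eq_iff frac_vec_def frac_def)
  then show ?thesis using periodic_int[OF assms, of "frac_vec x" "\<lambda>j. \<lfloor>x $ j\<rfloor>"] by simp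
qed

lemma periodic_shift: assumes "periodic f" shows "periodic (\<lambda>x. f (x + c))"
proof -
  have "f (x + axis j 1 + c) = f ((x + c) + axis j 1)" for x j by (simp only: ac_simps)
  then show ?thesis using assms by (simp add: periodic_def)
qed

lemma periodic_bounded:
  fixes f :: "real^'d \<Rightarrow> real"
  assumes "periodic f" "continuous_on UNIV f"
  obtains C where "\<And>x. \<bar>f x\<bar> \<le> C"
proof -
  have "compact (f ` cbox 0 One)"
    by (intro compact_continuous_image continuous_on_subset[OF assms(2)]) auto
  then obtain C where C: "\<And>y. y \<in> f ` cbox 0 One \<Longrightarrow> norm y \<le> C"
    using compact_imp_bounded bounded_iff by metis
  have "\<bar>f x\<bar> \<le> C" for x
    using C[OF imageI[OF frac_vec_cell[of x]]] periodic_frac_vec[OF assms(1), of x] by simp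
  then show ?thesis by (rule that)
qed

lemma continuous_periodic_L2:
  assumes "periodic f" "continuous_on UNIV f" shows "f \<in> L2"
proof -
  obtain C where "\<And>x. \<bar>f x\<bar> \<le> C" using periodic_bounded[OF assms] by blast
  then show ?thesis using assms
    by (intro L2_bounded[of f C])
      (use continuous_imp_measurable_on_sets_lebesgue[of UNIV f] in \<open>auto simp: lebesgue_on_UNIV_eq\<close>)
qed

subsection \<open>Trigonometric polynomials\<close>

text \<open>This test class is stable under translations and partial derivatives, contains only
  smooth periodic functions, and is uniformly dense in the continuous periodic ones.\<close>

inductive trig :: "(real^'d \<Rightarrow> real) \<Rightarrow> bool" where
  const: "trig (\<lambda>x. c)"
| cos: "trig (\<lambda>x. cos (2 * pi * x $ j))"
| sin: "trig (\<lambda>x. sin (2 * pi * x $ j))"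
| add: "trig f \<Longrightarrow> trig g \<Longrightarrow> trig (\<lambda>x. f x + g x)"
| mult: "trig f \<Longrightarrow> trig g \<Longrightarrow> trig (\<lambda>x. f x * g x)"

lemma trig_periodic: "trig f \<Longrightarrow> periodic f"
proof (induction rule: trig.induct)
  case (cos j)
  have "cos (2 * pi * (x + axis k 1 :: real^'a) $ j) = cos (2 * pi * x $ j)" for x k
    by (cases "j = k") (auto simp: axis_def distrib_left)
  then show ?case by (simp add: periodic_def)
next
  case (sin j)
  have "sin (2 * pi * (x + axis k 1 :: real^'a) $ j) = sin (2 * pi * x $ j)" for x k
    by (cases "j = k") (auto simp: axis_def distrib_left)
  then show ?case by (simp add: periodic_def)
qed (auto simp: periodic_def)

lemma trig_cmult: "trig f \<Longrightarrow> trig (\<lambda>x. c * f x)"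
  using trig.mult[OF trig.const] by blast

lemma trig_sum: "(\<And>i. i \<in> I \<Longrightarrow> trig (f i)) \<Longrightarrow> trig (\<lambda>x. \<Sum>i\<in>I. f i x)"
  by (induction I rule: infinite_finite_induct) (auto intro: trig.const trig.add)

lemma trig_shift: "trig f \<Longrightarrow> trig (\<lambda>x. f (x + c))"
proof (induction rule: trig.induct)
  case (cos j)
  have "trig (\<lambda>x. cos (2 * pi * c $ j) * cos (2 * pi * x $ j) + (- sin (2 * pi * c $ j)) * sin (2 * pi * x $ j))"
    by (intro trig.add trig_cmult trig.cos trig.sin)
  then show ?case by (simp add: distrib_left cos_add mult.commute)
next
  case (sin j)
  have "trig (\<lambda>x. cos (2 * pi * c $ j) * sin (2 * pi * x $ j) + sin (2 * pi * c $ j) * cos (2 * pi * x $ j))"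
    by (intro trig.add trig_cmult trig.cos trig.sin)
  then show ?case by (simp add: distrib_left sin_add mult.commute)
qed (auto intro: trig.intros)

lemma trig_has_derivative:
  "trig f \<Longrightarrow> \<exists>f'. (\<forall>h. trig (f' h)) \<and> (\<forall>x. (f has_derivative (\<lambda>h. f' h x)) (at x))"
proof (induction rule: trig.induct)
  case (const c)
  show ?case by (rule exI[of _ "\<lambda>h x. 0"]) (auto intro: trig.const)
next
  case (cos j)
  show ?case
  proof (rule exI[of _ "\<lambda>h x. (- (2 * pi * h $ j)) * sin (2 * pi * x $ j)"], intro conjI allI)
    show "trig (\<lambda>x. (- (2 * pi * h $ j)) * sin (2 * pi * x $ j))" for h :: "real^'a"
      by (rule trig_cmult[OF trig.sin])
  qed (auto intro!: derivative_eq_intros bounded_linear.has_derivative[OF bounded_linear_vec_nth])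
next
  case (sin j)
  show ?case
  proof (rule exI[of _ "\<lambda>h x. (2 * pi * h $ j) * cos (2 * pi * x $ j)"], intro conjI allI)
    show "trig (\<lambda>x. (2 * pi * h $ j) * cos (2 * pi * x $ j))" for h :: "real^'a"
      by (rule trig_cmult[OF trig.cos])
  qed (auto intro!: derivative_eq_intros bounded_linear.has_derivative[OF bounded_linear_vec_nth])
next
  case (add f g)
  then obtain f' g' where "\<And>h. trig (f' h)" "\<And>h. trig (g' h)"
    "\<And>x. (f has_derivative (\<lambda>h. f' h x)) (at x)" "\<And>x. (g has_derivative (\<lambda>h. g' h x)) (at x)" by blast
  then show ?case by (intro exI[of _ "\<lambda>h x. f' h x + g' h x"]) (auto intro: trig.add has_derivative_add)
next
  case (mult f g)
  then obtain f' g' where *: "\<And>h. trig (f' h)" "\<And>h. trig (g' h)"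
    "\<And>x. (f has_derivative (\<lambda>h. f' h x)) (at x)" "\<And>x. (g has_derivative (\<lambda>h. g' h x)) (at x)" by blast
  then show ?case using mult.hyps
    by (intro exI[of _ "\<lambda>h x. f x * g' h x + f' h x * g x"] conjI allI trig.add[OF trig.mult trig.mult] has_derivative_mult)
qed

lemma trig_differentiable: "trig f \<Longrightarrow> f differentiable (at x)"
  using trig_has_derivative unfolding differentiable_def by blast

lemma trig_continuous: "trig f \<Longrightarrow> continuous_on S f"
  by (intro continuous_at_imp_continuous_on ballI differentiable_imp_continuous_within trig_differentiable)

lemma trig_frechet_derivative: assumes "trig f" shows "trig (\<lambda>x. frechet_derivative f (at x) h)"
proof -
  obtain f' where f': "\<And>h. trig (f' h)" "\<And>x. (f has_derivative (\<lambda>h. f' h x)) (at x)"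
    using trig_has_derivative[OF assms] by blast
  then have "(\<lambda>x. frechet_derivative f (at x) h) = f' h"
    by (simp add: frechet_derivative_at[OF f'(2), symmetric])
  then show ?thesis using f'(1) by simp
qed

lemma trig_pd: "trig f \<Longrightarrow> trig (pd j f)"
  using trig_frechet_derivative[of f "axis j 1"] by (simp add: pd_def[abs_def])

lemma trig_smooth: assumes "trig f" shows "smooth f"
proof -
  have "Ck k f" for k using assms
    by (induction k arbitrary: f) (auto intro: trig_continuous trig_differentiable trig_frechet_derivative)
  then show ?thesis by (simp add: smooth_def)
qed

lemma trig_L2: "trig f \<Longrightarrow> f \<in> L2"
  by (intro continuous_periodic_L2 trig_periodic trig_continuous)

text \<open>The torus embeds into \<open>\<real>\<^sup>2\<^sup>d\<close>, where ordinary polynomials restrict to trigonometric ones, so that the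
  Stone--Weierstrass theorem for compact sets applies.\<close>

definition torus_emb :: "real^'d \<Rightarrow> (real^'d) \<times> (real^'d)" where
  "torus_emb x = (\<chi> j. cos (2 * pi * x $ j), \<chi> j. sin (2 * pi * x $ j))"

lemma continuous_torus_emb: "continuous_on S torus_emb"
  unfolding torus_emb_def by (intro continuous_intros continuous_on_vec_lambda)

lemma torus_emb_eq:
  assumes "torus_emb x = torus_emb y"
  obtains n where "x = y + (\<chi> j. of_int (n j))"
proof -
  have "\<exists>n::int. x $ j = y $ j + n" for j
  proof -
    have "sin (2 * pi * x $ j) = sin (2 * pi * y $ j) \<and> cos (2 * pi * x $ j) = cos (2 * pi * y $ j)"
      using assms by (simp add: torus_emb_def vec_eq_iff)
    then obtain n :: int where "2 * pi * x $ j = 2 * pi * y $ j + 2 * pi * n" using sin_cos_eq_iff by blast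
    then have "2 * pi * x $ j = 2 * pi * (y $ j + n)" by (simp add: distrib_left)
    then show ?thesis by (intro exI[of _ n]) (simp only: mult_cancel_left, simp)
  qed
  then obtain n :: "'a \<Rightarrow> int" where "\<And>j. x $ j = y $ j + n j" by metis
  then show ?thesis by (intro that[of n]) (simp add: vec_eq_iff)
qed

lemma trig_polynomial_emb:
  assumes "real_polynomial_function p"
  shows "trig (\<lambda>x. p (torus_emb x))"
  using assms
proof (induction rule: real_polynomial_function.induct)
  case (linear f)
  interpret bounded_linear f by fact
  have e: "torus_emb x = (\<Sum>j\<in>UNIV. cos (2 * pi * x $ j) *\<^sub>R (axis j 1, 0)) + (\<Sum>j\<in>UNIV. sin (2 * pi * x $ j) *\<^sub>R (0, axis j 1))"
    for x :: "real^'a"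
    by (simp add: torus_emb_def prod_eq_iff fst_sum snd_sum vec_eq_iff axis_def if_distrib cong: if_cong)
  have "f (torus_emb x) = (\<Sum>j\<in>UNIV. f (axis j 1, 0) * cos (2 * pi * x $ j)) + (\<Sum>j\<in>UNIV. f (0, axis j 1) * sin (2 * pi * x $ j))"
    for x :: "real^'a"
    unfolding e by (simp only: add sum scaleR) (simp add: mult.commute)
  then show ?case by (auto intro!: trig.add trig_sum trig_cmult trig.cos trig.sin)
qed (auto intro: trig.intros)

lemma trig_dense:
  fixes f :: "real^'d \<Rightarrow> real"
  assumes per: "periodic f" and cont: "continuous_on UNIV f" and e: "e > 0"
  obtains g where "trig g" "\<And>x. \<bar>f x - g x\<bar> < e"
proof -
  define K where "K = torus_emb ` (cbox 0 One :: (real^'d) set)"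
  have K: "compact K" unfolding K_def by (intro compact_continuous_image continuous_torus_emb) auto
  \<comment> \<open>The function f carried over to the image of the torus. Preimages of a point
    differ by integer vectors, so the choice does not affect the value.\<close>
  define h where "h y = f (SOME x. x \<in> cbox 0 One \<and> torus_emb x = y)" for y
  have h: "h (torus_emb x) = f x" if "x \<in> cbox 0 One" for x
  proof -
    define x' where "x' = (SOME x'. x' \<in> cbox 0 One \<and> torus_emb x' = torus_emb x)"
    have "x' \<in> cbox 0 One \<and> torus_emb x' = torus_emb x" unfolding x'_def by (rule someI) (use that in blast)
    then obtain n where "x' = x + (\<chi> j. of_int (n j))" using torus_emb_eq by blast
    then have "f x' = f x" using periodic_int[OF per] by simp
    then show ?thesis by (simp add: h_def x'_def)
  qed
  have "continuous_on K h"
    unfolding continuous_on_closed_vimage[OF compact_imp_closed[OF K]]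
  proof (intro allI impI)
    fix B :: "real set" assume B: "closed B"
    \<comment> \<open>The preimage of a closed set is the image of a compact set, so
      \<open>h\<close> is continuous although \<open>torus_emb\<close> has no inverse on the closed
      cell.\<close>
    have "h -` B \<inter> K = torus_emb ` (f -` B \<inter> cbox 0 One)"
      unfolding K_def using h by (auto simp: image_iff)
    moreover have "closed (f -` B)"
      using continuous_closed_vimage[OF B] cont by (auto simp: continuous_on_eq_continuous_at)
    ultimately show "closed (h -` B \<inter> K)"
      by (simp add: compact_imp_closed compact_continuous_image continuous_torus_emb closed_Int_compact)
  qed
  then obtain p where p: "real_polynomial_function p" "\<And>y. y \<in> K \<Longrightarrow> \<bar>h y - p y\<bar> < e"
    using Stone_Weierstrass_real_polynomial_function[OF K _ e] by metis
  have t: "trig (\<lambda>x. p (torus_emb x))" by (rule trig_polynomial_emb[OF p(1)])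
  have "\<bar>f x - p (torus_emb x)\<bar> < e" for x
    using p(2)[of "torus_emb (frac_vec x)"] h[OF frac_vec_cell, of x] frac_vec_cell[of x]
      periodic_frac_vec[OF per, of x] periodic_frac_vec[OF trig_periodic[OF t], of x]
    by (auto simp: K_def)
  then show ?thesis using that t by blast
qed

subsection \<open>Weak gradients\<close>

lemma has_weak_gradD:
  assumes "has_weak_grad f G"
  shows "f \<in> L2" "(\<lambda>x. G x $ j) \<in> L2"
    and "periodic \<phi> \<Longrightarrow> smooth \<phi> \<Longrightarrow>
      torus_integral (\<lambda>x. f x * pd j \<phi> x) = - torus_integral (\<lambda>x. G x $ j * \<phi> x)"
  using assms by (auto simp: has_weak_grad_def)

lemma Lipschitz_continuous:
  fixes \<psi> :: "'a::metric_space \<Rightarrow> real"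
  assumes "\<And>x y. \<bar>\<psi> x - \<psi> y\<bar> \<le> K * dist x y"
  shows "continuous_on S \<psi>"
proof (rule lipschitz_on_continuous_on)
  have "\<bar>\<psi> x - \<psi> y\<bar> \<le> \<bar>K\<bar> * dist x y" for x y
    by (rule order_trans[OF assms mult_right_mono]) auto
  then show "\<bar>K\<bar>-lipschitz_on S \<psi>" by (auto simp: lipschitz_on_def dist_real_def)
qed

lemma torus_integral_bound:
  assumes "f \<in> L2" "g \<in> borel_measurable cell" "\<And>x. \<bar>g x\<bar> \<le> C"
  shows "integrable cell (\<lambda>x. f x * g x)" "\<bar>torus_integral (\<lambda>x. f x * g x)\<bar> \<le> C * torus_integral (\<lambda>x. \<bar>f x\<bar>)"
proof -
  have f: "integrable cell (\<lambda>x. \<bar>f x\<bar>)"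
    using L2_mult_integrable[OF assms(1) L2_bounded[of "\<lambda>_. 1" 1]] by (auto simp: periodic_def dest: integrable_abs)
  have le: "\<bar>f x * g x\<bar> \<le> C * \<bar>f x\<bar>" for x
    using mult_left_mono[OF assms(3)[of x], of "\<bar>f x\<bar>"] by (simp add: abs_mult mult.commute)
  have le': "norm (f x * g x) \<le> norm (C * \<bar>f x\<bar>)" for x
    using order_trans[OF le abs_ge_self] by simp
  show int: "integrable cell (\<lambda>x. f x * g x)"
    by (rule Bochner_Integration.integrable_bound[of _ "\<lambda>x. C * \<bar>f x\<bar>"])
      (use f le' assms(2) L2D(3)[OF assms(1)] in auto)
  have "\<bar>torus_integral (\<lambda>x. f x * g x)\<bar> \<le> torus_integral (\<lambda>x. \<bar>f x * g x\<bar>)"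
    unfolding torus_integral_eq by (rule integral_abs_bound)
  also have "\<dots> \<le> torus_integral (\<lambda>x. C * \<bar>f x\<bar>)"
    unfolding torus_integral_eq using f int le by (intro integral_mono) auto
  finally show "\<bar>torus_integral (\<lambda>x. f x * g x)\<bar> \<le> C * torus_integral (\<lambda>x. \<bar>f x\<bar>)"
    by (simp add: torus_integral_eq)
qed

lemma tendsto_torus_integral_uniform:
  assumes f: "f \<in> L2" and g: "g \<in> borel_measurable cell" "\<And>n. gn n \<in> borel_measurable cell"
    and close: "\<And>n x. \<bar>g x - gn n x\<bar> \<le> inverse (real (Suc n))"
    and bd: "\<And>x. \<bar>g x\<bar> \<le> C"
  shows "(\<lambda>n. torus_integral (\<lambda>x. f x * gn n x)) \<longlonglongrightarrow> torus_integral (\<lambda>x. f x * g x)"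
proof (rule Lim_null[THEN iffD2], rule tendsto_rabs_zero_cancel, rule tendsto_sandwich[where f = "\<lambda>_. 0"])
  have int: "integrable cell (\<lambda>x. f x * g x)" by (rule torus_integral_bound(1)[OF f g(1) bd])
  have "\<bar>torus_integral (\<lambda>x. f x * gn n x) - torus_integral (\<lambda>x. f x * g x)\<bar>
      \<le> inverse (real (Suc n)) * torus_integral (\<lambda>x. \<bar>f x\<bar>)" for n
  proof -
    have m: "(\<lambda>x. gn n x - g x) \<in> borel_measurable cell" using g by simp
    have c: "\<bar>gn n x - g x\<bar> \<le> inverse (real (Suc n))" for x
      using close[of x n] by (simp add: abs_minus_commute)
    note b = torus_integral_bound[OF f m c]
    have "torus_integral (\<lambda>x. f x * gn n x) - torus_integral (\<lambda>x. f x * g x) = torus_integral (\<lambda>x. f x * (gn n x - g x))"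
      using Bochner_Integration.integral_add[OF b(1) int] by (simp add: torus_integral_eq algebra_simps)
    then show ?thesis using b(2) by simp
  qed
  then show "\<forall>\<^sub>F n in sequentially. \<bar>torus_integral (\<lambda>x. f x * gn n x) - torus_integral (\<lambda>x. f x * g x)\<bar>
      \<le> inverse (real (Suc n)) * torus_integral (\<lambda>x. \<bar>f x\<bar>)" by simp
  show "(\<lambda>n. inverse (real (Suc n)) * torus_integral (\<lambda>x. \<bar>f x\<bar>)) \<longlonglongrightarrow> 0"
    using tendsto_mult_right[OF LIMSEQ_inverse_real_of_nat] by (metis mult_zero_left)
qed auto

text \<open>The product rule with the weight \<open>exp (c V)\<close> needs Lipschitz test functions. The defining identity is
  therefore integrated along translates of a trigonometric polynomial: the increments over \<open>[0, h]\<close>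
  involve no derivative of the test function and extend by density.\<close>

lemma weak_grad_trig_shift:
  assumes G: "has_weak_grad f G" and \<phi>: "trig \<phi>"
  shows "((\<lambda>s. torus_integral (\<lambda>x. f x * \<phi> (x + s *\<^sub>R axis j 1))) has_real_derivative
     - torus_integral (\<lambda>x. G x $ j * \<phi> (x + s *\<^sub>R axis j 1))) (at s)"
proof -
  let ?e = "axis j 1 :: real^'a"
  define F where "F s = torus_integral (\<lambda>x. f x * \<phi> (x + s *\<^sub>R ?e))" for s
  define c where "c = torus_integral (\<lambda>x. f x * pd j \<phi> (x + s *\<^sub>R ?e))"
  have f: "f \<in> L2" using G by (simp add: has_weak_grad_def)
  obtain C where C: "\<And>x. \<bar>pd j (pd j \<phi>) x\<bar> \<le> C"
    using periodic_bounded trig_periodic trig_continuous trig_pd[OF trig_pd[OF \<phi>]] by metis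
  have C0: "0 \<le> C" using C[of 0] by linarith
  have line: "((\<lambda>r. \<psi> (x + r *\<^sub>R ?e)) has_real_derivative pd j \<psi> (x + r *\<^sub>R ?e)) (at r)" if "trig \<psi>" for \<psi> x r
  proof -
    have "(\<psi> has_derivative frechet_derivative \<psi> (at (x + r *\<^sub>R ?e))) (at (x + r *\<^sub>R ?e))"
      using trig_differentiable[OF that] frechet_derivative_works by blast
    moreover have "((\<lambda>r. x + r *\<^sub>R ?e) has_derivative (\<lambda>h. h *\<^sub>R ?e)) (at r)"
      by (auto intro!: derivative_eq_intros)
    ultimately have "((\<lambda>r. \<psi> (x + r *\<^sub>R ?e)) has_derivative (\<lambda>h. frechet_derivative \<psi> (at (x + r *\<^sub>R ?e)) (h *\<^sub>R ?e))) (at r)"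
      by (rule has_derivative_compose[rotated])
    moreover have "frechet_derivative \<psi> (at (x + r *\<^sub>R ?e)) (h *\<^sub>R ?e) = pd j \<psi> (x + r *\<^sub>R ?e) * h" for h
      using linear_frechet_derivative[OF trig_differentiable[OF that]]
      by (simp add: pd_def linear_scale)
    ultimately show ?thesis by (simp add: has_field_derivative_def)
  qed
  have pdb: "\<bar>pd j \<phi> (x + r *\<^sub>R ?e) - pd j \<phi> (x + s *\<^sub>R ?e)\<bar> \<le> C * \<bar>r - s\<bar>" for x r
    using field_differentiable_bound[OF convex_UNIV, of "\<lambda>r. pd j \<phi> (x + r *\<^sub>R ?e)" "\<lambda>r. pd j (pd j \<phi>) (x + r *\<^sub>R ?e)" C r s]
      line[OF trig_pd[OF \<phi>]] C by auto
  \<comment> \<open>A Taylor remainder bounded uniformly in x, which allows differentiation under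
    the integral.\<close>
  have quad: "\<bar>\<phi> (x + t *\<^sub>R ?e) - \<phi> (x + s *\<^sub>R ?e) - (t - s) * pd j \<phi> (x + s *\<^sub>R ?e)\<bar> \<le> C * \<bar>t - s\<bar> * \<bar>t - s\<bar>" for x t
  proof -
    have "norm ((\<phi> (x + t *\<^sub>R ?e) - t * pd j \<phi> (x + s *\<^sub>R ?e)) - (\<phi> (x + s *\<^sub>R ?e) - s * pd j \<phi> (x + s *\<^sub>R ?e)))
        \<le> (C * \<bar>t - s\<bar>) * norm (t - s)"
    proof (rule field_differentiable_bound[OF convex_closed_segment[of s t],
        where f' = "\<lambda>r. pd j \<phi> (x + r *\<^sub>R ?e) - pd j \<phi> (x + s *\<^sub>R ?e)"])
      fix r assume r: "r \<in> closed_segment s t"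
      show "((\<lambda>r. \<phi> (x + r *\<^sub>R ?e) - r * pd j \<phi> (x + s *\<^sub>R ?e)) has_field_derivative
          pd j \<phi> (x + r *\<^sub>R ?e) - pd j \<phi> (x + s *\<^sub>R ?e)) (at r within closed_segment s t)"
        by (rule has_field_derivative_at_within) (auto intro!: derivative_eq_intros line[OF \<phi>])
      have "C * \<bar>r - s\<bar> \<le> C * \<bar>t - s\<bar>"
        using r C0 by (intro mult_left_mono) (auto simp: closed_segment_eq_real_ivl split: if_splits)
      then show "norm (pd j \<phi> (x + r *\<^sub>R ?e) - pd j \<phi> (x + s *\<^sub>R ?e)) \<le> C * \<bar>t - s\<bar>"
        using pdb[of x r] by simp
    qed auto
    then show ?thesis by (simp add: algebra_simps)
  qed
  have sh: "trig (\<lambda>x. \<phi> (x + t *\<^sub>R ?e))" "trig (\<lambda>x. pd j \<phi> (x + t *\<^sub>R ?e))" for t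
    using trig_shift \<phi> trig_pd by blast+
  have Fq: "\<bar>F t - F s - (t - s) * c\<bar> \<le> C * \<bar>t - s\<bar> * \<bar>t - s\<bar> * torus_integral (\<lambda>x. \<bar>f x\<bar>)" for t
  proof -
    have "(\<lambda>x. \<phi> (x + t *\<^sub>R ?e) - \<phi> (x + s *\<^sub>R ?e) - (t - s) * pd j \<phi> (x + s *\<^sub>R ?e)) \<in> borel_measurable cell"
      using sh[THEN trig_L2, THEN L2D(3)] by simp
    note b = torus_integral_bound(2)[OF f this quad]
    have "torus_integral (\<lambda>x. f x * (\<phi> (x + t *\<^sub>R ?e) - \<phi> (x + s *\<^sub>R ?e) - (t - s) * pd j \<phi> (x + s *\<^sub>R ?e))) = F t - F s - (t - s) * c"
    proof -
      have "f x * (\<phi> (x + t *\<^sub>R ?e) - \<phi> (x + s *\<^sub>R ?e) - (t - s) * pd j \<phi> (x + s *\<^sub>R ?e))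
        = f x * \<phi> (x + t *\<^sub>R ?e) - f x * \<phi> (x + s *\<^sub>R ?e) - (t - s) * (f x * pd j \<phi> (x + s *\<^sub>R ?e))" for x
        by (simp add: algebra_simps)
      then show ?thesis
        using L2_mult_integrable[OF f trig_L2[OF sh(1)], of t] L2_mult_integrable[OF f trig_L2[OF sh(1)], of s]
          L2_mult_integrable[OF f trig_L2[OF sh(2)], of s]
        by (simp add: F_def c_def torus_integral_eq)
    qed
    then show ?thesis using b by simp
  qed
  have "(F has_real_derivative c) (at s)"
    unfolding has_field_derivative_iff
  proof (rule Lim_null[THEN iffD2], rule tendsto_rabs_zero_cancel, rule tendsto_sandwich[where f = "\<lambda>_. 0"])
    let ?B = "C * torus_integral (\<lambda>x. \<bar>f x\<bar>)"
    have "\<bar>(F t - F s) / (t - s) - c\<bar> \<le> ?B * \<bar>t - s\<bar>" if "t \<noteq> s" for t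
    proof -
      have "\<bar>(F t - F s) / (t - s) - c\<bar> = \<bar>F t - F s - (t - s) * c\<bar> / \<bar>t - s\<bar>"
        using that by (simp add: abs_divide[symmetric] diff_divide_distrib)
      also have "\<dots> \<le> (?B * \<bar>t - s\<bar> * \<bar>t - s\<bar>) / \<bar>t - s\<bar>"
        using Fq[of t] by (intro divide_right_mono) (simp_all add: mult_ac)
      finally show ?thesis using that by simp
    qed
    then show "\<forall>\<^sub>F t in at s. \<bar>(F t - F s) / (t - s) - c\<bar> \<le> ?B * \<bar>t - s\<bar>"
      by (auto simp: eventually_at_filter)
    have "((\<lambda>t. ?B * \<bar>t - s\<bar>) \<longlongrightarrow> ?B * \<bar>s - s\<bar>) (at s)" by (intro tendsto_intros)
    then show "((\<lambda>t. ?B * \<bar>t - s\<bar>) \<longlongrightarrow> 0) (at s)" by simp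
  qed auto
  moreover have "c = - torus_integral (\<lambda>x. G x $ j * \<phi> (x + s *\<^sub>R ?e))"
  proof -
    \<comment> \<open>Translation commutes with differentiation, so the translated polynomial can be
      inserted as a test function into the definition of the weak gradient.\<close>
    have "pd j (\<lambda>x. \<phi> (x + s *\<^sub>R ?e)) x = pd j \<phi> (x + s *\<^sub>R ?e)" for x
    proof -
      have "(\<phi> has_derivative frechet_derivative \<phi> (at (x + s *\<^sub>R ?e))) (at (x + s *\<^sub>R ?e))"
        using trig_differentiable[OF \<phi>] frechet_derivative_works by blast
      then have "((\<lambda>x. \<phi> (x + s *\<^sub>R ?e)) has_derivative frechet_derivative \<phi> (at (x + s *\<^sub>R ?e))) (at x)"
        by (rule has_derivative_compose[rotated]) (auto intro!: derivative_eq_intros)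
      then show ?thesis unfolding pd_def by (simp add: frechet_derivative_at[symmetric])
    qed
    then show ?thesis
      using has_weak_gradD(3)[OF G trig_periodic[OF sh(1)] trig_smooth[OF sh(1)], of j s] by (simp add: c_def)
  qed
  ultimately show ?thesis by (simp add: F_def[abs_def])
qed

text \<open>The mean value inequality is applied to trigonometric approximations of \<psi>. They
  inherit the Lipschitz bound up to twice the uniform error, and as none of their derivatives
  occurs, the error can be sent to 0.\<close>

lemma weak_grad_Lipschitz_increment:
  assumes G: "has_weak_grad f G" and per: "periodic \<psi>" and lip: "\<And>x y. \<bar>\<psi> x - \<psi> y\<bar> \<le> K * dist x y"
  shows "\<bar>torus_integral (\<lambda>x. f x * \<psi> (x + h *\<^sub>R axis j 1)) - torus_integral (\<lambda>x. f x * \<psi> x) + h * torus_integral (\<lambda>x. G x $ j * \<psi> x)\<bar>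
    \<le> K * h\<^sup>2 * torus_integral (\<lambda>x. \<bar>G x $ j\<bar>)"
proof -
  let ?e = "axis j 1 :: real^'a"
  have f: "f \<in> L2" and g: "(\<lambda>x. G x $ j) \<in> L2" using G by (auto simp: has_weak_grad_def)
  let ?T = "torus_integral (\<lambda>x. \<bar>G x $ j\<bar>)"
  have cont: "continuous_on S \<psi>" for S
    by (rule Lipschitz_continuous[OF lip])
  have "\<exists>g. trig g \<and> (\<forall>x. \<bar>\<psi> x - g x\<bar> < inverse (real (Suc n)))" for n
    using trig_dense[OF per cont, of "inverse (real (Suc n))"] by (metis inverse_positive_iff_positive of_nat_0_less_iff zero_less_Suc)
  then obtain \<phi> where \<phi>: "\<And>n. trig (\<phi> n)" and cl: "\<And>n x. \<bar>\<psi> x - \<phi> n x\<bar> < inverse (real (Suc n))" by metis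
  obtain C where C: "\<And>x. \<bar>\<psi> x\<bar> \<le> C" using periodic_bounded[OF per cont] by blast
  have step: "\<bar>torus_integral (\<lambda>x. f x * \<phi> n (x + h *\<^sub>R ?e)) - torus_integral (\<lambda>x. f x * \<phi> n x) + h * torus_integral (\<lambda>x. G x $ j * \<phi> n x)\<bar>
      \<le> (K * \<bar>h\<bar> + 2 * inverse (real (Suc n))) * ?T * \<bar>h\<bar>" for n
  proof -
    have sh: "trig (\<lambda>x. \<phi> n (x + s *\<^sub>R ?e))" for s using trig_shift[OF \<phi>] .
    define F where "F s = torus_integral (\<lambda>x. f x * \<phi> n (x + s *\<^sub>R ?e)) + s * torus_integral (\<lambda>x. G x $ j * \<phi> n x)" for s
    have "norm (F h - F 0) \<le> ((K * \<bar>h\<bar> + 2 * inverse (real (Suc n))) * ?T) * norm (h - 0)"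
    proof (rule field_differentiable_bound[OF convex_closed_segment[of 0 h]])
      fix s assume s: "s \<in> closed_segment 0 h"
      show "(F has_field_derivative (- torus_integral (\<lambda>x. G x $ j * \<phi> n (x + s *\<^sub>R ?e)) + torus_integral (\<lambda>x. G x $ j * \<phi> n x)))
          (at s within closed_segment 0 h)"
        unfolding F_def by (rule has_field_derivative_at_within) (auto intro!: derivative_eq_intros weak_grad_trig_shift[OF G \<phi>])
      have sh': "\<bar>s\<bar> \<le> \<bar>h\<bar>" using s by (auto simp: closed_segment_eq_real_ivl split: if_splits)
      have "\<bar>\<phi> n x - \<phi> n (x + s *\<^sub>R ?e)\<bar> \<le> K * \<bar>h\<bar> + 2 * inverse (real (Suc n))" for x
      proof -
        have "\<bar>\<psi> x - \<psi> (x + s *\<^sub>R ?e)\<bar> \<le> K * \<bar>s\<bar>" using lip[of x "x + s *\<^sub>R ?e"] by (simp add: dist_norm norm_axis_1)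
        moreover have "0 \<le> K" using lip[of 0 ?e] by (simp add: dist_norm norm_axis_1)
        then have "K * \<bar>s\<bar> \<le> K * \<bar>h\<bar>" using sh' by (intro mult_left_mono) auto
        ultimately show ?thesis using cl[of x n] cl[of "x + s *\<^sub>R ?e" n] by linarith
      qed
      moreover have "(\<lambda>x. \<phi> n x - \<phi> n (x + s *\<^sub>R ?e)) \<in> borel_measurable cell"
        using sh[THEN trig_L2, THEN L2D(3)] \<phi>[THEN trig_L2, THEN L2D(3)] by simp
      ultimately have "\<bar>torus_integral (\<lambda>x. G x $ j * (\<phi> n x - \<phi> n (x + s *\<^sub>R ?e)))\<bar> \<le> (K * \<bar>h\<bar> + 2 * inverse (real (Suc n))) * ?T"
        by (intro torus_integral_bound(2)[OF g])
      moreover have "torus_integral (\<lambda>x. G x $ j * (\<phi> n x - \<phi> n (x + s *\<^sub>R ?e)))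
          = torus_integral (\<lambda>x. G x $ j * \<phi> n x) - torus_integral (\<lambda>x. G x $ j * \<phi> n (x + s *\<^sub>R ?e))"
        using L2_mult_integrable[OF g trig_L2[OF sh], of s] L2_mult_integrable[OF g trig_L2[OF \<phi>], of n]
        by (simp add: torus_integral_eq right_diff_distrib)
      ultimately show "norm (- torus_integral (\<lambda>x. G x $ j * \<phi> n (x + s *\<^sub>R ?e)) + torus_integral (\<lambda>x. G x $ j * \<phi> n x))
          \<le> (K * \<bar>h\<bar> + 2 * inverse (real (Suc n))) * ?T" by simp
    qed auto
    then show ?thesis by (simp add: F_def algebra_simps)
  qed
  have "continuous_on UNIV (\<lambda>x. \<psi> (x + h *\<^sub>R ?e))"
    by (rule continuous_on_compose2[OF cont[of UNIV]]) (auto intro: continuous_intros)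
  then have meas: "\<psi> \<in> borel_measurable cell" "(\<lambda>x. \<psi> (x + h *\<^sub>R ?e)) \<in> borel_measurable cell"
    by (intro continuous_periodic_L2[THEN L2D(3)] periodic_shift per cont)+
  have "\<bar>torus_integral (\<lambda>x. f x * \<psi> (x + h *\<^sub>R ?e)) - torus_integral (\<lambda>x. f x * \<psi> x) + h * torus_integral (\<lambda>x. G x $ j * \<psi> x)\<bar>
      \<le> (K * \<bar>h\<bar> + 2 * 0) * ?T * \<bar>h\<bar>"
  proof (rule LIMSEQ_le)
    show "(\<lambda>n. \<bar>torus_integral (\<lambda>x. f x * \<phi> n (x + h *\<^sub>R ?e)) - torus_integral (\<lambda>x. f x * \<phi> n x) + h * torus_integral (\<lambda>x. G x $ j * \<phi> n x)\<bar>)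
      \<longlonglongrightarrow> \<bar>torus_integral (\<lambda>x. f x * \<psi> (x + h *\<^sub>R ?e)) - torus_integral (\<lambda>x. f x * \<psi> x) + h * torus_integral (\<lambda>x. G x $ j * \<psi> x)\<bar>"
      by (intro tendsto_intros tendsto_torus_integral_uniform[where C = C] f g meas less_imp_le[OF cl] C
          trig_L2[THEN L2D(3)] \<phi> trig_shift)
    show "(\<lambda>n. (K * \<bar>h\<bar> + 2 * inverse (real (Suc n))) * ?T * \<bar>h\<bar>) \<longlonglongrightarrow> (K * \<bar>h\<bar> + 2 * 0) * ?T * \<bar>h\<bar>"
      by (intro tendsto_intros LIMSEQ_inverse_real_of_nat)
  qed (use step in blast)
  also have "(K * \<bar>h\<bar> + 2 * 0) * ?T * \<bar>h\<bar> = K * h\<^sup>2 * ?T" by (simp add: power2_eq_square)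
  finally show ?thesis .
qed

text \<open>Divides the increment by h = 1 / (n + 1): the error of order h^2 disappears, and the
  difference quotients converge under the integral with the dominating function K |f|. Here
  \<open>d\<close> stands for a derivative that exists only almost everywhere.\<close>

lemma weak_grad_Lipschitz:
  assumes G: "has_weak_grad f G" and per: "periodic \<psi>" and lip: "\<And>x y. \<bar>\<psi> x - \<psi> y\<bar> \<le> K * dist x y"
    and d: "AE x in lebesgue. (\<lambda>n. (\<psi> (x + inverse (real (Suc n)) *\<^sub>R axis j 1) - \<psi> x) * real (Suc n)) \<longlonglongrightarrow> d x"
    and dm: "d \<in> borel_measurable lebesgue"
  shows "torus_integral (\<lambda>x. f x * d x) = - torus_integral (\<lambda>x. G x $ j * \<psi> x)"
proof -
  let ?e = "axis j 1 :: real^'a"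
  let ?r = "\<lambda>n. inverse (real (Suc n))"
  have f: "f \<in> L2" using G by (auto simp: has_weak_grad_def)
  have cont: "continuous_on S \<psi>" for S
    by (rule Lipschitz_continuous[OF lip])
  have "continuous_on UNIV (\<lambda>x. \<psi> (x + c))" for c
    by (rule continuous_on_compose2[OF cont[of UNIV]]) (auto intro: continuous_intros)
  then have L2: "\<psi> \<in> L2" "(\<lambda>x. \<psi> (x + h *\<^sub>R ?e)) \<in> L2" for h
    by (intro continuous_periodic_L2 periodic_shift per cont; blast)+
  have fi: "integrable cell (\<lambda>x. \<bar>f x\<bar>)"
    using L2_mult_integrable[OF f L2_bounded[of "\<lambda>_. 1" 1]] by (auto simp: periodic_def dest: integrable_abs)
  have 1: "(\<lambda>n. integral\<^sup>L cell (\<lambda>x. f x * ((\<psi> (x + ?r n *\<^sub>R ?e) - \<psi> x) * real (Suc n)))) \<longlonglongrightarrow> integral\<^sup>L cell (\<lambda>x. f x * d x)"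
  proof (rule integral_dominated_convergence[where w = "\<lambda>x. K * \<bar>f x\<bar>"])
    show "AE x in cell. (\<lambda>n. f x * ((\<psi> (x + ?r n *\<^sub>R ?e) - \<psi> x) * real (Suc n))) \<longlonglongrightarrow> f x * d x"
      using AE_cell[OF d] by eventually_elim (intro tendsto_intros)
    show "AE x in cell. norm (f x * ((\<psi> (x + ?r n *\<^sub>R ?e) - \<psi> x) * real (Suc n))) \<le> K * \<bar>f x\<bar>" for n
    proof (rule AE_I2)
      fix x
      have "\<bar>\<psi> (x + ?r n *\<^sub>R ?e) - \<psi> x\<bar> \<le> K * ?r n" using lip[of "x + ?r n *\<^sub>R ?e" x] by (simp add: dist_norm norm_axis_1)
      then have "\<bar>\<psi> (x + ?r n *\<^sub>R ?e) - \<psi> x\<bar> * real (Suc n) \<le> K" by (simp add: field_simps)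
      then have "\<bar>f x\<bar> * (\<bar>\<psi> (x + ?r n *\<^sub>R ?e) - \<psi> x\<bar> * real (Suc n)) \<le> \<bar>f x\<bar> * K" by (intro mult_left_mono) auto
      then show "norm (f x * ((\<psi> (x + ?r n *\<^sub>R ?e) - \<psi> x) * real (Suc n))) \<le> K * \<bar>f x\<bar>"
        by (simp add: abs_mult mult.commute)
    qed
  qed (use fi L2D(3)[OF f] L2[THEN L2D(3)] measurable_cell[OF dm] in auto)
  have 2: "integral\<^sup>L cell (\<lambda>x. f x * ((\<psi> (x + ?r n *\<^sub>R ?e) - \<psi> x) * real (Suc n)))
     = (torus_integral (\<lambda>x. f x * \<psi> (x + ?r n *\<^sub>R ?e)) - torus_integral (\<lambda>x. f x * \<psi> x)) * real (Suc n)" for n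
  proof -
    have eq: "f x * ((\<psi> (x + ?r n *\<^sub>R ?e) - \<psi> x) * real (Suc n)) = (f x * \<psi> (x + ?r n *\<^sub>R ?e) - f x * \<psi> x) * real (Suc n)" for x
      by (simp add: algebra_simps)
    show ?thesis unfolding eq torus_integral_eq
      using L2_mult_integrable[OF f L2(2), of "?r n"] L2_mult_integrable[OF f L2(1)]
      by (simp del: of_nat_Suc)
  qed
  have 3: "(\<lambda>n. (torus_integral (\<lambda>x. f x * \<psi> (x + ?r n *\<^sub>R ?e)) - torus_integral (\<lambda>x. f x * \<psi> x)) * real (Suc n))
     \<longlonglongrightarrow> - torus_integral (\<lambda>x. G x $ j * \<psi> x)"
  proof (rule Lim_null[THEN iffD2], rule tendsto_rabs_zero_cancel, rule tendsto_sandwich[where f = "\<lambda>_. 0"])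
    let ?I = "\<lambda>n. torus_integral (\<lambda>x. f x * \<psi> (x + ?r n *\<^sub>R ?e)) - torus_integral (\<lambda>x. f x * \<psi> x)"
    let ?J = "torus_integral (\<lambda>x. G x $ j * \<psi> x)"
    have "\<bar>?I n * real (Suc n) - - ?J\<bar> \<le> K * ?r n * torus_integral (\<lambda>x. \<bar>G x $ j\<bar>)" for n
    proof -
      have "\<bar>?I n * real (Suc n) - - ?J\<bar> = \<bar>?I n + ?r n * ?J\<bar> * real (Suc n)"
      proof -
        have "?I n * real (Suc n) - - ?J = (?I n + ?r n * ?J) * real (Suc n)"
          by (simp add: distrib_right del: of_nat_Suc)
        then show ?thesis by (simp add: abs_mult del: of_nat_Suc)
      qed
      also have "\<dots> \<le> (K * (?r n)\<^sup>2 * torus_integral (\<lambda>x. \<bar>G x $ j\<bar>)) * real (Suc n)"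
        by (intro mult_right_mono weak_grad_Lipschitz_increment[OF G per lip]) auto
      also have "\<dots> = K * ?r n * torus_integral (\<lambda>x. \<bar>G x $ j\<bar>)"
        by (simp add: power2_eq_square del: of_nat_Suc)
      finally show ?thesis .
    qed
    then show "\<forall>\<^sub>F n in sequentially. \<bar>?I n * real (Suc n) - - ?J\<bar> \<le> K * ?r n * torus_integral (\<lambda>x. \<bar>G x $ j\<bar>)" by simp
    have "(\<lambda>n. K * ?r n * torus_integral (\<lambda>x. \<bar>G x $ j\<bar>)) \<longlonglongrightarrow> K * 0 * torus_integral (\<lambda>x. \<bar>G x $ j\<bar>)"
      by (intro tendsto_intros LIMSEQ_inverse_real_of_nat)
    then show "(\<lambda>n. K * ?r n * torus_integral (\<lambda>x. \<bar>G x $ j\<bar>)) \<longlonglongrightarrow> 0" by simp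
  qed auto
  show ?thesis
    using LIMSEQ_unique[OF 1[unfolded 2] 3] by (simp add: torus_integral_eq)
qed

text \<open>The indicator of a box \<open>B\<close> inside the cell is the limit of functions of the distance, in the embedded torus,
  to the image of \<open>B\<close>; these are continuous and periodic.\<close>

lemma trig_orthogonal_imp_AE_0:
  fixes g :: "real^'d \<Rightarrow> real"
  assumes g: "g \<in> L2" and orth: "\<And>\<phi>. trig \<phi> \<Longrightarrow> torus_integral (\<lambda>x. g x * \<phi> x) = 0"
  shows "AE x in cell. g x = 0"
proof -
  have gi: "integrable cell g"
    using L2_mult_integrable[OF g L2_bounded[of "\<lambda>_. 1" 1]] by (auto simp: periodic_def)
  have orth_cont: "torus_integral (\<lambda>x. g x * \<psi> x) = 0" if per: "periodic \<psi>" and cont: "continuous_on UNIV \<psi>" for \<psi>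
  proof -
    have "\<exists>\<phi>. trig \<phi> \<and> (\<forall>x. \<bar>\<psi> x - \<phi> x\<bar> < inverse (real (Suc n)))" for n
      using trig_dense[OF per cont, of "inverse (real (Suc n))"] by (metis inverse_positive_iff_positive of_nat_0_less_iff zero_less_Suc)
    then obtain \<phi> where \<phi>: "\<And>n. trig (\<phi> n)" and cl: "\<And>n x. \<bar>\<psi> x - \<phi> n x\<bar> < inverse (real (Suc n))" by metis
    obtain C where C: "\<And>x. \<bar>\<psi> x\<bar> \<le> C" using periodic_bounded[OF per cont] by blast
    have "(\<lambda>n. torus_integral (\<lambda>x. g x * \<phi> n x)) \<longlonglongrightarrow> torus_integral (\<lambda>x. g x * \<psi> x)"
      by (intro tendsto_torus_integral_uniform[where C = C] g C less_imp_le[OF cl] trig_L2[THEN L2D(3)] \<phi>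
          continuous_periodic_L2[OF per cont, THEN L2D(3)])
    then show ?thesis by (simp add: orth[OF \<phi>] LIMSEQ_const_iff)
  qed
  have box0: "torus_integral (\<lambda>x. g x * indicator (cbox a b) x) = 0" if sub: "cbox a b \<subseteq> box 0 One" and ne: "cbox a b \<noteq> {}" for a b
  proof -
    define K where "K = torus_emb ` cbox a b"
    have K: "closed K" "K \<noteq> {}"
      unfolding K_def using ne by (auto intro!: compact_imp_closed compact_continuous_image continuous_torus_emb)
    \<comment> \<open>Equal to 1 on the image of the box and, for n > 0, equal to 0 at distance 1 /
      n or more from it.\<close>
    define \<psi> where "\<psi> n x = max 0 (1 - real n * infdist (torus_emb x) K)" for n x
    have per: "periodic (\<psi> n)" for n
    proof -
      have "torus_emb (x + axis j 1) = torus_emb x" for x :: "real^'d" and j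
      proof -
        have "cos (2 * pi * (x + axis j 1) $ k) = cos (2 * pi * x $ k)" "sin (2 * pi * (x + axis j 1) $ k) = sin (2 * pi * x $ k)" for k
          by (cases "k = j"; auto simp: axis_def distrib_left)+
        then show ?thesis by (simp add: torus_emb_def)
      qed
      then show ?thesis by (simp add: periodic_def \<psi>_def)
    qed
    have cont: "continuous_on UNIV (\<psi> n)" for n
      unfolding \<psi>_def by (intro continuous_intros continuous_torus_emb)
    have lim: "(\<lambda>n. \<psi> n x) \<longlonglongrightarrow> indicator (cbox a b) x" if x: "x \<in> cbox 0 One" for x
    proof (cases "x \<in> cbox a b")
      case True
      then have "infdist (torus_emb x) K = 0" by (simp add: K_def)
      then show ?thesis using True by (simp add: \<psi>_def)
    next
      case False
      \<comment> \<open>The coordinates of a point of the box lie strictly between 0 and 1, so no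
        other point of the closed cell has the same image.\<close>
      have "torus_emb x \<notin> K"
      proof
        assume "torus_emb x \<in> K"
        then obtain y where y: "y \<in> cbox a b" "torus_emb x = torus_emb y" by (auto simp: K_def)
        then obtain n where n: "x = y + (\<chi> j. of_int (n j))" using torus_emb_eq by blast
        have "n j = 0" for j
        proof -
          have "0 < y $ j" "y $ j < 1" using y sub mem_unit_box by blast+
          moreover have "0 \<le> x $ j" "x $ j \<le> 1" using x mem_unit_cbox by blast+
          ultimately have "\<bar>real_of_int (n j)\<bar> < 1" using n by simp
          then show ?thesis by linarith
        qed
        then have "x = y" using n by (simp add: vec_eq_iff)
        then show False using y False by simp
      qed
      then have pos: "infdist (torus_emb x) K > 0"
        using in_closed_iff_infdist_zero[OF K] infdist_nonneg[of "torus_emb x" K] by (simp add: less_le)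
      obtain N where N: "1 < real N * infdist (torus_emb x) K" using reals_Archimedean3[OF pos] by blast
      have "\<psi> n x = 0" if "n \<ge> N" for n
      proof -
        have "real N * infdist (torus_emb x) K \<le> real n * infdist (torus_emb x) K"
          using that pos by (intro mult_right_mono) auto
        then show ?thesis using N by (simp add: \<psi>_def)
      qed
      then have "\<forall>\<^sub>F n in sequentially. \<psi> n x = 0" by (auto simp: eventually_sequentially)
      then show ?thesis using False by (simp add: tendsto_eventually)
    qed
    have "(\<lambda>n. integral\<^sup>L cell (\<lambda>x. g x * \<psi> n x)) \<longlonglongrightarrow> integral\<^sup>L cell (\<lambda>x. g x * indicator (cbox a b) x)"
    proof (rule integral_dominated_convergence[where w = "\<lambda>x. \<bar>g x\<bar>"])
      show "(\<lambda>x. g x * indicator (cbox a b) x) \<in> borel_measurable cell"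
        by (intro borel_measurable_times L2D(3)[OF g] measurable_cell borel_measurable_indicator) auto
      show "(\<lambda>x. g x * \<psi> n x) \<in> borel_measurable cell" for n
        by (intro borel_measurable_times L2D(3)[OF g] continuous_periodic_L2[OF per cont, THEN L2D(3)])
      show "AE x in cell. (\<lambda>n. g x * \<psi> n x) \<longlonglongrightarrow> g x * indicator (cbox a b) x"
        by (rule AE_I2) (auto intro!: tendsto_intros lim)
      show "AE x in cell. norm (g x * \<psi> n x) \<le> \<bar>g x\<bar>" for n
      proof (rule AE_I2)
        fix x
        have "\<bar>\<psi> n x\<bar> \<le> 1" by (auto simp: \<psi>_def infdist_nonneg)
        then show "norm (g x * \<psi> n x) \<le> \<bar>g x\<bar>" using mult_left_mono[of "\<bar>\<psi> n x\<bar>" 1 "\<bar>g x\<bar>"] by (simp add: abs_mult)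
      qed
    qed (use gi in auto)
    moreover have "integral\<^sup>L cell (\<lambda>x. g x * \<psi> n x) = 0" for n
      using orth_cont[OF per cont] by (simp add: torus_integral_eq)
    ultimately show ?thesis by (simp add: torus_integral_eq LIMSEQ_const_iff)
  qed
  \<comment> \<open>Extension by zero, prepared for Lebesgue's differentiation theorem on cubes with
    lower corner x: for x in the open cell, small cubes stay inside it, and by \<open>box0\<close>
    their integrals vanish.\<close>
  define f where "f x = indicator (cbox 0 One) x * g x" for x
  have fi: "integrable lebesgue f"
    using gi by (subst (asm) integrable_restrict_space) (auto simp: f_def[abs_def])
  have fs: "set_integrable lebesgue (cbox a b) f" for a b
    unfolding set_integrable_def using fi by (intro integrable_mult_indicator) auto
  have fint: "integral (cbox a b) f = torus_integral (\<lambda>x. g x * indicator (cbox a b) x)" for a b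
  proof -
    have "integral (cbox a b) f = (LINT x|lebesgue. indicator (cbox 0 One) x *\<^sub>R (g x * indicator (cbox a b) x))"
      using set_lebesgue_integral_eq_integral(2)[OF fs, of a b] by (simp add: set_lebesgue_integral_def f_def mult_ac)
    then show ?thesis by (simp add: torus_integral_def set_lebesgue_integral_def)
  qed
  obtain N where N: "negligible N" "\<And>x e. x \<notin> N \<Longrightarrow> 0 < e \<Longrightarrow> \<exists>d>0. \<forall>h. 0 < h \<and> h < d \<longrightarrow>
      norm (integral (cbox x (x + h *\<^sub>R One)) f /\<^sub>R h ^ DIM(real^'d) - f x) < e"
    using integrable_ccontinuous_explicit[of f] set_lebesgue_integral_eq_integral(1)[OF fs] by blast
  have f0: "f x = 0" if x: "x \<in> box 0 One" "x \<notin> N" for x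
  proof (rule ccontr)
    assume "f x \<noteq> 0"
    then obtain d where d: "d > 0" "\<And>h. 0 < h \<and> h < d \<Longrightarrow>
        norm (integral (cbox x (x + h *\<^sub>R One)) f /\<^sub>R h ^ DIM(real^'d) - f x) < \<bar>f x\<bar>"
      using N(2)[OF x(2), of "\<bar>f x\<bar>"] by auto
    obtain d' where d': "d' > 0" "ball x d' \<subseteq> box 0 One" using open_box x(1) open_contains_ball by blast
    define h where "h = min (d / 2) (d' / (2 * norm (One :: real^'d)))"
    have n0: "norm (One :: real^'d) > 0" using One_nth by (metis one_neq_zero zero_index zero_less_norm_iff)
    have h: "0 < h" "h < d" "h * norm (One :: real^'d) < d'"
    proof -
      have "h * norm (One :: real^'d) \<le> d' / (2 * norm (One :: real^'d)) * norm (One :: real^'d)"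
        by (intro mult_right_mono) (auto simp: h_def)
      then show "h * norm (One :: real^'d) < d'" using n0 d' by simp
    qed (use d d' n0 in \<open>auto simp: h_def\<close>)
    have "cbox x (x + h *\<^sub>R One) \<subseteq> ball x d'"
    proof
      fix y assume y: "y \<in> cbox x (x + h *\<^sub>R One)"
      have "norm (y - x) \<le> norm (h *\<^sub>R (One :: real^'d))"
      proof (rule norm_le_componentwise_cart)
        fix i
        have "x $ i \<le> y $ i" "y $ i \<le> x $ i + h"
          using y by (simp_all add: mem_box_cart One_nth del: sum_component)
        then show "norm ((y - x) $ i) \<le> norm ((h *\<^sub>R (One :: real^'d)) $ i)"
          by (simp add: One_nth del: sum_component)
      qed
      then show "y \<in> ball x d'" using h by (simp add: dist_norm norm_minus_commute)
    qed
    moreover have "x \<in> cbox x (x + h *\<^sub>R One)" using h(1) by (simp add: mem_box_cart One_nth del: sum_component)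
    ultimately have "integral (cbox x (x + h *\<^sub>R One)) f = 0"
      unfolding fint using d' by (intro box0) auto
    then show False using d(2)[of h] h by simp
  qed
  have "AE x in lebesgue. x \<notin> N"
    using N(1) by (intro AE_not_in) (simp add: negligible_iff_null_sets)
  moreover have "AE x in lebesgue. x \<notin> cbox (0::real^'d) One - box 0 One"
    using negligible_frontier_interval[of "0::real^'d" One]
    by (intro AE_not_in) (simp add: negligible_iff_null_sets)
  ultimately have "AE x in lebesgue. x \<in> cbox 0 One \<longrightarrow> g x = 0"
    by eventually_elim (use f0 in \<open>force simp: f_def\<close>)
  then show ?thesis by (subst AE_restrict_space_iff) auto
qed

section \<open>Uniqueness of weak gradients\<close>

lemma weak_grad_unique:
  assumes G: "has_weak_grad f G" and G': "has_weak_grad f' G'" and ff': "AE x in cell. f x = f' x"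
  shows "AE x in cell. G x = G' x"
proof -
  have "AE x in cell. G x $ j - G' x $ j = 0" for j
  proof (rule trig_orthogonal_imp_AE_0)
    show "(\<lambda>x. G x $ j - G' x $ j) \<in> L2" by (intro L2_diff has_weak_gradD(2)[OF G] has_weak_gradD(2)[OF G'])
    fix \<phi> :: "real^'a \<Rightarrow> real" assume \<phi>: "trig \<phi>"
    note s = trig_periodic[OF \<phi>] trig_smooth[OF \<phi>]
    have "torus_integral (\<lambda>x. f x * pd j \<phi> x) = torus_integral (\<lambda>x. f' x * pd j \<phi> x)"
      by (rule torus_integral_mult_cong)
        (use G G' ff' trig_L2[OF trig_pd[OF \<phi>]] in \<open>auto simp: l2_rel_def has_weak_gradD(1)\<close>)
    then have "torus_integral (\<lambda>x. G x $ j * \<phi> x) = torus_integral (\<lambda>x. G' x $ j * \<phi> x)"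
      using has_weak_gradD(3)[OF G s, of j] has_weak_gradD(3)[OF G' s, of j] by simp
    then show "torus_integral (\<lambda>x. (G x $ j - G' x $ j) * \<phi> x) = 0"
      using L2_mult_integrable[OF has_weak_gradD(2)[OF G] trig_L2[OF \<phi>], of j]
        L2_mult_integrable[OF has_weak_gradD(2)[OF G'] trig_L2[OF \<phi>], of j]
      by (simp add: torus_integral_eq left_diff_distrib)
  qed
  then have "AE x in cell. \<forall>j. G x $ j - G' x $ j = 0" by (simp add: AE_all_countable)
  then show ?thesis by eventually_elim (simp add: vec_eq_iff)
qed

lemma wgrad: "f \<in> H1 \<Longrightarrow> has_weak_grad f (wgrad f)"
  using someI_ex[of "has_weak_grad f"] unfolding H1_def wgrad_def by simp

lemma wgrad_AE: "has_weak_grad f G \<Longrightarrow> AE x in cell. wgrad f x = G x"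
  by (rule weak_grad_unique[of f _ f]) (auto intro!: wgrad simp: H1_def)

lemma H1I: "has_weak_grad f G \<Longrightarrow> f \<in> H1"
  by (auto simp: H1_def)

lemma H1_L2: "f \<in> H1 \<Longrightarrow> f \<in> L2"
  using wgrad has_weak_gradD(1) by blast

lemma wgrad_L2: "f \<in> H1 \<Longrightarrow> (\<lambda>x. wgrad f x $ j) \<in> L2"
  using wgrad has_weak_gradD(2) by blast

subsection \<open>Classical derivatives of periodic functions\<close>

text \<open>Differentiability is not assumed: both points have the same set of derivatives, so the
  choice inside \<open>frechet_derivative\<close> is the same even when that set is empty. This
  matters for V, which is differentiable only almost everywhere.\<close>

lemma frechet_derivative_periodic:
  assumes "periodic f" shows "frechet_derivative f (at (x + axis k 1)) = frechet_derivative f (at x)"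
proof -
  have "(f has_derivative D) (at (x + axis k 1)) \<longleftrightarrow> (f has_derivative D) (at x)" for D
  proof
    assume "(f has_derivative D) (at (x + axis k 1))"
    then have "((\<lambda>y. f (y + axis k 1)) has_derivative D) (at x)"
      by (rule has_derivative_compose[rotated]) (auto intro!: derivative_eq_intros)
    then show "(f has_derivative D) (at x)" using assms by (simp add: periodic_def)
  next
    assume "(f has_derivative D) (at x)"
    then have "(f has_derivative D) (at ((x + axis k 1) - axis k 1))" by simp
    then have "((\<lambda>y. f (y - axis k 1)) has_derivative D) (at (x + axis k 1))"
      by (rule has_derivative_compose[rotated]) (auto intro!: derivative_eq_intros)
    moreover have "f (y - axis k 1) = f y" for y
      using assms[unfolded periodic_def, rule_format, of "y - axis k 1" k] by simp
    ultimately show "(f has_derivative D) (at (x + axis k 1))" by simp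
  qed
  then show ?thesis by (simp add: frechet_derivative_def)
qed

lemma pd_periodic: "periodic f \<Longrightarrow> periodic (pd j f)"
  unfolding periodic_def[of "pd j f"] by (simp add: pd_def frechet_derivative_periodic)

lemma frechet_derivative_eq_grad:
  fixes f :: "real^'d \<Rightarrow> real"
  assumes "f differentiable (at x)"
  shows "frechet_derivative f (at x) h = grad f x \<bullet> h"
proof -
  interpret linear "frechet_derivative f (at x)" by (rule linear_frechet_derivative[OF assms])
  have "h = (\<Sum>j\<in>UNIV. h $ j *\<^sub>R axis j 1)" by (simp add: vec_eq_iff axis_def if_distrib cong: if_cong)
  then have "frechet_derivative f (at x) h = frechet_derivative f (at x) (\<Sum>j\<in>UNIV. h $ j *\<^sub>R axis j 1)"
    by simp
  also have "\<dots> = (\<Sum>j\<in>UNIV. h $ j * frechet_derivative f (at x) (axis j 1))"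
    by (simp add: sum scale)
  finally have "frechet_derivative f (at x) h = (\<Sum>j\<in>UNIV. h $ j * frechet_derivative f (at x) (axis j 1))" .
  then show ?thesis by (simp add: grad_def pd_def inner_vec_def mult.commute)
qed

lemma has_derivative_grad:
  assumes "f differentiable (at x)" shows "(f has_derivative (\<lambda>h. grad f x \<bullet> h)) (at x)"
proof -
  have "frechet_derivative f (at x) = (\<lambda>h. grad f x \<bullet> h)"
    using assms by (simp add: fun_eq_iff frechet_derivative_eq_grad)
  then show ?thesis using frechet_derivative_works[of f "at x"] assms by simp
qed

lemma has_derivative_pd:
  assumes "(f has_derivative (\<lambda>h. D \<bullet> h)) (at x)" shows "pd j f x = D $ j" "grad f x = D"
proof -
  have "pd j f x = D $ j" for j
    using frechet_derivative_at[OF assms, symmetric] by (simp add: pd_def inner_axis)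
  then show "pd j f x = D $ j" "grad f x = D" by (simp_all add: grad_def vec_eq_iff)
qed

lemma grad_bound_Lipschitz:
  fixes f :: "real^'d \<Rightarrow> real"
  assumes "\<And>x. f differentiable (at x)" "\<And>x. norm (grad f x) \<le> K"
  shows "\<bar>f x - f y\<bar> \<le> K * dist x y"
proof -
  have "norm (f x - f y) \<le> K * norm (x - y)"
  proof (rule differentiable_bound[OF convex_UNIV])
    show "(f has_derivative (\<lambda>h. grad f x \<bullet> h)) (at x within UNIV)" for x
      using has_derivative_grad[OF assms(1)] by simp
    show "onorm (\<lambda>h. grad f x \<bullet> h) \<le> K" for x
    proof (rule onorm_le)
      fix h
      have "norm (grad f x \<bullet> h) \<le> norm (grad f x) * norm h" by (simp add: Cauchy_Schwarz_ineq2)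
      also have "\<dots> \<le> K * norm h" by (intro mult_right_mono assms) auto
      finally show "norm (grad f x \<bullet> h) \<le> K * norm h" .
    qed
  qed auto
  then show ?thesis by (simp add: dist_norm)
qed

lemma Ck_SucD:
  fixes f :: "real^'d \<Rightarrow> real"
  assumes "Ck (Suc k) f" shows "f differentiable (at x)" "Ck k (pd j f)" "continuous_on S f"
proof -
  show d: "f differentiable (at x)" for x using assms by simp
  have "(axis j 1 :: real^'d) \<in> Basis" by (simp add: axis_in_Basis_iff)
  then show "Ck k (pd j f)" using assms by (simp add: pd_def[abs_def])
  show "continuous_on S f"
    by (intro continuous_at_imp_continuous_on ballI differentiable_imp_continuous_within d)
qed

lemma periodic_C1_Lipschitz:
  fixes f :: "real^'d \<Rightarrow> real"
  assumes "periodic f" "Ck (Suc 0) f"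
  shows "\<exists>K. (\<forall>x y. \<bar>f x - f y\<bar> \<le> K * dist x y) \<and> (\<forall>x j. \<bar>pd j f x\<bar> \<le> K)"
proof -
  have "\<exists>C. \<forall>x. \<bar>pd j f x\<bar> \<le> C" for j
    using periodic_bounded[OF pd_periodic[OF assms(1)]] Ck_SucD(2)[OF assms(2)] by (metis Ck.simps(1))
  then obtain C where C: "\<And>j x. \<bar>pd j f x\<bar> \<le> C j" by metis
  have C0: "0 \<le> C j" for j using C[of j 0] by linarith
  have "norm (grad f x) \<le> (\<Sum>j\<in>UNIV. C j)" for x
    by (rule order_trans[OF norm_le_l1_cart]) (auto simp: grad_def C intro: sum_mono)
  then have "\<bar>f x - f y\<bar> \<le> (\<Sum>j\<in>UNIV. C j) * dist x y" for x y
    by (intro grad_bound_Lipschitz Ck_SucD(1)[OF assms(2)])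
  moreover have "\<bar>pd j f x\<bar> \<le> (\<Sum>j\<in>UNIV. C j)" for x j
    using order_trans[OF C[of j x] member_le_sum[of j UNIV C]] C0 by auto
  ultimately show ?thesis by blast
qed

lemma has_derivative_imp_sequential:
  fixes f :: "real^'d \<Rightarrow> real"
  assumes "(f has_derivative (\<lambda>h. D \<bullet> h)) (at x)"
  shows "(\<lambda>n. (f (x + inverse (real (Suc n)) *\<^sub>R axis j 1) - f x) * real (Suc n)) \<longlonglongrightarrow> D $ j"
proof -
  have "(f has_derivative (\<lambda>h. D \<bullet> h)) (at (x + 0 *\<^sub>R axis j 1))" using assms by simp
  then have "((\<lambda>r. f (x + r *\<^sub>R axis j 1)) has_derivative (\<lambda>h. D \<bullet> (h *\<^sub>R axis j 1))) (at 0)"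
    by (rule has_derivative_compose[rotated]) (auto intro!: derivative_eq_intros)
  then have "((\<lambda>r. f (x + r *\<^sub>R axis j 1)) has_real_derivative D $ j) (at 0)"
  proof -
    assume a: "((\<lambda>r. f (x + r *\<^sub>R axis j 1)) has_derivative (\<lambda>h. D \<bullet> (h *\<^sub>R axis j 1))) (at 0)"
    have "(\<lambda>h. D \<bullet> (h *\<^sub>R axis j 1)) = (*) (D $ j)" by (simp add: fun_eq_iff inner_axis)
    then show ?thesis using a by (simp only: has_field_derivative_def)
  qed
  then have "((\<lambda>r. (f (x + r *\<^sub>R axis j 1) - f x) / r) \<longlongrightarrow> D $ j) (at 0)"
    by (simp add: has_field_derivative_iff)
  moreover have "filterlim (\<lambda>n. inverse (real (Suc n))) (at 0) sequentially"
    unfolding filterlim_at using LIMSEQ_inverse_real_of_nat by (auto intro: always_eventually)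
  ultimately have "(\<lambda>n. (f (x + inverse (real (Suc n)) *\<^sub>R axis j 1) - f x) / inverse (real (Suc n))) \<longlonglongrightarrow> D $ j"
    by (rule filterlim_compose)
  then show ?thesis by (simp add: divide_inverse)
qed

lemma smooth_periodic_L2:
  assumes "periodic \<phi>" "smooth \<phi>" shows "\<phi> \<in> L2" "pd j \<phi> \<in> L2"
proof -
  have "Ck (Suc 0) \<phi>" using assms(2) by (simp only: smooth_def)
  then show "\<phi> \<in> L2" "pd j \<phi> \<in> L2"
    using Ck_SucD[of 0 \<phi>] assms by (auto intro!: continuous_periodic_L2 pd_periodic simp del: Ck.simps(2))
qed

text \<open>For smooth \<phi> the product g \<phi> is a Lipschitz test function for f, and its
  derivative is known wherever g is differentiable; the rest is rearrangement.\<close>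

lemma has_weak_grad_mult:
  assumes G: "has_weak_grad f G" and per: "periodic g" and lip: "\<And>x y. \<bar>g x - g y\<bar> \<le> K * dist x y"
    and bd: "\<And>x. \<bar>g x\<bar> \<le> C"
    and dg: "\<And>j. (\<lambda>x. dg x $ j) \<in> borel_measurable lebesgue" "\<And>j. periodic (\<lambda>x. dg x $ j)"
      "\<And>j. AE x in lebesgue. \<bar>dg x $ j\<bar> \<le> B"
    and der: "AE x in lebesgue. (g has_derivative (\<lambda>h. dg x \<bullet> h)) (at x)"
  shows "has_weak_grad (\<lambda>x. g x * f x) (\<lambda>x. g x *\<^sub>R G x + f x *\<^sub>R dg x)"
proof -
  have f: "f \<in> L2" and GL: "\<And>j. (\<lambda>x. G x $ j) \<in> L2" using has_weak_gradD[OF G] by auto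
  have g: "g \<in> L2" by (intro continuous_periodic_L2 per Lipschitz_continuous[OF lip])
  have gm: "g \<in> borel_measurable lebesgue" using L2D(2)[OF g] .
  have gL: "(\<lambda>x. g x * u x) \<in> L2" if "u \<in> L2" for u
    by (rule L2_mult_bounded[OF that per gm, of C]) (simp add: bd)
  have dgL: "(\<lambda>x. dg x $ j * u x) \<in> L2" if "u \<in> L2" for u j
    by (rule L2_mult_bounded[OF that dg(2,1,3)])
  show ?thesis unfolding has_weak_grad_def
  proof (intro conjI allI impI)
    show "(\<lambda>x. g x * f x) \<in> L2" by (rule gL[OF f])
    show "(\<lambda>x. (g x *\<^sub>R G x + f x *\<^sub>R dg x) $ j) \<in> L2" for j
      using L2_add[OF gL[OF GL] dgL[OF f], of j j] by (simp add: mult.commute[of "f _"])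
    fix j and \<phi> :: "real^'a \<Rightarrow> real" assume \<phi>: "periodic \<phi> \<and> smooth \<phi>"
    note \<phi>L = smooth_periodic_L2[OF conjunct1[OF \<phi>] conjunct2[OF \<phi>]]
    have C1: "Ck (Suc 0) \<phi>" using \<phi> by (simp only: smooth_def)
    obtain M where M: "\<And>x y. \<bar>\<phi> x - \<phi> y\<bar> \<le> M * dist x y" "\<And>x j. \<bar>pd j \<phi> x\<bar> \<le> M"
      using periodic_C1_Lipschitz[OF conjunct1[OF \<phi>] C1] by blast
    obtain C' where C': "\<And>x. \<bar>\<phi> x\<bar> \<le> C'"
      using periodic_bounded[OF conjunct1[OF \<phi>] Ck_SucD(3)[OF C1]] by blast
    have "torus_integral (\<lambda>x. f x * (dg x $ j * \<phi> x + g x * pd j \<phi> x)) = - torus_integral (\<lambda>x. G x $ j * (g x * \<phi> x))"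
    proof (rule weak_grad_Lipschitz[OF G])
      show "periodic (\<lambda>x. g x * \<phi> x)" using per \<phi> by (simp add: periodic_def)
      show "\<bar>g x * \<phi> x - g y * \<phi> y\<bar> \<le> (C * M + K * C') * dist x y" for x y
      proof -
        have "g x * \<phi> x - g y * \<phi> y = g x * (\<phi> x - \<phi> y) + (g x - g y) * \<phi> y" by (simp add: algebra_simps)
        then have "\<bar>g x * \<phi> x - g y * \<phi> y\<bar> \<le> \<bar>g x\<bar> * \<bar>\<phi> x - \<phi> y\<bar> + \<bar>g x - g y\<bar> * \<bar>\<phi> y\<bar>"
          by (metis abs_mult abs_triangle_ineq)
        also have "\<dots> \<le> C * (M * dist x y) + (K * dist x y) * C'"
          using bd[of x] M(1)[of x y] lip[of x y] C'[of y] abs_ge_zero order_trans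
          by (intro add_mono mult_mono) (blast | simp)+
        finally show ?thesis by (simp add: algebra_simps)
      qed
      show "AE x in lebesgue. (\<lambda>n. (g (x + inverse (real (Suc n)) *\<^sub>R axis j 1) * \<phi> (x + inverse (real (Suc n)) *\<^sub>R axis j 1)
          - g x * \<phi> x) * real (Suc n)) \<longlonglongrightarrow> dg x $ j * \<phi> x + g x * pd j \<phi> x"
        using der
      proof eventually_elim
        case (elim x)
        have "((\<lambda>x. g x * \<phi> x) has_derivative (\<lambda>h. (\<phi> x *\<^sub>R dg x + g x *\<^sub>R grad \<phi> x) \<bullet> h)) (at x)"
          using has_derivative_mult[OF elim has_derivative_grad[OF Ck_SucD(1)[OF C1]]]
          by (simp add: inner_add_left algebra_simps)
        from has_derivative_imp_sequential[OF this, of j] show ?case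
          by (simp add: grad_def mult.commute)
      qed
      show "(\<lambda>x. dg x $ j * \<phi> x + g x * pd j \<phi> x) \<in> borel_measurable lebesgue"
        using dg(1) gm \<phi>L[THEN L2D(2)] by simp
    qed
    moreover have "torus_integral (\<lambda>x. f x * (dg x $ j * \<phi> x + g x * pd j \<phi> x))
        = torus_integral (\<lambda>x. (dg x $ j * f x) * \<phi> x) + torus_integral (\<lambda>x. (g x * f x) * pd j \<phi> x)"
    proof -
      have "f x * (dg x $ j * \<phi> x + g x * pd j \<phi> x) = (dg x $ j * f x) * \<phi> x + (g x * f x) * pd j \<phi> x" for x
        by (simp add: algebra_simps)
      then show ?thesis unfolding torus_integral_eq
        using L2_mult_integrable[OF dgL[OF f] \<phi>L(1)] L2_mult_integrable[OF gL[OF f] \<phi>L(2)] by simp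
    qed
    moreover have "torus_integral (\<lambda>x. (g x *\<^sub>R G x + f x *\<^sub>R dg x) $ j * \<phi> x)
        = torus_integral (\<lambda>x. G x $ j * (g x * \<phi> x)) + torus_integral (\<lambda>x. (dg x $ j * f x) * \<phi> x)"
    proof -
      have "(g x *\<^sub>R G x + f x *\<^sub>R dg x) $ j * \<phi> x = G x $ j * (g x * \<phi> x) + (dg x $ j * f x) * \<phi> x" for x
        by (simp add: algebra_simps)
      then show ?thesis unfolding torus_integral_eq
        using L2_mult_integrable[OF dgL[OF f] \<phi>L(1)] L2_mult_integrable[OF GL gL[OF \<phi>L(1)]] by simp
    qed
    ultimately show "torus_integral (\<lambda>x. g x * f x * pd j \<phi> x) = - torus_integral (\<lambda>x. (g x *\<^sub>R G x + f x *\<^sub>R dg x) $ j * \<phi> x)"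
      by linarith
  qed
qed

lemma has_weak_grad_add:
  assumes "has_weak_grad f F" "has_weak_grad g G"
  shows "has_weak_grad (\<lambda>x. f x + g x) (\<lambda>x. F x + G x)"
  unfolding has_weak_grad_def
proof (intro conjI allI impI)
  fix j and \<phi> :: "real^'a \<Rightarrow> real" assume \<phi>: "periodic \<phi> \<and> smooth \<phi>"
  note \<phi>L = smooth_periodic_L2[OF conjunct1[OF \<phi>] conjunct2[OF \<phi>]]
  show "torus_integral (\<lambda>x. (f x + g x) * pd j \<phi> x) = - torus_integral (\<lambda>x. (F x + G x) $ j * \<phi> x)"
    using has_weak_gradD[OF assms(1)] has_weak_gradD[OF assms(2)] \<phi>
    by (simp add: torus_integral_eq distrib_right L2_mult_integrable \<phi>L)
qed (use has_weak_gradD[OF assms(1)] has_weak_gradD[OF assms(2)] in \<open>auto intro: L2_add\<close>)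

lemma has_weak_grad_scale:
  assumes "has_weak_grad f F"
  shows "has_weak_grad (\<lambda>x. c * f x) (\<lambda>x. c *\<^sub>R F x)"
  unfolding has_weak_grad_def
  using has_weak_gradD[OF assms] by (auto intro: L2_scale simp: torus_integral_eq mult.assoc)

lemma has_weak_grad_cong:
  assumes "has_weak_grad f F" "g \<in> L2" "AE x in cell. f x = g x"
  shows "has_weak_grad g F"
  unfolding has_weak_grad_def
proof (intro conjI allI impI)
  fix j and \<phi> :: "real^'a \<Rightarrow> real" assume \<phi>: "periodic \<phi> \<and> smooth \<phi>"
  note \<phi>L = smooth_periodic_L2[OF conjunct1[OF \<phi>] conjunct2[OF \<phi>]]
  have "torus_integral (\<lambda>x. f x * pd j \<phi> x) = torus_integral (\<lambda>x. g x * pd j \<phi> x)"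
    by (rule torus_integral_mult_cong) (use assms \<phi>L has_weak_gradD(1)[OF assms(1)] in \<open>auto simp: l2_rel_def\<close>)
  then show "torus_integral (\<lambda>x. g x * pd j \<phi> x) = - torus_integral (\<lambda>x. F x $ j * \<phi> x)"
    using has_weak_gradD(3)[OF assms(1)] \<phi> by simp
qed (use has_weak_gradD[OF assms(1)] assms in auto)

text \<open>The defining identity pairs f and its gradient with fixed vectors, so both sides are
  continuous in norm.\<close>

lemma has_weak_grad_closed:
  assumes G: "\<And>n. has_weak_grad (f n) (G n)" and fL: "f' \<in> L2" and GL: "\<And>j. (\<lambda>x. G' x $ j) \<in> L2"
    and f: "(\<lambda>n. abs_l2 (f n)) \<longlonglongrightarrow> abs_l2 f'"
    and Gl: "\<And>j. (\<lambda>n. abs_l2 (\<lambda>x. G n x $ j)) \<longlonglongrightarrow> abs_l2 (\<lambda>x. G' x $ j)"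
  shows "has_weak_grad f' G'"
  unfolding has_weak_grad_def
proof (intro conjI allI impI fL GL)
  fix j and \<phi> :: "real^'a \<Rightarrow> real" assume \<phi>: "periodic \<phi> \<and> smooth \<phi>"
  note \<phi>L = smooth_periodic_L2[OF conjunct1[OF \<phi>] conjunct2[OF \<phi>]]
  have eq: "abs_l2 (f n) \<bullet> abs_l2 (pd j \<phi>) = - (abs_l2 (\<lambda>x. G n x $ j) \<bullet> abs_l2 \<phi>)" for n
    using has_weak_gradD[OF G] \<phi> by (simp add: inner_abs_l2 \<phi>L)
  have "(\<lambda>n. abs_l2 (f n) \<bullet> abs_l2 (pd j \<phi>)) \<longlonglongrightarrow> abs_l2 f' \<bullet> abs_l2 (pd j \<phi>)"
    by (intro tendsto_intros f)
  moreover have "(\<lambda>n. abs_l2 (f n) \<bullet> abs_l2 (pd j \<phi>)) \<longlonglongrightarrow> - (abs_l2 (\<lambda>x. G' x $ j) \<bullet> abs_l2 \<phi>)"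
    unfolding eq by (intro tendsto_intros Gl)
  ultimately have "abs_l2 f' \<bullet> abs_l2 (pd j \<phi>) = - (abs_l2 (\<lambda>x. G' x $ j) \<bullet> abs_l2 \<phi>)"
    by (rule LIMSEQ_unique)
  then show "torus_integral (\<lambda>x. f' x * pd j \<phi> x) = - torus_integral (\<lambda>x. G' x $ j * \<phi> x)"
    by (simp add: inner_abs_l2 fL GL \<phi>L)
qed

subsection \<open>Integration by parts on the torus\<close>

lemma continuous_torus_integral:
  assumes "continuous_on (cbox 0 One) f"
  shows "torus_integral f = integral (cbox 0 One) f"
  unfolding torus_integral_def
  by (intro set_lebesgue_integral_eq_integral absolutely_integrable_continuous assms)

text \<open>The shifted cell is cut at the hyperplane where coordinate j equals 1, and the part
  beyond it is moved back by one period.\<close>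

lemma torus_integral_shift:
  fixes f :: "real^'d \<Rightarrow> real"
  assumes per: "periodic f" and cont: "continuous_on UNIV f" and h: "0 \<le> h" "h \<le> 1"
  shows "torus_integral (\<lambda>x. f (x + h *\<^sub>R axis j 1)) = torus_integral f"
proof -
  let ?e = "axis j 1 :: real^'d"
  let ?c = "h *\<^sub>R ?e"
  have e: "?e \<in> Basis" by (simp add: axis_in_Basis_iff)
  have int: "f integrable_on cbox a b" for a b
    by (intro integrable_continuous continuous_on_subset[OF cont]) auto
  have all_split: "(\<forall>i. P i) \<longleftrightarrow> P j \<and> (\<forall>i. i \<noteq> j \<longrightarrow> P i)" for P by metis
  \<comment> \<open>Collects the conditions on all coordinates other than j, which are common to the
    four boxes.\<close>
  define R where "R x \<longleftrightarrow> (\<forall>i. i \<noteq> j \<longrightarrow> 0 \<le> x $ i \<and> x $ i \<le> 1)" for x :: "real^'d"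
  have b0: "x \<in> cbox 0 One \<longleftrightarrow> (0 \<le> x $ j \<and> x $ j \<le> 1) \<and> R x"
    and b1: "x \<in> cbox (0 + ?c) (One + ?c) \<longleftrightarrow> (h \<le> x $ j \<and> x $ j \<le> 1 + h) \<and> R x"
    and b2: "x \<in> cbox (0 + ?e) ((One - (1 - h) *\<^sub>R ?e) + ?e) \<longleftrightarrow> (1 \<le> x $ j \<and> x $ j \<le> 1 + h) \<and> R x"
    and b3: "x \<in> cbox 0 (One - (1 - h) *\<^sub>R ?e) \<longleftrightarrow> (0 \<le> x $ j \<and> x $ j \<le> h) \<and> R x" for x
    by (subst mem_box_cart, subst all_split, simp add: One_nth axis_def R_def add.commute del: sum_component)+
  have "continuous_on (cbox 0 One) (\<lambda>x. f (x + ?c))"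
    by (rule continuous_on_compose2[OF cont]) (auto intro: continuous_intros)
  then have "torus_integral (\<lambda>x. f (x + ?c)) = integral (cbox 0 One) (f \<circ> ((+) ?c))"
    by (simp add: continuous_torus_integral o_def add.commute)
  also have "\<dots> = integral (cbox (0 + ?c) (One + ?c)) f" by (rule integral_shift_cbox_plus)
  also have "\<dots> = integral (cbox (0 + ?c) (One + ?c) \<inter> {x. x \<bullet> ?e \<le> 1}) f + integral (cbox (0 + ?c) (One + ?c) \<inter> {x. x \<bullet> ?e \<ge> 1}) f"
    by (rule integral_split[OF int e])
  also have "cbox (0 + ?c) (One + ?c) \<inter> {x. x \<bullet> ?e \<le> 1} = cbox 0 One \<inter> {x. x \<bullet> ?e \<ge> h}"
    unfolding set_eq_iff Int_iff mem_Collect_eq b1 b0 using h by (auto simp: inner_axis)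
  also have "cbox (0 + ?c) (One + ?c) \<inter> {x. x \<bullet> ?e \<ge> 1} = cbox (0 + ?e) ((One - (1 - h) *\<^sub>R ?e) + ?e)"
    unfolding set_eq_iff Int_iff mem_Collect_eq b1 b2 using h by (auto simp: inner_axis)
  also have "integral (cbox (0 + ?e) ((One - (1 - h) *\<^sub>R ?e) + ?e)) f = integral (cbox 0 (One - (1 - h) *\<^sub>R ?e)) (f \<circ> ((+) ?e))"
    by (rule integral_shift_cbox_plus[symmetric])
  also have "f \<circ> ((+) ?e) = f" using per by (auto simp: periodic_def add.commute)
  also have "cbox 0 (One - (1 - h) *\<^sub>R ?e) = cbox 0 One \<inter> {x. x \<bullet> ?e \<le> h}"
    unfolding set_eq_iff Int_iff mem_Collect_eq b3 b0 using h by (auto simp: inner_axis)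
  also have "integral (cbox 0 One \<inter> {x. x \<bullet> ?e \<ge> h}) f + integral (cbox 0 One \<inter> {x. x \<bullet> ?e \<le> h}) f = integral (cbox 0 One) f"
    using integral_split[OF int e, of 0 One h] by simp
  also have "\<dots> = torus_integral f"
    by (intro continuous_torus_integral[symmetric] continuous_on_subset[OF cont]) auto
  finally show ?thesis .
qed

text \<open>By translation invariance the difference quotients have integral 0, and they converge
  boundedly.\<close>

lemma torus_integral_pd:
  fixes f :: "real^'d \<Rightarrow> real"
  assumes per: "periodic f" and C1: "Ck (Suc 0) f"
  shows "torus_integral (pd j f) = 0"
proof -
  let ?r = "\<lambda>n. inverse (real (Suc n))"
  let ?e = "axis j 1 :: real^'d"
  have cont: "continuous_on UNIV f" by (rule Ck_SucD(3)[OF C1])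
  obtain K where K: "\<And>x y. \<bar>f x - f y\<bar> \<le> K * dist x y" "\<And>x j. \<bar>pd j f x\<bar> \<le> K"
    using periodic_C1_Lipschitz[OF per C1] by blast
  have fL: "f \<in> L2" by (rule continuous_periodic_L2[OF per cont])
  have pL: "pd j f \<in> L2"
    using Ck_SucD(2)[OF C1, of j] by (intro continuous_periodic_L2 pd_periodic per) simp
  have cs: "continuous_on UNIV (\<lambda>x. f (x + c))" for c
    by (rule continuous_on_compose2[OF cont]) (auto intro: continuous_intros)
  have sL: "(\<lambda>x. f (x + c)) \<in> L2" for c by (intro continuous_periodic_L2 periodic_shift per cs)
  have one: "integrable cell u" if "u \<in> L2" for u :: "real^'d \<Rightarrow> real"
    using L2_mult_integrable[OF that L2_bounded[of "\<lambda>_. 1" 1]] by (auto simp: periodic_def)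
  have "(\<lambda>n. integral\<^sup>L cell (\<lambda>x. (f (x + ?r n *\<^sub>R ?e) - f x) * real (Suc n))) \<longlonglongrightarrow> integral\<^sup>L cell (pd j f)"
  proof (rule integral_dominated_convergence[where w = "\<lambda>_. K"])
    show "AE x in cell. (\<lambda>n. (f (x + ?r n *\<^sub>R ?e) - f x) * real (Suc n)) \<longlonglongrightarrow> pd j f x"
      using has_derivative_imp_sequential[OF has_derivative_grad[OF Ck_SucD(1)[OF C1]], where j = j]
      by (intro AE_I2) (simp add: grad_def)
    show "AE x in cell. norm ((f (x + ?r n *\<^sub>R ?e) - f x) * real (Suc n)) \<le> K" for n
    proof (rule AE_I2)
      fix x
      have "\<bar>f (x + ?r n *\<^sub>R ?e) - f x\<bar> \<le> K * ?r n" using K(1)[of "x + ?r n *\<^sub>R ?e" x] by (simp add: dist_norm norm_axis_1)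
      then have "\<bar>f (x + ?r n *\<^sub>R ?e) - f x\<bar> * real (Suc n) \<le> K" by (simp add: field_simps)
      then show "norm ((f (x + ?r n *\<^sub>R ?e) - f x) * real (Suc n)) \<le> K" by (simp add: abs_mult)
    qed
  qed (use L2D(3)[OF fL] L2D(3)[OF pL] L2D(3)[OF sL] in auto)
  moreover have "integral\<^sup>L cell (\<lambda>x. (f (x + ?r n *\<^sub>R ?e) - f x) * real (Suc n)) = 0" for n
    using torus_integral_shift[OF per cont, of "?r n" j] one[OF fL] one[OF sL, of "?r n *\<^sub>R ?e"]
    by (simp add: torus_integral_eq inverse_le_1_iff del: of_nat_Suc)
  ultimately show ?thesis by (simp add: torus_integral_eq LIMSEQ_const_iff)
qed

subsection \<open>The effective diffusion matrix\<close>

lemma C1_iff: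
  fixes f :: "real^'d \<Rightarrow> real"
  shows "Ck (Suc 0) f \<longleftrightarrow> (\<forall>x. f differentiable (at x)) \<and> (\<forall>j. continuous_on UNIV (pd j f))"
  by (auto simp: Basis_vec_def pd_def[abs_def])

lemma pd_add:
  assumes "f differentiable (at x)" "g differentiable (at x)"
  shows "pd j (\<lambda>x. f x + g x) x = pd j f x + pd j g x"
  using has_derivative_pd(1)[of "\<lambda>x. f x + g x" "grad f x + grad g x" x j]
    has_derivative_add[OF has_derivative_grad[OF assms(1)] has_derivative_grad[OF assms(2)]]
  by (simp add: inner_add_left grad_def)

lemma pd_mult:
  assumes "f differentiable (at x)" "g differentiable (at x)"
  shows "pd j (\<lambda>x. f x * g x) x = f x * pd j g x + pd j f x * g x"
  using has_derivative_pd(1)[of "\<lambda>x. f x * g x" "f x *\<^sub>R grad g x + g x *\<^sub>R grad f x" x j]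
    has_derivative_mult[OF has_derivative_grad[OF assms(1)] has_derivative_grad[OF assms(2)]]
  by (simp add: inner_add_left grad_def mult.commute)

lemma pd_const: "pd j (\<lambda>x. c) x = 0"
  using has_derivative_pd(1)[of "\<lambda>x. c" 0 x j] by simp

lemma pd_sum:
  assumes "\<And>i. i \<in> I \<Longrightarrow> f i differentiable (at x)"
  shows "pd j (\<lambda>x. \<Sum>i\<in>I. f i x) x = (\<Sum>i\<in>I. pd j (f i) x)"
  using assms
  by (induction I rule: infinite_finite_induct) (auto simp: pd_const pd_add)

lemma C1_add:
  fixes f g :: "real^'d \<Rightarrow> real"
  assumes "Ck (Suc 0) f" "Ck (Suc 0) g" shows "Ck (Suc 0) (\<lambda>x. f x + g x)"
proof -
  have d: "f differentiable (at x)" "g differentiable (at x)" for x using assms by (auto simp: C1_iff)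
  then have "pd j (\<lambda>x. f x + g x) = (\<lambda>x. pd j f x + pd j g x)" for j
    by (auto simp: pd_add)
  then show ?thesis
    using assms d unfolding C1_iff by (auto intro!: continuous_intros differentiable_add)
qed

lemma C1_mult:
  fixes f g :: "real^'d \<Rightarrow> real"
  assumes "Ck (Suc 0) f" "Ck (Suc 0) g" shows "Ck (Suc 0) (\<lambda>x. f x * g x)"
proof -
  have d: "f differentiable (at x)" "g differentiable (at x)" for x using assms by (auto simp: C1_iff)
  then have "pd j (\<lambda>x. f x * g x) = (\<lambda>x. f x * pd j g x + pd j f x * g x)" for j
    by (auto simp: pd_mult)
  then show ?thesis
    using assms d Ck_SucD(3)[OF assms(1)] Ck_SucD(3)[OF assms(2)] unfolding C1_iff
    by (auto intro!: continuous_intros differentiable_mult)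
qed

lemma C1_sum: "(\<And>i. i \<in> I \<Longrightarrow> Ck (Suc 0) (f i)) \<Longrightarrow> Ck (Suc 0) (\<lambda>x::real^'d. \<Sum>i\<in>I. f i x)"
proof (induction I rule: infinite_finite_induct)
  case (insert i I)
  then show ?case using C1_add[of "f i" "\<lambda>x. \<Sum>i\<in>I. f i x"] by (simp del: Ck.simps)
qed (auto simp: C1_iff pd_const[abs_def] simp del: Ck.simps)

lemma C2_imp_C1:
  fixes f :: "real^'d \<Rightarrow> real"
  assumes "Ck 2 f" shows "Ck (Suc 0) f" "Ck (Suc 0) (pd j f)"
proof -
  have f: "Ck (Suc (Suc 0)) f" using assms by (simp only: numeral_2_eq_2)
  show p: "Ck (Suc 0) (pd j f)" for j by (rule Ck_SucD(2)[OF f])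
  show "Ck (Suc 0) f" unfolding C1_iff
    using Ck_SucD(1)[OF f] Ck_SucD(3)[OF p] by blast
qed

lemma continuous_integrable_cell: "continuous_on UNIV f \<Longrightarrow> integrable cell (f :: real^'d \<Rightarrow> real)"
  using absolutely_integrable_continuous[of 0 One f] continuous_on_subset[of UNIV f]
  unfolding set_integrable_def by (subst integrable_restrict_space) auto

lemma sum_matrix_vector: "\<xi> \<bullet> (M *v \<eta>) = (\<Sum>j\<in>UNIV. \<Sum>k\<in>UNIV. \<xi> $ j * M $ j $ k * \<eta> $ k)"
  by (simp add: inner_vec_def matrix_vector_mult_def sum_distrib_left mult.assoc)

text \<open>By the corrector equation \<open>As j k = \<integral> (e\<^sub>j + \<nabla>\<chi>\<^sub>j) \<cdot> A (e\<^sub>k + \<nabla>\<chi>\<^sub>k)\<close>, and the gradients \<open>\<nabla>\<chi>\<^sub>k\<close> have mean zero.\<close>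

lemma effective_matrix_elliptic:
  fixes A :: "real^'d \<Rightarrow> real^'d^'d" and X :: "real^'d \<Rightarrow> real^'d"
  assumes per: "periodic A" and C2: "\<And>j k. Ck 2 (\<lambda>x. A x $ j $ k)"
    and sym: "\<And>x. transpose (A x) = A x"
    and ell: "\<And>x \<xi>. c * (\<xi> \<bullet> \<xi>) \<le> \<xi> \<bullet> (A x *v \<xi>)" and c: "c \<ge> 0"
    and X: "corrector A X"
  shows "effective_matrix A X $ j $ k = effective_matrix A X $ k $ j"
    and "c * (\<xi> \<bullet> \<xi>) \<le> \<xi> \<bullet> (effective_matrix A X *v \<xi>)"
proof -
  define As where "As = effective_matrix A X"
  define \<kappa> where "\<kappa> k x = X x $ k" for k x
  have \<kappa>per: "periodic (\<kappa> k)" for k using X by (simp add: corrector_def periodic_def \<kappa>_def)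
  have \<kappa>2: "Ck 2 (\<kappa> k)" for k using X by (simp only: corrector_def \<kappa>_def[abs_def])
  note \<kappa>1 = C2_imp_C1[OF \<kappa>2]
  have Aper: "periodic (\<lambda>x. A x $ j $ l)" for j l using per by (simp add: periodic_def)
  note A1 = C2_imp_C1(1)[OF C2]
  have cA: "continuous_on UNIV (\<lambda>x. A x $ j $ l)" for j l by (rule Ck_SucD(3)[OF A1])
  have c\<kappa>: "continuous_on UNIV (pd l (\<kappa> k))" for l k by (rule Ck_SucD(3)[OF \<kappa>1(2)])
  \<comment> \<open>Component j of the flux A (e_k + \<nabla>\<chi>_k). The corrector equation says
    that it is free of divergence.\<close>
  define F where "F k j x = A x $ j $ k + (\<Sum>l\<in>UNIV. A x $ j $ l * pd l (\<kappa> k) x)" for k j x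
  have F1: "Ck (Suc 0) (F k j)" for k j
    unfolding F_def by (intro C1_add C1_sum C1_mult A1 \<kappa>1)
  have Fper: "periodic (F k j)" for k j
    using Aper pd_periodic[OF \<kappa>per] unfolding F_def periodic_def by simp
  have div: "(\<Sum>j\<in>UNIV. pd j (F k j) x) = 0" for k x
  proof -
    have "pd j (F k j) x = pd j (\<lambda>x. A x $ j $ k) x + (\<Sum>l\<in>UNIV. pd j (\<lambda>x. A x $ j $ l * pd l (\<kappa> k) x) x)" for j
    proof -
      have d: "(\<lambda>x. A x $ j $ l * pd l (\<kappa> k) x) differentiable (at x)" for l
        by (rule Ck_SucD(1)[OF C1_mult[OF A1 \<kappa>1(2)]])
      have d': "(\<lambda>x. \<Sum>l\<in>UNIV. A x $ j $ l * pd l (\<kappa> k) x) differentiable (at x)"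
        by (rule Ck_SucD(1)[OF C1_sum]) (intro C1_mult A1 \<kappa>1)
      show ?thesis unfolding F_def by (simp add: pd_add[OF Ck_SucD(1)[OF A1] d'] pd_sum[OF d])
    qed
    then have "(\<Sum>j\<in>UNIV. pd j (F k j) x) = (\<Sum>j\<in>UNIV. pd j (\<lambda>x. A x $ j $ k) x)
        + (\<Sum>j\<in>UNIV. \<Sum>l\<in>UNIV. pd j (\<lambda>x. A x $ j $ l * pd l (\<kappa> k) x) x)"
      by (simp add: sum.distrib)
    moreover have "- (\<Sum>j\<in>UNIV. \<Sum>l\<in>UNIV. pd j (\<lambda>x. A x $ j $ l * pd l (\<kappa> k) x) x) = (\<Sum>j\<in>UNIV. pd j (\<lambda>x. A x $ j $ k) x)"
      using X by (simp only: corrector_def \<kappa>_def[abs_def])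
    ultimately show ?thesis by simp
  qed
  \<comment> \<open>Integration by parts: the flux is orthogonal to every gradient
    \<nabla>\<chi>_m.\<close>
  have orth: "torus_integral (\<lambda>x. \<Sum>j\<in>UNIV. pd j (\<kappa> m) x * F k j x) = 0" for m k
  proof -
    have int: "integrable cell (pd j (\<lambda>x. \<kappa> m x * F k j x))" for j
      using C1_mult[OF \<kappa>1(1) F1] by (intro continuous_integrable_cell) (auto simp: C1_iff simp del: Ck.simps)
    have "(\<Sum>j\<in>UNIV. pd j (\<kappa> m) x * F k j x) = (\<Sum>j\<in>UNIV. pd j (\<lambda>x. \<kappa> m x * F k j x) x)" for x
    proof -
      have "(\<Sum>j\<in>UNIV. pd j (\<lambda>x. \<kappa> m x * F k j x) x) = (\<Sum>j\<in>UNIV. \<kappa> m x * pd j (F k j) x + pd j (\<kappa> m) x * F k j x)"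
        by (intro sum.cong refl pd_mult Ck_SucD(1)[OF F1] Ck_SucD(1)[OF \<kappa>1(1)])
      also have "\<dots> = \<kappa> m x * (\<Sum>j\<in>UNIV. pd j (F k j) x) + (\<Sum>j\<in>UNIV. pd j (\<kappa> m) x * F k j x)"
        by (simp add: sum.distrib sum_distrib_left)
      finally show ?thesis by (simp add: div)
    qed
    then have "torus_integral (\<lambda>x. \<Sum>j\<in>UNIV. pd j (\<kappa> m) x * F k j x) = (\<Sum>j\<in>UNIV. torus_integral (pd j (\<lambda>x. \<kappa> m x * F k j x)))"
      using int by (simp add: torus_integral_eq)
    also have "\<dots> = 0"
    proof (intro sum.neutral ballI torus_integral_pd)
      show "periodic (\<lambda>x. \<kappa> m x * F k j x)" for j using \<kappa>per Fper by (simp add: periodic_def)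
    qed (rule C1_mult[OF \<kappa>1(1) F1])
    finally show ?thesis .
  qed
  define g where "g k x = axis k 1 + grad (\<kappa> k) x" for k x
  have cg: "continuous_on UNIV (\<lambda>x. g k x $ j)" for k j
    unfolding g_def by (auto simp: grad_def intro!: continuous_intros c\<kappa>)
  have Fg: "F k j x = (A x *v g k x) $ j" for k j x
    by (simp add: F_def g_def matrix_vector_right_distrib matrix_vector_mult_basis column_def)
      (simp add: matrix_vector_mult_def grad_def)
  have Ag: "g m x \<bullet> (A x *v g k x) = F k m x + (\<Sum>j\<in>UNIV. pd j (\<kappa> m) x * F k j x)" for m k x
  proof -
    have "g m x \<bullet> (A x *v g k x) = axis m 1 \<bullet> (A x *v g k x) + grad (\<kappa> m) x \<bullet> (A x *v g k x)"
      by (simp add: g_def[of m] inner_add_left)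
    moreover have "grad (\<kappa> m) x \<bullet> v = (\<Sum>j\<in>UNIV. pd j (\<kappa> m) x * v $ j)" for v
      by (simp add: inner_vec_def grad_def)
    ultimately show ?thesis by (simp add: inner_axis' Fg)
  qed
  have Asg: "As $ m $ k = torus_integral (\<lambda>x. g m x \<bullet> (A x *v g k x))" for m k
  proof -
    have i1: "integrable cell (F k m)" by (intro continuous_integrable_cell Ck_SucD(3)[OF F1])
    have i2: "integrable cell (\<lambda>x. \<Sum>j\<in>UNIV. pd j (\<kappa> m) x * F k j x)"
      by (intro continuous_integrable_cell continuous_intros c\<kappa> Ck_SucD(3)[OF F1])
    have "As $ m $ k = torus_integral (F k m)"
      by (simp add: As_def effective_matrix_def F_def[abs_def] \<kappa>_def[abs_def])
    then show ?thesis using orth[of m k] i1 i2 by (simp add: Ag torus_integral_eq)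
  qed
  have symA: "u \<bullet> (A x *v w) = w \<bullet> (A x *v u)" for u w x
    using sym[of x] by (metis dot_lmul_matrix inner_commute transpose_matrix_vector)
  show "effective_matrix A X $ j $ k = effective_matrix A X $ k $ j"
    using Asg[of j k] Asg[of k j] symA by (simp add: As_def)
  \<comment> \<open>The constant \<xi> plus a combination of the \<nabla>\<chi>_k. Its mean is
    \<xi>, so Jensen's inequality bounds the mean of its square from below by \<xi> \<bullet>
    \<xi>.\<close>
  define w where "w x = (\<Sum>k\<in>UNIV. \<xi> $ k *\<^sub>R g k x)" for x
  have cw: "continuous_on UNIV (\<lambda>x. w x $ j)" for j
    unfolding w_def by (simp, intro continuous_intros cg)
  have "\<xi> \<bullet> (As *v \<xi>) = torus_integral (\<lambda>x. w x \<bullet> (A x *v w x))"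
  proof -
    have ci: "integrable cell (\<lambda>x. g m x \<bullet> (A x *v g k x))" for m k
      unfolding sum_matrix_vector by (intro continuous_integrable_cell continuous_intros cg cA)
    have "w x \<bullet> (A x *v w x) = (\<Sum>m\<in>UNIV. \<Sum>k\<in>UNIV. \<xi> $ m * (g m x \<bullet> (A x *v g k x)) * \<xi> $ k)" for x
      unfolding w_def
      by (simp add: inner_sum_left inner_sum_right matrix_vector_mult_scaleR linear_sum[OF matrix_vector_mul_linear]
          sum_distrib_left mult_ac) (subst sum.swap, simp add: mult.left_commute)
    then show ?thesis
      unfolding sum_matrix_vector[of \<xi> As] Asg using ci by (simp add: torus_integral_eq)
  qed
  moreover have "torus_integral (\<lambda>x. c * (w x \<bullet> w x)) \<le> torus_integral (\<lambda>x. w x \<bullet> (A x *v w x))"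
    unfolding torus_integral_eq
  proof (rule integral_mono)
    show "integrable cell (\<lambda>x. c * (w x \<bullet> w x))" "integrable cell (\<lambda>x. w x \<bullet> (A x *v w x))"
      unfolding sum_matrix_vector inner_vec_def[of "w _" "w _"] inner_real_def
      by (intro continuous_integrable_cell continuous_on_sum continuous_on_mult continuous_on_const cw cA)+
  qed (rule ell)
  moreover have "\<xi> \<bullet> \<xi> \<le> torus_integral (\<lambda>x. w x \<bullet> w x)"
  proof -
    have wi: "integrable cell (\<lambda>x. w x $ j)" for j by (intro continuous_integrable_cell cw)
    have wi2: "integrable cell (\<lambda>x. w x $ j * w x $ j)" for j by (intro continuous_integrable_cell continuous_intros cw)
    have wj: "integral\<^sup>L cell (\<lambda>x. w x $ j) = \<xi> $ j" for j
    proof -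
      have "w x $ j = \<xi> $ j + (\<Sum>k\<in>UNIV. \<xi> $ k * pd j (\<kappa> k) x)" for x
        by (simp add: w_def g_def grad_def distrib_left sum.distrib) (simp add: axis_def if_distrib cong: if_cong)
      moreover have "integrable cell (pd j (\<kappa> k))" for k by (intro continuous_integrable_cell c\<kappa>)
      ultimately show ?thesis
        using torus_integral_pd[OF \<kappa>per \<kappa>1(1), of j] measure_cell[where 'd = 'd] by (simp add: torus_integral_eq)
    qed
    have "(\<xi> $ j)\<^sup>2 \<le> integral\<^sup>L cell (\<lambda>x. w x $ j * w x $ j)" for j
    proof -
      have "0 \<le> integral\<^sup>L cell (\<lambda>x. (w x $ j - \<xi> $ j)\<^sup>2)" by simp
      also have "(\<lambda>x. (w x $ j - \<xi> $ j)\<^sup>2) = (\<lambda>x. w x $ j * w x $ j - 2 * \<xi> $ j * w x $ j + (\<xi> $ j)\<^sup>2)"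
        by (simp add: power2_eq_square algebra_simps)
      also have "integral\<^sup>L cell \<dots> = integral\<^sup>L cell (\<lambda>x. w x $ j * w x $ j) - 2 * \<xi> $ j * \<xi> $ j + (\<xi> $ j)\<^sup>2"
        using wi wi2 wj[of j] measure_cell[where 'd = 'd] by simp
      finally show ?thesis by (simp add: power2_eq_square)
    qed
    then have "(\<Sum>j\<in>UNIV. (\<xi> $ j)\<^sup>2) \<le> (\<Sum>j\<in>UNIV. integral\<^sup>L cell (\<lambda>x. w x $ j * w x $ j))" by (rule sum_mono)
    then show ?thesis using wi2 by (simp add: inner_vec_def torus_integral_eq power2_eq_square)
  qed
  then have "c * (\<xi> \<bullet> \<xi>) \<le> torus_integral (\<lambda>x. c * (w x \<bullet> w x))"
    using c by (simp add: torus_integral_eq mult_left_mono)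
  ultimately show "c * (\<xi> \<bullet> \<xi>) \<le> \<xi> \<bullet> (effective_matrix A X *v \<xi>)"
    unfolding As_def by linarith
qed

subsection \<open>Smooth functions of one variable\<close>

lemma eventually_nhds_openI: "open S \<Longrightarrow> x \<in> S \<Longrightarrow> (\<And>y. y \<in> S \<Longrightarrow> P y) \<Longrightarrow> \<forall>\<^sub>F y in nhds x. P y"
  by (auto simp: eventually_nhds)

text \<open>The power of 1 / x makes the family stable under differentiation up to linear
  combinations, so that one computation covers derivatives of all orders.\<close>

definition flat :: "nat \<Rightarrow> real \<Rightarrow> real" where
  "flat k x = (if x > 0 then (1 / x) ^ k * exp (- 1 / x) else 0)"

lemma flat_has_derivative: "(flat k has_real_derivative (flat (k + 2) x - real k * flat (k + 1) x)) (at x)"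
proof -
  consider "x > 0" | "x < 0" | "x = 0" by linarith
  then show ?thesis
  proof cases
    case 1
    have ev: "\<forall>\<^sub>F y in nhds x. flat k y = (1 / y) ^ k * exp (- 1 / y)"
      by (rule eventually_nhds_openI[of "{0<..}"]) (use 1 in \<open>auto simp: flat_def\<close>)
    define z where "z = 1 / x"
    have d: "((\<lambda>y. 1 / y) has_real_derivative - (z * z)) (at x)"
      using 1 by (auto intro!: derivative_eq_intros simp: z_def power2_eq_square)
    have p: "((\<lambda>y. (1 / y) ^ k) has_real_derivative real k * (- (z * z) * z ^ (k - Suc 0))) (at x)"
      using DERIV_power[OF d, of k] by (simp add: z_def)
    have "((\<lambda>y. exp (- 1 / y)) has_real_derivative exp (- z) * (z * z)) (at x)"
      using DERIV_chain2[OF DERIV_exp DERIV_minus[OF d]] by (simp add: z_def)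
    from DERIV_mult[OF p this]
    have "((\<lambda>y. (1 / y) ^ k * exp (- 1 / y)) has_real_derivative
        real k * (- (z * z) * z ^ (k - Suc 0)) * exp (- z) + exp (- z) * (z * z) * z ^ k) (at x)"
      by (simp add: z_def)
    moreover have "real k * (- (z * z) * z ^ (k - Suc 0)) * exp (- z) + exp (- z) * (z * z) * z ^ k
        = flat (k + 2) x - real k * flat (k + 1) x"
      using 1 by (cases k) (auto simp: flat_def z_def[symmetric] algebra_simps simp flip: minus_divide_left)
    ultimately have "((\<lambda>y. (1 / y) ^ k * exp (- 1 / y)) has_real_derivative (flat (k + 2) x - real k * flat (k + 1) x)) (at x)"
      by simp
    then show ?thesis using DERIV_cong_ev[OF refl ev refl] by blast
  next
    case 2
    have ev: "\<forall>\<^sub>F y in nhds x. flat k y = 0"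
      by (rule eventually_nhds_openI[of "{..<0}"]) (use 2 in \<open>auto simp: flat_def\<close>)
    have "((\<lambda>y. 0) has_real_derivative (flat (k + 2) x - real k * flat (k + 1) x)) (at x)"
      using 2 by (simp add: flat_def)
    then show ?thesis using DERIV_cong_ev[OF refl ev refl] by blast
  next
    case 3
    \<comment> \<open>At 0 from the right the difference quotient becomes, under y = 1 / x, a power
      divided by an exponential at infinity.\<close>
    have "((\<lambda>y::real. y ^ (k + 1) / exp y) \<longlongrightarrow> 0) at_top" by (rule tendsto_power_div_exp_0)
    then have "((\<lambda>y::real. inverse y ^ (k + 1) / exp (inverse y)) \<longlongrightarrow> 0) (at_right 0)"
      by (rule filterlim_compose[where g = "\<lambda>y. y ^ (k + 1) / exp y", OF _ filterlim_inverse_at_top_right])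
    moreover have "\<forall>\<^sub>F y in at_right 0. inverse y ^ (k + 1) / exp (inverse y) = (flat k y - flat k 0) / (y - 0)"
      by (auto simp: eventually_at_filter flat_def exp_minus divide_inverse mult_ac intro!: always_eventually)
    ultimately have r: "((\<lambda>y. (flat k y - flat k 0) / (y - 0)) \<longlongrightarrow> 0) (at_right 0)"
      by (rule Lim_transform_eventually)
    have "\<forall>\<^sub>F y in at_left 0. 0 = (flat k y - flat k 0) / (y - 0)"
      by (auto simp: eventually_at_filter flat_def intro!: always_eventually)
    then have l: "((\<lambda>y. (flat k y - flat k 0) / (y - 0)) \<longlongrightarrow> 0) (at_left 0)"
      by (rule Lim_transform_eventually[OF tendsto_const])
    have "((\<lambda>y. (flat k y - flat k 0) / (y - 0)) \<longlongrightarrow> 0) (at 0)"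
      using l r by (simp add: filterlim_split_at_real)
    then show ?thesis using 3 by (simp add: has_field_derivative_iff flat_def)
  qed
qed

text \<open>An algebra closed under differentiation and affine substitution, so smoothness follows
  by induction on the order.\<close>

inductive flatalg :: "(real \<Rightarrow> real) \<Rightarrow> bool" where
  const: "flatalg (\<lambda>x. c)"
| flat: "flatalg (\<lambda>x. flat k (a * x + b))"
| add: "flatalg f \<Longrightarrow> flatalg g \<Longrightarrow> flatalg (\<lambda>x. f x + g x)"
| mult: "flatalg f \<Longrightarrow> flatalg g \<Longrightarrow> flatalg (\<lambda>x. f x * g x)"

lemma flatalg_affine: "flatalg f \<Longrightarrow> flatalg (\<lambda>x. f (a * x + b))"
proof (induction rule: flatalg.induct)
  case (flat k a' b')
  have "flatalg (\<lambda>x. flat k ((a' * a) * x + (a' * b + b')))" by (rule flatalg.flat)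
  then show ?case by (simp add: algebra_simps)
qed (auto intro: flatalg.intros)

lemma flatalg_has_derivative:
  "flatalg f \<Longrightarrow> \<exists>f'. flatalg f' \<and> (\<forall>x. (f has_real_derivative f' x) (at x))"
proof (induction rule: flatalg.induct)
  case (const c)
  show ?case by (intro exI[of _ "\<lambda>x. 0"]) (auto intro: flatalg.const)
next
  case (flat k a b)
  let ?f' = "\<lambda>x. a * (flat (k + 2) (a * x + b) + (- real k) * flat (k + 1) (a * x + b))"
  have "((\<lambda>x. flat k (a * x + b)) has_real_derivative ?f' x) (at x)" for x
  proof -
    have "((\<lambda>x. flat k (a * x + b)) has_real_derivative
        (flat (k + 2) (a * x + b) - real k * flat (k + 1) (a * x + b)) * a) (at x)"
      by (rule DERIV_chain2[where f = "flat k", OF flat_has_derivative]) (auto intro!: derivative_eq_intros)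
    then show ?thesis by (simp add: mult.commute)
  qed
  moreover have "flatalg ?f'" by (intro flatalg.intros)
  ultimately show ?case by blast
next
  case (add f g)
  then obtain f' g' where "flatalg f'" "\<And>x. (f has_real_derivative f' x) (at x)"
    "flatalg g'" "\<And>x. (g has_real_derivative g' x) (at x)" by blast
  then show ?case by (intro exI[of _ "\<lambda>x. f' x + g' x"]) (auto intro: flatalg.add DERIV_add)
next
  case (mult f g)
  then obtain f' g' where *: "flatalg f'" "\<And>x. (f has_real_derivative f' x) (at x)"
    "flatalg g'" "\<And>x. (g has_real_derivative g' x) (at x)" by blast
  have "((\<lambda>x. f x * g x) has_real_derivative (f' x * g x + f x * g' x)) (at x)" for x
    using DERIV_mult[OF *(2)[of x] *(4)[of x]] by (simp add: mult.commute add.commute)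
  then show ?case using mult.hyps *
    by (intro exI[of _ "\<lambda>x. f' x * g x + f x * g' x"]) (auto intro: flatalg.add flatalg.mult)
qed

lemma Ck_real:
  fixes f :: "real \<Rightarrow> real"
  assumes "\<And>x. (f has_real_derivative f' x) (at x)" "Ck k f'"
  shows "Ck (Suc k) f"
proof -
  have "frechet_derivative f (at x) 1 = f' x" for x
    using frechet_derivative_at[OF assms(1)[of x, unfolded has_field_derivative_def], symmetric] by simp
  moreover have "f differentiable (at x)" for x
    using assms(1)[of x] by (auto simp: has_field_derivative_def differentiable_def)
  ultimately show ?thesis using assms(2) by simp
qed

lemma flatalg_Ck: "flatalg f \<Longrightarrow> Ck k f"
proof (induction k arbitrary: f)
  case 0
  obtain f' where "\<And>x. (f has_real_derivative f' x) (at x)" using flatalg_has_derivative[OF 0] by blast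
  then show ?case by (auto intro!: continuous_at_imp_continuous_on DERIV_isCont)
next
  case (Suc k)
  obtain f' where "flatalg f'" "\<And>x. (f has_real_derivative f' x) (at x)" using flatalg_has_derivative[OF Suc.prems] by blast
  then show ?case using Ck_real Suc.IH by blast
qed

text \<open>Serves the cutoffs built from \<theta>, which are given as primitives of functions in
  \<open>flatalg\<close>.\<close>

lemma smooth_primitive:
  fixes f :: "real \<Rightarrow> real"
  assumes "\<And>x. (f has_real_derivative f' x) (at x)" "flatalg f'"
  shows "smooth f"
proof -
  have c: "continuous_on UNIV f" using assms(1) by (auto intro!: continuous_at_imp_continuous_on DERIV_isCont)
  have "Ck k f" for k
    by (cases k) (use c Ck_real[OF assms(1) flatalg_Ck[OF assms(2)]] in \<open>auto simp del: Ck.simps(2)\<close>)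
  then show ?thesis by (simp add: smooth_def)
qed

text \<open>\<theta> is the normalised primitive of a bump supported in [0, 1].\<close>

lemma smooth_step:
  "\<exists>\<theta> \<rho> :: real \<Rightarrow> real. flatalg \<rho> \<and> (\<forall>x. (\<theta> has_real_derivative \<rho> x) (at x)) \<and> (\<forall>x. 0 \<le> \<rho> x) \<and>
    (\<forall>x\<le>0. \<theta> x = 0) \<and> (\<forall>x\<ge>1. \<theta> x = 1)"
proof -
  define r where "r x = flat 0 x * flat 0 (1 - x)" for x
  have r: "flatalg r"
  proof -
    have "flatalg (\<lambda>x. flat 0 (1 * x + 0) * flat 0 ((-1) * x + 1))" by (intro flatalg.intros)
    then show ?thesis by (simp add: r_def[abs_def])
  qed
  have r0: "0 \<le> r x" for x by (simp add: r_def flat_def)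
  have rz: "r x = 0" if "x \<notin> {0<..<1}" for x using that by (auto simp: r_def flat_def)
  have rc: "continuous_on S r" for S using flatalg_Ck[OF r, of 0] continuous_on_subset by auto
  \<comment> \<open>The lower limit -1 lies to the left of the support, so the fundamental theorem
    of calculus also applies at 0.\<close>
  define R where "R x = integral {-1..x} r" for x
  have Rd: "(R has_real_derivative r x) (at x)" if x: "x > -1" for x
  proof -
    have "(R has_vector_derivative r x) (at x within {-1..x+1})"
      unfolding R_def by (rule integral_has_vector_derivative) (use x rc in auto)
    moreover have "at x within {-1..x+1} = at x" using x by (intro at_within_interior) auto
    ultimately show ?thesis by (simp add: has_real_derivative_iff_has_vector_derivative)
  qed
  have R0: "R x = 0" if "x \<le> 0" for x
  proof -
    have "integral {-1..x} r = integral {-1..x} (\<lambda>_. 0)" by (rule integral_cong) (use rz that in auto)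
    then show ?thesis by (simp add: R_def)
  qed
  have R1: "R x = R 1" if "x \<ge> 1" for x
  proof -
    have "integral {-1..1} r + integral {1..x} r = integral {-1..x} r"
      by (rule Henstock_Kurzweil_Integration.integral_combine) (use that rc in \<open>auto intro: integrable_continuous_interval\<close>)
    moreover have "integral {1..x} r = integral {1..x} (\<lambda>_. 0)" by (rule integral_cong) (use rz in auto)
    ultimately show ?thesis by (simp add: R_def)
  qed
  \<comment> \<open>The bump is positive on [1/4, 1/2], so R increases strictly there and the
    normalising factor is not 0.\<close>
  have Z: "R 1 > 0"
  proof -
    have "R (1/4) < R (1/2)"
    proof (rule DERIV_pos_imp_increasing[where f = R])
      fix x :: real assume "1/4 \<le> x" "x \<le> 1/2"
      then show "\<exists>y. (R has_real_derivative y) (at x) \<and> 0 < y"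
        using Rd[of x] by (intro exI[of _ "r x"]) (auto simp: r_def flat_def)
    qed auto
    moreover have "R x \<le> R y" if "0 \<le> x" "x \<le> y" for x y
    proof (rule DERIV_nonneg_imp_nondecreasing[where f = R, OF that(2)])
      fix z assume "x \<le> z" "z \<le> y"
      then show "\<exists>D. (R has_real_derivative D) (at z) \<and> 0 \<le> D"
        using Rd[of z] r0[of z] that by (intro exI[of _ "r z"]) auto
    qed
    from this[of 0 "1/4"] this[of "1/2" 1] have "R 0 \<le> R (1/4)" "R (1/2) \<le> R 1" by auto
    ultimately show ?thesis using R0[of 0] by linarith
  qed
  show ?thesis
  proof (rule exI[of _ "\<lambda>x. inverse (R 1) * R x"], rule exI[of _ "\<lambda>x. inverse (R 1) * r x"], intro conjI allI)
    show "flatalg (\<lambda>x. inverse (R 1) * r x)" by (intro flatalg.mult flatalg.const r)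
    show "((\<lambda>x. inverse (R 1) * R x) has_real_derivative inverse (R 1) * r x) (at x)" for x
    proof (cases "x > -1")
      case True then show ?thesis by (intro DERIV_cmult Rd)
    next
      case False
      have ev: "\<forall>\<^sub>F y in nhds x. inverse (R 1) * R y = 0"
        by (rule eventually_nhds_openI[of "{..<0}"]) (use False in \<open>auto simp: R0\<close>)
      have "((\<lambda>y. 0) has_real_derivative inverse (R 1) * r x) (at x)" using False rz[of x] by simp
      then show ?thesis using DERIV_cong_ev[OF refl ev refl] by blast
    qed
    show "0 \<le> inverse (R 1) * r x" for x using r0[of x] Z by simp
    show "x \<le> 0 \<longrightarrow> inverse (R 1) * R x = 0" for x using R0[of x] by simp
    show "1 \<le> x \<longrightarrow> inverse (R 1) * R x = 1" for x
    proof
      assume "1 \<le> x"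
      then show "inverse (R 1) * R x = 1" unfolding R1[OF \<open>1 \<le> x\<close>] using Z by simp
    qed
  qed
qed

subsection \<open>Weak derivatives in time\<close>

text \<open>The test functions are smooth approximations of the indicator of an interval \<open>(c, d]\<close>; their
  derivatives are approximate identities at \<open>c\<close> and \<open>d\<close>.\<close>

lemma weak_derivative_integral:
  fixes g k :: "real \<Rightarrow> real"
  assumes g: "continuous_on {0<..} g" and k: "continuous_on {0<..} k"
    and weak: "\<And>\<eta> a b. smooth \<eta> \<Longrightarrow> 0 < a \<Longrightarrow> (\<And>t. t \<notin> {a..b} \<Longrightarrow> \<eta> t = 0) \<Longrightarrow>
      (LINT t:{0<..}|lebesgue. deriv \<eta> t * g t) = (LINT t:{0<..}|lebesgue. \<eta> t * k t)"
    and cd: "0 < c" "c < d"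
  shows "g c - g d = integral {c..d} k"
proof -
  obtain \<theta> \<rho> :: "real \<Rightarrow> real" where \<rho>: "flatalg \<rho>" and \<theta>': "\<And>x. (\<theta> has_real_derivative \<rho> x) (at x)"
    and \<rho>0: "\<And>x. 0 \<le> \<rho> x" and \<theta>0: "\<And>x. x \<le> 0 \<Longrightarrow> \<theta> x = 0" and \<theta>1: "\<And>x. x \<ge> 1 \<Longrightarrow> \<theta> x = 1"
    using smooth_step by blast
  have \<theta>b: "0 \<le> \<theta> x" "\<theta> x \<le> 1" for x
  proof -
    have m: "\<theta> x \<le> \<theta> y" if "x \<le> y" for x y
      by (rule DERIV_nonneg_imp_nondecreasing[OF that]) (use \<theta>' \<rho>0 in blast)
    show "0 \<le> \<theta> x" using m[of "min x 0" x] \<theta>0[of "min x 0"] by simp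
    show "\<theta> x \<le> 1" using m[of x "max x 1"] \<theta>1[of "max x 1"] by simp
  qed
  have \<rho>c: "continuous_on S \<rho>" for S using flatalg_Ck[OF \<rho>, of 0] continuous_on_subset by auto
  have \<theta>c: "continuous_on S \<theta>" for S using \<theta>' by (auto intro!: continuous_at_imp_continuous_on DERIV_isCont)
  have \<rho>z: "\<rho> x = 0" if "x < 0 \<or> x > 1" for x
  proof -
    have "(\<theta> has_real_derivative 0) (at x)"
    proof (cases "x < 0")
      case True
      have "\<forall>\<^sub>F y in nhds x. \<theta> y = 0"
        by (rule eventually_nhds_openI[of "{..<0}"]) (use True in \<open>auto simp: \<theta>0\<close>)
      from DERIV_cong_ev[OF refl this refl, of 0] show ?thesis by simp
    next
      case False
      have "\<forall>\<^sub>F y in nhds x. \<theta> y = 1"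
        by (rule eventually_nhds_openI[of "{1<..}"]) (use False that in \<open>auto simp: \<theta>1\<close>)
      from DERIV_cong_ev[OF refl this refl, of 0] show ?thesis by simp
    qed
    then show ?thesis using DERIV_unique[OF \<theta>'] by blast
  qed
  define N where "N n = real (Suc n)" for n
  have N: "N n \<ge> 1" for n by (simp add: N_def)
  \<comment> \<open>The derivative of the rescaled step: nonnegative, of mass 1, and supported in
    [c, c + 1 / N n].\<close>
  define \<delta> where "\<delta> n c t = N n * \<rho> (N n * (t - c))" for n c t
  have \<delta>d: "((\<lambda>t. \<theta> (N n * (t - c))) has_real_derivative \<delta> n c t) (at t)" for n c t
  proof -
    have "((\<lambda>t. \<theta> (N n * (t - c))) has_real_derivative \<rho> (N n * (t - c)) * N n) (at t)"
      by (rule DERIV_chain2[where f = \<theta>, OF \<theta>']) (auto intro!: derivative_eq_intros)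
    then show ?thesis by (simp add: \<delta>_def mult.commute)
  qed
  have \<delta>c: "continuous_on S (\<delta> n c)" for S n c
    unfolding \<delta>_def by (intro continuous_intros continuous_on_compose2[OF \<rho>c[of UNIV]]) auto
  have \<delta>z: "\<delta> n c t = 0" if "t \<notin> {c..c+1}" for n c t
  proof -
    have "N n * (t - c) < 0 \<or> N n * (t - c) > 1"
    proof (cases "t < c")
      case True then show ?thesis using N[of n] by (simp add: mult_less_0_iff)
    next
      case False
      then have "t - c > 1" using that by auto
      then have "1 * 1 < N n * (t - c)" using N[of n] by (intro mult_le_less_imp_less) auto
      then show ?thesis by simp
    qed
    then show ?thesis using \<rho>z by (simp add: \<delta>_def)
  qed
  have gi: "continuous_on {c..c+1} g" if "0 < c" for c using that by (intro continuous_on_subset[OF g]) auto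
  have conv: "(\<lambda>n. integral {c..c+1} (\<lambda>t. \<delta> n c t * g t)) \<longlonglongrightarrow> g c" if c: "0 < c" for c
  proof (rule LIMSEQ_I)
    fix e :: real assume e: "0 < e"
    obtain h where h: "h > 0" "\<And>t. t \<in> {c..c+1} \<Longrightarrow> dist t c < h \<Longrightarrow> dist (g t) (g c) < e / 2"
      using gi[OF c] e unfolding continuous_on_iff by (metis add.commute atLeastAtMost_iff half_gt_zero le_add_same_cancel1 order_refl zero_le_one)
    obtain n0 where n0: "inverse (real (Suc n0)) < h" using reals_Archimedean[OF h(1)] by blast
    have "norm (integral {c..c+1} (\<lambda>t. \<delta> n c t * g t) - g c) < e" if n: "n \<ge> n0" for n
    proof -
      have "(\<delta> n c has_integral (\<theta> (N n * (c + 1 - c)) - \<theta> (N n * (c - c)))) {c..c+1}"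
        by (rule fundamental_theorem_of_calculus)
          (auto simp: has_real_derivative_iff_has_vector_derivative[symmetric] intro: has_field_derivative_at_within \<delta>d)
      then have one: "(\<delta> n c has_integral 1) {c..c+1}" using \<theta>0[of 0] \<theta>1[OF N, of n] by simp
      have pos: "0 \<le> \<delta> n c t" for t using \<rho>0 N[of n] by (simp add: \<delta>_def)
      have i1: "(\<lambda>t. \<delta> n c t * g t) integrable_on {c..c+1}"
        by (intro integrable_continuous_interval continuous_intros \<delta>c gi c)
      have "norm (integral {c..c+1} (\<lambda>t. \<delta> n c t * (g t - g c))) \<le> integral {c..c+1} (\<lambda>t. \<delta> n c t * (e / 2))"
      proof (rule integral_norm_bound_integral)
        show "(\<lambda>t. \<delta> n c t * (g t - g c)) integrable_on {c..c+1}" "(\<lambda>t. \<delta> n c t * (e / 2)) integrable_on {c..c+1}"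
          by (intro integrable_continuous_interval continuous_intros \<delta>c gi c)+
        fix t assume t: "t \<in> {c..c+1}"
        show "norm (\<delta> n c t * (g t - g c)) \<le> \<delta> n c t * (e / 2)"
        proof (cases "t - c < h")
          case True
          then have "\<bar>g t - g c\<bar> \<le> e / 2" using h(2)[OF t] t by (simp add: dist_real_def)
          from mult_left_mono[OF this pos[of t]] show ?thesis using pos[of t] by (simp add: abs_mult)
        next
          case False
          have "inverse (N n) \<le> inverse (real (Suc n0))" unfolding N_def using n by (intro le_imp_inverse_le) auto
          then have "inverse (N n) < t - c" using False n0 by linarith
          then have "1 < N n * (t - c)" using N[of n] by (simp add: field_simps)
          then show ?thesis using \<rho>z by (simp add: \<delta>_def)
        qed
      qed
      also have "\<dots> = e / 2" using integral_unique[OF has_integral_mult_left[OF one, of "e / 2"]] by simp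
      also have "integral {c..c+1} (\<lambda>t. \<delta> n c t * (g t - g c)) = integral {c..c+1} (\<lambda>t. \<delta> n c t * g t) - g c"
      proof -
        have "((\<lambda>t. \<delta> n c t * g t - \<delta> n c t * g c) has_integral (integral {c..c+1} (\<lambda>t. \<delta> n c t * g t) - 1 * g c)) {c..c+1}"
          by (intro has_integral_diff integrable_integral i1 has_integral_mult_left one)
        then show ?thesis by (simp add: right_diff_distrib integral_unique)
      qed
      finally show ?thesis using e by simp
    qed
    then show "\<exists>n0. \<forall>n\<ge>n0. norm (integral {c..c+1} (\<lambda>t. \<delta> n c t * g t) - g c) < e" by blast
  qed
  have LI: "(LINT t:{0<..}|lebesgue. u t) = integral {a..b} u"
    if ab: "0 < a" and u: "continuous_on {a..b} u" "\<And>t. t \<notin> {a..b} \<Longrightarrow> u t = 0" for a b and u :: "real \<Rightarrow> real"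
  proof -
    have "(LINT t:{0<..}|lebesgue. u t) = (LINT t:{a..b}|lebesgue. u t)"
      unfolding set_lebesgue_integral_def
      by (rule Bochner_Integration.integral_cong) (use ab u(2) in \<open>auto simp: indicator_def\<close>)
    also have "\<dots> = integral {a..b} u"
      by (intro set_lebesgue_integral_eq_integral(2) absolutely_integrable_continuous_real u(1))
    finally show ?thesis .
  qed
  \<comment> \<open>Rises just after c and falls just after d, so its support lies in [c, d + 1] and
    avoids 0.\<close>
  define \<eta> where "\<eta> n t = \<theta> (N n * (t - c)) - \<theta> (N n * (t - d))" for n t
  have \<eta>d: "(\<eta> n has_real_derivative (\<delta> n c t - \<delta> n d t)) (at t)" for n t
    unfolding \<eta>_def by (intro DERIV_diff \<delta>d)
  have \<eta>s: "smooth (\<eta> n)" for n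
  proof (rule smooth_primitive[OF \<eta>d])
    have "flatalg (\<lambda>t. N n * \<rho> (N n * t + (- N n * c)) + (- N n) * \<rho> (N n * t + (- N n * d)))"
      by (intro flatalg.add flatalg.mult flatalg.const flatalg_affine \<rho>)
    then show "flatalg (\<lambda>t. \<delta> n c t - \<delta> n d t)" by (simp add: \<delta>_def right_diff_distrib)
  qed
  have \<eta>z: "\<eta> n t = 0" if "t \<notin> {c..d+1}" for n t
  proof (cases "t < c")
    case True
    then have "N n * (t - c) \<le> 0" "N n * (t - d) \<le> 0" using N[of n] cd by (simp_all add: mult_le_0_iff)
    then show ?thesis by (simp add: \<eta>_def \<theta>0)
  next
    case False
    then have "t - d \<ge> 1" "t - c \<ge> 1" using that cd by auto
    then have "1 * 1 \<le> N n * (t - c)" "1 * 1 \<le> N n * (t - d)" using N[of n] by (intro mult_mono; simp)+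
    then show ?thesis by (simp add: \<eta>_def \<theta>1)
  qed
  have \<eta>c: "continuous_on S (\<eta> n)" for S n
    unfolding \<eta>_def by (intro continuous_intros continuous_on_compose2[OF \<theta>c[of UNIV]]) auto
  have kc: "continuous_on {c..d+1} k" using cd by (intro continuous_on_subset[OF k]) auto
  have gc: "continuous_on {c..d+1} g" using cd by (intro continuous_on_subset[OF g]) auto
  have main: "integral {c..c+1} (\<lambda>t. \<delta> n c t * g t) - integral {d..d+1} (\<lambda>t. \<delta> n d t * g t)
      = integral {c..d+1} (\<lambda>t. \<eta> n t * k t)" for n
  proof -
    have "integral {c..d+1} (\<lambda>t. \<eta> n t * k t) = (LINT t:{0<..}|lebesgue. \<eta> n t * k t)"
      by (rule LI[symmetric]) (use cd \<eta>z \<eta>c kc in \<open>auto intro!: continuous_intros\<close>)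
    also have "\<dots> = (LINT t:{0<..}|lebesgue. deriv (\<eta> n) t * g t)"
      using weak[OF \<eta>s cd(1) \<eta>z] by simp
    also have "\<dots> = (LINT t:{0<..}|lebesgue. (\<delta> n c t - \<delta> n d t) * g t)"
      by (simp add: DERIV_imp_deriv[OF \<eta>d])
    also have "\<dots> = integral {c..d+1} (\<lambda>t. (\<delta> n c t - \<delta> n d t) * g t)"
    proof (rule LI)
      show "continuous_on {c..d+1} (\<lambda>t. (\<delta> n c t - \<delta> n d t) * g t)" by (intro continuous_intros \<delta>c gc)
      show "(\<delta> n c t - \<delta> n d t) * g t = 0" if "t \<notin> {c..d+1}" for t
        using \<delta>z[of t c n] \<delta>z[of t d n] that cd by auto
    qed (rule cd)
    also have "\<dots> = integral {c..d+1} (\<lambda>t. \<delta> n c t * g t) - integral {c..d+1} (\<lambda>t. \<delta> n d t * g t)"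
      unfolding left_diff_distrib
      by (intro Henstock_Kurzweil_Integration.integral_diff integrable_continuous_interval continuous_intros \<delta>c gc)
    finally have 2: "integral {c..d+1} (\<lambda>t. \<eta> n t * k t)
        = integral {c..d+1} (\<lambda>t. \<delta> n c t * g t) - integral {c..d+1} (\<lambda>t. \<delta> n d t * g t)" .
    have "integral {c..d+1} (\<lambda>t. \<delta> n e t * g t) = integral {e..e+1} (\<lambda>t. \<delta> n e t * g t)" if e: "c \<le> e" "e \<le> d" for e
    proof -
      have "integral {c..d+1} (\<lambda>t. \<delta> n e t * g t) = (LINT t:{0<..}|lebesgue. \<delta> n e t * g t)"
      proof (rule LI[symmetric])
        show "continuous_on {c..d+1} (\<lambda>t. \<delta> n e t * g t)" by (intro continuous_intros \<delta>c gc)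
        show "\<delta> n e t * g t = 0" if "t \<notin> {c..d+1}" for t using \<delta>z[of t e n] that e by auto
      qed (rule cd)
      also have "\<dots> = integral {e..e+1} (\<lambda>t. \<delta> n e t * g t)"
      proof (rule LI)
        show "continuous_on {e..e+1} (\<lambda>t. \<delta> n e t * g t)"
          using e cd by (intro continuous_intros \<delta>c gi) auto
        show "\<delta> n e t * g t = 0" if "t \<notin> {e..e+1}" for t using \<delta>z[OF that] by simp
      qed (use cd e in simp)
      finally show ?thesis .
    qed
    from this[of c] this[of d] have "integral {c..d+1} (\<lambda>t. \<delta> n c t * g t) = integral {c..c+1} (\<lambda>t. \<delta> n c t * g t)"
      "integral {c..d+1} (\<lambda>t. \<delta> n d t * g t) = integral {d..d+1} (\<lambda>t. \<delta> n d t * g t)" using cd by auto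
    then show ?thesis using 2 by simp
  qed
  have lim: "(\<lambda>n. integral {c..d+1} (\<lambda>t. \<eta> n t * k t)) \<longlonglongrightarrow> integral {c..d+1} (\<lambda>t. indicator {c<..d} t * k t)"
  proof (rule dominated_convergence(2)[where h = "\<lambda>t. \<bar>k t\<bar>"])
    show "(\<lambda>t. \<eta> n t * k t) integrable_on {c..d+1}" for n
      by (intro integrable_continuous_interval continuous_intros \<eta>c kc)
    show "(\<lambda>t. \<bar>k t\<bar>) integrable_on {c..d+1}"
      by (intro integrable_continuous_interval continuous_intros kc)
    show "norm (\<eta> n t * k t) \<le> \<bar>k t\<bar>" for n t
    proof -
      have "\<bar>\<eta> n t\<bar> \<le> 1" using \<theta>b[of "N n * (t - c)"] \<theta>b[of "N n * (t - d)"] by (simp add: \<eta>_def abs_le_iff)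
      then show ?thesis using mult_right_mono[of "\<bar>\<eta> n t\<bar>" 1 "\<bar>k t\<bar>"] by (simp add: abs_mult)
    qed
    show "(\<lambda>n. \<eta> n t * k t) \<longlonglongrightarrow> indicator {c<..d} t * k t" for t
    proof -
      \<comment> \<open>Since \<theta> vanishes at 0, the limit is the indicator of a half-line open
        on the left.\<close>
      have step: "(\<lambda>n. \<theta> (N n * (t - c))) \<longlonglongrightarrow> indicator {c<..} t" for c
      proof (cases "t > c")
        case True
        obtain n0 where n0: "inverse (real (Suc n0)) < t - c" using reals_Archimedean[of "t - c"] True by auto
        have "\<theta> (N n * (t - c)) = 1" if "n \<ge> n0" for n
        proof -
          have "inverse (N n) \<le> inverse (real (Suc n0))" unfolding N_def using that by (intro le_imp_inverse_le) auto
          then have "inverse (N n) < t - c" using n0 by linarith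
          then have "1 < N n * (t - c)" using N[of n] by (simp add: field_simps)
          then show ?thesis by (simp add: \<theta>1)
        qed
        then have "\<forall>\<^sub>F n in sequentially. \<theta> (N n * (t - c)) = 1" by (auto simp: eventually_sequentially)
        then show ?thesis using True by (simp add: tendsto_eventually)
      next
        case False
        then have "\<theta> (N n * (t - c)) = 0" for n using N[of n] by (intro \<theta>0) (simp add: mult_le_0_iff)
        then show ?thesis using False by simp
      qed
      have "(\<lambda>n. \<eta> n t * k t) \<longlonglongrightarrow> (indicator {c<..} t - indicator {d<..} t) * k t"
        unfolding \<eta>_def by (intro tendsto_intros step)
      moreover have "indicator {c<..} t - indicator {d<..} t = (indicator {c<..d} t :: real)"
        using cd by (auto simp: indicator_def)
      ultimately show ?thesis by simp
    qed
  qed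
  have ind: "integral {c..d+1} (\<lambda>t. indicator {c<..d} t * k t) = integral {c..d} k"
  proof -
    have "integral {c..d} k = integral {c..d+1} (\<lambda>t. if t \<in> {c..d} then k t else 0)"
      unfolding integral_restrict_Int using cd by (simp add: Int_atLeastAtMost)
    also have "\<dots> = integral {c..d+1} (\<lambda>t. indicator {c<..d} t * k t)"
      by (rule integral_spike[of "{c}"]) (auto simp: indicator_def)
    finally show ?thesis by simp
  qed
  have "(\<lambda>n. integral {c..d+1} (\<lambda>t. \<eta> n t * k t)) \<longlonglongrightarrow> g c - g d"
    unfolding main[symmetric] using cd by (intro tendsto_diff conv) auto
  from LIMSEQ_unique[OF this lim] show ?thesis by (simp only: ind)
qed

lemma weak_derivative_imp_has_derivative:
  fixes g k :: "real \<Rightarrow> real"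
  assumes g: "continuous_on {0<..} g" and k: "continuous_on {0<..} k"
    and weak: "\<And>\<eta> a b. smooth \<eta> \<Longrightarrow> 0 < a \<Longrightarrow> (\<And>t. t \<notin> {a..b} \<Longrightarrow> \<eta> t = 0) \<Longrightarrow>
      (LINT t:{0<..}|lebesgue. deriv \<eta> t * g t) = (LINT t:{0<..}|lebesgue. \<eta> t * k t)"
    and s: "0 < s"
  shows "(g has_real_derivative - k s) (at s)"
proof -
  \<comment> \<open>A base point to the left of s that is still positive, where g and k are
    continuous.\<close>
  let ?c = "s / 2"
  have "((\<lambda>t. integral {?c..t} k) has_vector_derivative k s) (at s within {?c..s+1})"
    by (rule integral_has_vector_derivative) (use s in \<open>auto intro: continuous_on_subset[OF k]\<close>)
  moreover have "at s within {?c..s+1} = at s" using s by (intro at_within_interior) auto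
  ultimately have "((\<lambda>t. integral {?c..t} k) has_real_derivative k s) (at s)"
    by (simp add: has_real_derivative_iff_has_vector_derivative)
  then have "((\<lambda>t. g ?c - integral {?c..t} k) has_real_derivative 0 - k s) (at s)"
    by (intro DERIV_diff) auto
  then have d: "((\<lambda>t. g ?c - integral {?c..t} k) has_real_derivative - k s) (at s)" by simp
  have ev: "\<forall>\<^sub>F t in nhds s. g t = g ?c - integral {?c..t} k"
  proof -
    have "\<forall>\<^sub>F t in nhds s. t \<in> {?c<..}" using s by (intro eventually_nhds_in_open) auto
    then show ?thesis
    proof eventually_elim
      case (elim t)
      have "g ?c - g t = integral {?c..t} k"
      proof (rule weak_derivative_integral[OF g k])
        fix \<eta> :: "real \<Rightarrow> real" and a b :: real assume "smooth \<eta>" "0 < a" "\<And>t. t \<notin> {a..b} \<Longrightarrow> \<eta> t = 0"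
        then show "(LINT t:{0<..}|lebesgue. deriv \<eta> t * g t) = (LINT t:{0<..}|lebesgue. \<eta> t * k t)"
          by (rule weak)
      qed (use s elim in auto)
      then show ?case by linarith
    qed
  qed
  show ?thesis using d DERIV_cong_ev[OF refl ev refl] by blast
qed

lemma has_derivative_imp_weak_derivative:
  fixes g k \<eta> :: "real \<Rightarrow> real"
  assumes g: "\<And>s. 0 < s \<Longrightarrow> (g has_real_derivative - k s) (at s)" and k: "continuous_on {0<..} k"
    and \<eta>: "smooth \<eta>" and a: "0 < a" and z: "\<And>t. t \<notin> {a..b} \<Longrightarrow> \<eta> t = 0"
  shows "(LINT t:{0<..}|lebesgue. deriv \<eta> t * g t) = (LINT t:{0<..}|lebesgue. \<eta> t * k t)"
proof -
  have \<eta>1: "Ck (Suc 0) \<eta>" using \<eta> by (simp only: smooth_def)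
  have \<eta>d: "(\<eta> has_real_derivative deriv \<eta> t) (at t)" for t
  proof -
    have "\<eta> differentiable (at t)" using \<eta>1 by simp
    then show ?thesis by (simp add: DERIV_deriv_iff_real_differentiable)
  qed
  have "deriv \<eta> t = frechet_derivative \<eta> (at t) 1" for t
    using frechet_derivative_at[OF \<eta>d[of t, unfolded has_field_derivative_def], symmetric] by simp
  then have \<eta>c: "continuous_on UNIV (deriv \<eta>)" using \<eta>1 by simp
  have \<eta>cc: "continuous_on S \<eta>" for S using \<eta>d by (auto intro!: continuous_at_imp_continuous_on DERIV_isCont)
  have gc: "continuous_on {0<..} g" using g by (auto intro!: continuous_at_imp_continuous_on DERIV_isCont)
  \<comment> \<open>Both endpoints lie outside the support of \<eta>, which removes the boundary
    terms.\<close>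
  define p r where "p = a / 2" and "r = max a b + 1"
  have pr: "0 < p" "p < a" "b < r" "p < r" using a by (auto simp: p_def r_def)
  have \<eta>'z: "deriv \<eta> t = 0" if "t \<notin> {a..b}" for t
  proof -
    have "open (- {a..b})" by auto
    then have "\<forall>\<^sub>F y in nhds t. \<eta> y = 0"
      by (rule eventually_nhds_openI[of "- {a..b}"]) (use that in \<open>auto simp: z\<close>)
    from DERIV_cong_ev[OF refl this refl, of 0] have "(\<eta> has_real_derivative 0) (at t)" by simp
    then show ?thesis by (rule DERIV_imp_deriv)
  qed
  have c': "continuous_on {p..r} g" "continuous_on {p..r} k"
    using pr by (auto intro: continuous_on_subset[OF gc] continuous_on_subset[OF k])
  have LI: "(LINT t:{0<..}|lebesgue. u t) = integral {p..r} u"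
    if u: "continuous_on {p..r} u" "\<And>t. t \<notin> {a..b} \<Longrightarrow> u t = 0" for u :: "real \<Rightarrow> real"
  proof -
    have "(LINT t:{0<..}|lebesgue. u t) = (LINT t:{p..r}|lebesgue. u t)"
      unfolding set_lebesgue_integral_def
      by (rule Bochner_Integration.integral_cong) (use pr u(2) in \<open>auto simp: indicator_def\<close>)
    also have "\<dots> = integral {p..r} u"
      by (intro set_lebesgue_integral_eq_integral(2) absolutely_integrable_continuous_real u(1))
    finally show ?thesis .
  qed
  have "((\<lambda>t. deriv \<eta> t * g t - \<eta> t * k t) has_integral (\<eta> r * g r - \<eta> p * g p)) {p..r}"
  proof (rule fundamental_theorem_of_calculus)
    fix t assume t: "t \<in> {p..r}"
    have "((\<lambda>t. \<eta> t * g t) has_real_derivative (deriv \<eta> t * g t + - k t * \<eta> t)) (at t)"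
      using t pr by (intro DERIV_mult \<eta>d g) auto
    then show "((\<lambda>t. \<eta> t * g t) has_vector_derivative (deriv \<eta> t * g t - \<eta> t * k t)) (at t within {p..r})"
      by (simp add: has_real_derivative_iff_has_vector_derivative[symmetric] has_field_derivative_at_within mult.commute)
  qed (use pr in auto)
  moreover have "\<eta> r = 0" "\<eta> p = 0" using pr by (auto intro: z)
  ultimately have "integral {p..r} (\<lambda>t. deriv \<eta> t * g t - \<eta> t * k t) = 0" by (simp add: integral_unique)
  moreover have "integral {p..r} (\<lambda>t. deriv \<eta> t * g t - \<eta> t * k t)
      = integral {p..r} (\<lambda>t. deriv \<eta> t * g t) - integral {p..r} (\<lambda>t. \<eta> t * k t)"
    by (intro Henstock_Kurzweil_Integration.integral_diff integrable_continuous_interval continuous_intros c'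
        continuous_on_subset[OF \<eta>c] \<eta>cc) auto
  moreover have "(LINT t:{0<..}|lebesgue. deriv \<eta> t * g t) = integral {p..r} (\<lambda>t. deriv \<eta> t * g t)"
    by (rule LI) (auto simp: \<eta>'z intro!: continuous_intros c' continuous_on_subset[OF \<eta>c])
  moreover have "(LINT t:{0<..}|lebesgue. \<eta> t * k t) = integral {p..r} (\<lambda>t. \<eta> t * k t)"
    by (rule LI) (auto simp: z intro!: continuous_intros c' \<eta>cc)
  ultimately show ?thesis by simp
qed

subsection \<open>Multiplication operators\<close>

definition multiplier :: "(real^'d \<Rightarrow> real) \<Rightarrow> bool" where
  "multiplier h \<longleftrightarrow> periodic h \<and> h \<in> borel_measurable lebesgue \<and> (\<exists>C. AE x in lebesgue. \<bar>h x\<bar> \<le> C)"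

definition mult_l2 :: "(real^'d \<Rightarrow> real) \<Rightarrow> 'd l2 \<Rightarrow> 'd l2" where
  "mult_l2 h u = abs_l2 (\<lambda>x. h x * rep_l2 u x)"

lemma multiplier_L2: "multiplier h \<Longrightarrow> f \<in> L2 \<Longrightarrow> (\<lambda>x. h x * f x) \<in> L2"
  unfolding multiplier_def by (blast intro: L2_mult_bounded)

lemma multiplier_continuous: "periodic h \<Longrightarrow> continuous_on UNIV h \<Longrightarrow> multiplier h"
  unfolding multiplier_def
  using L2D(2)[OF continuous_periodic_L2] periodic_bounded[of h] by (metis (no_types, lifting) AE_I2)

lemma multiplier_mult:
  assumes "multiplier g" "multiplier h" shows "multiplier (\<lambda>x. g x * h x)"
proof -
  obtain C D where C: "AE x in lebesgue. \<bar>g x\<bar> \<le> C" and D: "AE x in lebesgue. \<bar>h x\<bar> \<le> D"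
    using assms unfolding multiplier_def by blast
  have "AE x in lebesgue. \<bar>g x * h x\<bar> \<le> \<bar>C\<bar> * \<bar>D\<bar>"
    using C D by eventually_elim (auto simp: abs_mult intro!: mult_mono)
  then show ?thesis using assms by (auto simp: multiplier_def periodic_def)
qed

lemma mult_l2_abs:
  assumes h: "multiplier h" and f: "f \<in> L2"
  shows "mult_l2 h (abs_l2 f) = abs_l2 (\<lambda>x. h x * f x)"
  unfolding mult_l2_def
proof (subst abs_l2_eq_iff)
  show "AE x in cell. h x * rep_l2 (abs_l2 f) x = h x * f x"
    using rep_abs_l2[OF f] by eventually_elim simp
qed (intro multiplier_L2 h f rep_l2_in_L2)+

lemma bounded_linear_mult_l2:
  fixes h :: "real^'d \<Rightarrow> real"
  assumes h: "multiplier h" shows "bounded_linear (mult_l2 h)"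
proof -
  obtain C where C: "AE x in lebesgue. \<bar>h x\<bar> \<le> C" using h by (auto simp: multiplier_def)
  show ?thesis
  proof (rule bounded_linear_intro[where K = "\<bar>C\<bar>"])
    fix u v :: "'d l2" and r :: real
    note L = multiplier_L2[OF h rep_l2_in_L2]
    have "mult_l2 h (u + v) = mult_l2 h (abs_l2 (rep_l2 u) + abs_l2 (rep_l2 v))" by (simp add: abs_l2_rep)
    also have "\<dots> = abs_l2 (\<lambda>x. h x * (rep_l2 u x + rep_l2 v x))"
      by (simp add: abs_l2_add mult_l2_abs h L2_add)
    finally show "mult_l2 h (u + v) = mult_l2 h u + mult_l2 h v"
      by (simp add: mult_l2_def abs_l2_add L distrib_left)
    have "mult_l2 h (r *\<^sub>R u) = mult_l2 h (r *\<^sub>R abs_l2 (rep_l2 u))" by (simp add: abs_l2_rep)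
    also have "\<dots> = abs_l2 (\<lambda>x. h x * (r * rep_l2 u x))"
      by (simp add: abs_l2_scale mult_l2_abs h L2_scale)
    finally show "mult_l2 h (r *\<^sub>R u) = r *\<^sub>R mult_l2 h u"
      by (simp add: mult_l2_def abs_l2_scale L mult.left_commute)
    have "torus_integral (\<lambda>x. (h x * rep_l2 u x)\<^sup>2) \<le> torus_integral (\<lambda>x. C\<^sup>2 * (rep_l2 u x)\<^sup>2)"
      unfolding torus_integral_eq
    proof (rule integral_mono_AE)
      show "AE x in cell. (h x * rep_l2 u x)\<^sup>2 \<le> C\<^sup>2 * (rep_l2 u x)\<^sup>2"
        using AE_cell[OF C]
      proof eventually_elim
        case (elim x)
        then have "(h x)\<^sup>2 \<le> C\<^sup>2" by (metis abs_ge_zero power2_abs power_mono)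
        then show ?case by (simp add: power_mult_distrib mult_right_mono)
      qed
    qed (use L2D(4)[OF L] L2D(4)[OF rep_l2_in_L2] in auto)
    then have "L2_norm (\<lambda>x. h x * rep_l2 u x) \<le> sqrt (C\<^sup>2 * torus_integral (\<lambda>x. (rep_l2 u x)\<^sup>2))"
      unfolding L2_norm_def by (intro real_sqrt_le_mono) (simp add: torus_integral_eq)
    then have "norm (mult_l2 h u) \<le> \<bar>C\<bar> * L2_norm (rep_l2 u)"
      by (simp add: mult_l2_def norm_abs_l2 L real_sqrt_mult L2_norm_def)
    then show "norm (mult_l2 h u) \<le> norm u * \<bar>C\<bar>"
      using norm_abs_l2[OF rep_l2_in_L2, of u] by (simp add: abs_l2_rep mult.commute)
  qed
qed

subsection \<open>The Fokker--Planck operator as a closed form\<close>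

text \<open>Dividing densities by \<open>sqrt \<pi>\<^sub>*\<close> turns the weighted inner product of the scheme into the inner product of
  \<open>L\<^sup>2\<close>. In the names below \<open>w = \<mu> / \<pi>\<^sub>*\<close>, so that \<open>cls w\<close> is the class of \<open>\<mu> / sqrt \<pi>\<^sub>*\<close>.\<close>

locale fokker_planck =
  fixes As :: "real^'d^'d" and V :: "real^'d \<Rightarrow> real" and DV :: "real^'d \<Rightarrow> real^'d" and L c0 :: real
  assumes As_sym: "As $ j $ k = As $ k $ j"
    and c0: "0 < c0" and ell: "c0 * (\<xi> \<bullet> \<xi>) \<le> \<xi> \<bullet> (As *v \<xi>)"
    and V_per: "periodic V" and V_lip: "\<bar>V x - V y\<bar> \<le> L * dist x y" and V_bd: "0 \<le> V x" "V x \<le> L"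
    and V_der: "AE x in lebesgue. (V has_derivative (\<lambda>h. DV x \<bullet> h)) (at x)"
begin

lemma V_cont: "continuous_on S V"
  by (rule Lipschitz_continuous[OF V_lip])

text \<open>\<open>DV\<close> is fixed only almost everywhere and need not be periodic at every
  point, as \<open>L2\<close> requires. The classical gradient is periodic everywhere, so it
  replaces \<open>DV\<close> until \<open>FP_form_emb\<close>.\<close>

lemma grad_V_DV: "AE x in lebesgue. grad V x = DV x"
  using V_der by eventually_elim (rule has_derivative_pd(2))

lemma V_der_grad: "AE x in lebesgue. (V has_derivative (\<lambda>h. grad V x \<bullet> h)) (at x)"
  using V_der by eventually_elim (simp add: has_derivative_pd(2))

text \<open>Measurability and the bound L are both inherited from difference quotients, which
  converge almost everywhere.\<close>

lemma multiplier_pd_V: "multiplier (pd j V)"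
proof -
  let ?q = "\<lambda>n x. (V (x + inverse (real (Suc n)) *\<^sub>R axis j 1) - V x) * real (Suc n)"
  have lim: "AE x in lebesgue. (\<lambda>n. ?q n x) \<longlonglongrightarrow> pd j V x"
    using V_der_grad by eventually_elim (use has_derivative_imp_sequential in \<open>fastforce simp: grad_def\<close>)
  have sh: "continuous_on UNIV (\<lambda>x. V (x + c))" for c
    by (rule continuous_on_compose2[OF V_cont[of UNIV]]) (auto intro: continuous_intros)
  have m: "?q n \<in> borel_measurable lebesgue" for n
    using L2D(2)[OF continuous_periodic_L2[OF V_per V_cont]]
      L2D(2)[OF continuous_periodic_L2[OF periodic_shift[OF V_per] sh]] by simp
  have "(\<lambda>x. lim (\<lambda>n. ?q n x)) \<in> borel_measurable lebesgue" by (rule borel_measurable_lim_metric[OF m])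
  moreover have "AE x in lebesgue. lim (\<lambda>n. ?q n x) = pd j V x"
    using lim by eventually_elim (rule limI)
  ultimately have "pd j V \<in> borel_measurable lebesgue" by (rule borel_measurable_AE)
  moreover have "AE x in lebesgue. \<bar>pd j V x\<bar> \<le> L"
    using lim
  proof eventually_elim
    case (elim x)
    have "\<bar>?q n x\<bar> \<le> L" for n
    proof -
      have "\<bar>V (x + inverse (real (Suc n)) *\<^sub>R axis j 1) - V x\<bar> \<le> L * inverse (real (Suc n))"
        using V_lip[of "x + inverse (real (Suc n)) *\<^sub>R axis j 1" x] by (simp add: dist_norm norm_axis_1)
      then have "\<bar>V (x + inverse (real (Suc n)) *\<^sub>R axis j 1) - V x\<bar> * real (Suc n) \<le> L"
        by (simp add: field_simps)
      then show ?thesis by (simp add: abs_mult del: of_nat_Suc)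
    qed
    then show ?case using tendsto_upperbound[OF tendsto_rabs[OF elim], of L] by simp
  qed
  ultimately show ?thesis unfolding multiplier_def using pd_periodic[OF V_per] by blast
qed

text \<open>The exponent c = 1 gives 1 / \<pi>_*, and c = 1/2, -1/2 give the reciprocal square root
  and the square root of \<pi>_*.\<close>

definition ex :: "real \<Rightarrow> real^'d \<Rightarrow> real" where "ex c x = exp (c * V x)"

lemma ex_mult: "ex a x * ex b x = ex (a + b) x" "ex a x * (ex b x * y) = ex (a + b) x * y"
  by (simp_all add: ex_def exp_add distrib_right)

lemma ex_0: "ex 0 x = 1"
  by (simp add: ex_def)

lemma ex_pos: "0 < ex c x"
  by (simp add: ex_def)

lemma ex_le: "ex c x \<le> exp (\<bar>c\<bar> * L)"
proof -
  have "c * V x \<le> \<bar>c\<bar> * \<bar>V x\<bar>" by (metis abs_ge_self abs_mult)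
  also have "\<dots> \<le> \<bar>c\<bar> * L" using V_bd[of x] by (intro mult_left_mono) auto
  finally show ?thesis by (simp add: ex_def)
qed

lemma ex_periodic: "periodic (ex c)"
  using V_per by (simp add: periodic_def ex_def)

lemma multiplier_ex: "multiplier (ex c)"
proof (rule multiplier_continuous[OF ex_periodic])
  show "continuous_on UNIV (ex c)" unfolding ex_def by (intro continuous_intros V_cont)
qed

lemma ex_Lipschitz: "\<bar>ex c x - ex c y\<bar> \<le> (exp (\<bar>c\<bar> * L) * (\<bar>c\<bar> * L)) * dist x y"
proof -
  have "norm (exp (c * V x) - exp (c * V y)) \<le> exp (\<bar>c\<bar> * L) * norm (c * V x - c * V y)"
  proof (rule field_differentiable_bound[OF convex_closed_segment[of "c * V x" "c * V y"]])
    fix z assume z: "z \<in> closed_segment (c * V x) (c * V y)"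
    have "c * V x \<le> \<bar>c\<bar> * L" "c * V y \<le> \<bar>c\<bar> * L" using ex_le[of c x] ex_le[of c y] by (simp_all add: ex_def)
    then have "z \<le> \<bar>c\<bar> * L" using z by (auto simp: closed_segment_eq_real_ivl split: if_splits)
    then show "norm (exp z) \<le> exp (\<bar>c\<bar> * L)" by simp
    show "(exp has_field_derivative exp z) (at z within closed_segment (c * V x) (c * V y))"
      by (rule has_field_derivative_at_within[OF DERIV_exp])
  qed auto
  also have "norm (c * V x - c * V y) = \<bar>c\<bar> * \<bar>V x - V y\<bar>" by (simp add: abs_mult flip: right_diff_distrib)
  also have "exp (\<bar>c\<bar> * L) * (\<bar>c\<bar> * \<bar>V x - V y\<bar>) \<le> exp (\<bar>c\<bar> * L) * (\<bar>c\<bar> * (L * dist x y))"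
    by (intro mult_left_mono V_lip) auto
  finally show ?thesis by (simp add: ex_def mult.assoc)
qed

lemma has_weak_grad_ex:
  assumes G: "has_weak_grad f G"
  shows "has_weak_grad (\<lambda>x. ex c x * f x) (\<lambda>x. ex c x *\<^sub>R G x + f x *\<^sub>R ((c * ex c x) *\<^sub>R grad V x))"
proof -
  have m: "multiplier (\<lambda>x. c * ex c x * pd j V x)" for j
    by (intro multiplier_mult multiplier_ex multiplier_pd_V multiplier_continuous) (auto simp: periodic_def)
  have "\<exists>B. AE x in lebesgue. \<bar>((c * ex c x) *\<^sub>R grad V x) $ j\<bar> \<le> B" for j
    using m[of j] by (simp add: multiplier_def grad_def)
  then obtain B where B: "\<And>j. AE x in lebesgue. \<bar>((c * ex c x) *\<^sub>R grad V x) $ j\<bar> \<le> B j" by metis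
  have B0: "B j \<le> (\<Sum>i\<in>UNIV. \<bar>B i\<bar>)" for j
    using member_le_sum[of j UNIV "\<lambda>i. \<bar>B i\<bar>"] by auto
  show ?thesis
  proof (rule has_weak_grad_mult[OF G ex_periodic ex_Lipschitz])
    show "\<bar>ex c x\<bar> \<le> exp (\<bar>c\<bar> * L)" for x using ex_le[of c x] ex_pos[of c x] by simp
    show "(\<lambda>x. ((c * ex c x) *\<^sub>R grad V x) $ j) \<in> borel_measurable lebesgue"
      "periodic (\<lambda>x. ((c * ex c x) *\<^sub>R grad V x) $ j)" for j
      using m[of j] by (simp_all add: multiplier_def grad_def)
    show "AE x in lebesgue. \<bar>((c * ex c x) *\<^sub>R grad V x) $ j\<bar> \<le> (\<Sum>i\<in>UNIV. \<bar>B i\<bar>)" for j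
      using B[of j] by eventually_elim (rule order_trans[OF _ B0])
    show "AE x in lebesgue. (ex c has_derivative (\<lambda>h. ((c * ex c x) *\<^sub>R grad V x) \<bullet> h)) (at x)"
      using V_der_grad
    proof eventually_elim
      case (elim x)
      have "((\<lambda>x. exp (c * V x)) has_derivative (\<lambda>h. (c * (grad V x \<bullet> h)) * exp (c * V x))) (at x)"
        by (auto intro!: derivative_eq_intros elim)
      then show ?case by (simp add: ex_def[abs_def] mult_ac)
    qed
  qed
qed

lemma H1_ex: "f \<in> H1 \<Longrightarrow> (\<lambda>x. ex c x * f x) \<in> H1"
  using has_weak_grad_ex[OF wgrad] H1I by blast

section \<open>The weighted gradient form on classes\<close>

definition cls :: "(real^'d \<Rightarrow> real) \<Rightarrow> 'd l2" where
  "cls w = abs_l2 (\<lambda>x. ex (-1/2) x * w x)"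

definition den :: "'d l2 \<Rightarrow> real^'d \<Rightarrow> real" where
  "den u x = ex (1/2) x * rep_l2 u x"

definition D :: "'d l2 set" where
  "D = {u. den u \<in> H1}"

text \<open>The class of sqrt \<pi>_* times a partial derivative of \<mu> / \<pi>_*. In these
  vectors \<open>q\<close> is a combination of inner products, so convergence of E means convergence
  in q.\<close>

definition E :: "'d l2 \<Rightarrow> 'd \<Rightarrow> 'd l2" where
  "E u j = cls (\<lambda>x. wgrad (den u) x $ j)"

definition q :: "'d l2 \<Rightarrow> 'd l2 \<Rightarrow> real" where
  "q u v = (\<Sum>j\<in>UNIV. \<Sum>k\<in>UNIV. As $ j $ k * (E v j \<bullet> E u k))"

lemma exL2: "f \<in> L2 \<Longrightarrow> (\<lambda>x. ex c x * f x) \<in> L2"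
  by (rule multiplier_L2[OF multiplier_ex])

lemma den_L2: "den u \<in> L2"
  unfolding den_def by (intro exL2 rep_l2_in_L2)

lemma cls_den: "cls (den u) = u"
  by (simp add: cls_def den_def ex_mult ex_0 abs_l2_rep)

lemma den_cls: assumes "w \<in> L2" shows "AE x in cell. den (cls w) x = w x"
  using rep_abs_l2[OF exL2[OF assms, of "-1/2"]]
  by eventually_elim (simp add: den_def cls_def ex_mult ex_0)

lemma cls_add: "v \<in> L2 \<Longrightarrow> w \<in> L2 \<Longrightarrow> cls v + cls w = cls (\<lambda>x. v x + w x)"
  unfolding cls_def by (simp add: abs_l2_add exL2 distrib_left)

lemma cls_scale: "w \<in> L2 \<Longrightarrow> r *\<^sub>R cls w = cls (\<lambda>x. r * w x)"
  unfolding cls_def by (simp add: abs_l2_scale exL2 mult.left_commute)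

text \<open>\<open>D\<close> and \<open>E\<close> refer to the representative picked by
  \<open>rep_l2\<close>. Computations go through this lemma, which accepts any representative and
  any of its weak gradients.\<close>

lemma cls_weak_grad:
  assumes G: "has_weak_grad w G"
  shows "cls w \<in> D" "E (cls w) j = cls (\<lambda>x. G x $ j)"
proof -
  have w: "w \<in> L2" using has_weak_gradD(1)[OF G] .
  have "AE x in cell. w x = den (cls w) x" using den_cls[OF w] by eventually_elim simp
  then have g: "has_weak_grad (den (cls w)) G" by (rule has_weak_grad_cong[OF G den_L2])
  then show "cls w \<in> D" by (simp add: D_def H1I)
  have ae: "AE x in cell. ex (-1/2) x * wgrad (den (cls w)) x $ j = ex (-1/2) x * G x $ j"
    using wgrad_AE[OF g] by eventually_elim simp
  show "E (cls w) j = cls (\<lambda>x. G x $ j)"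
    unfolding E_def cls_def[of "\<lambda>x. wgrad (den (cls w)) x $ j"] cls_def[of "\<lambda>x. G x $ j"]
      abs_l2_eq_iff[OF exL2[OF wgrad_L2[OF H1I[OF g]]] exL2[OF has_weak_gradD(2)[OF G]]]
    by (rule ae)
qed

lemma D_weak_grad: "u \<in> D \<Longrightarrow> has_weak_grad (den u) (wgrad (den u))"
  unfolding D_def by (simp add: wgrad)

lemma E_add:
  assumes "u \<in> D" "v \<in> D" shows "u + v \<in> D" "E (u + v) j = E u j + E v j"
proof -
  note g = has_weak_grad_add[OF D_weak_grad[OF assms(1)] D_weak_grad[OF assms(2)]]
  have e: "u + v = cls (\<lambda>x. den u x + den v x)" using cls_add[OF den_L2 den_L2, of u v] by (simp add: cls_den)
  show "u + v \<in> D" unfolding e by (rule cls_weak_grad(1)[OF g])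
  have "E (u + v) j = cls (\<lambda>x. (wgrad (den u) x + wgrad (den v) x) $ j)" unfolding e by (rule cls_weak_grad(2)[OF g])
  also have "\<dots> = E u j + E v j"
    unfolding E_def using has_weak_gradD(2)[OF D_weak_grad] assms by (simp add: cls_add)
  finally show "E (u + v) j = E u j + E v j" .
qed

lemma E_scale:
  assumes "u \<in> D" shows "r *\<^sub>R u \<in> D" "E (r *\<^sub>R u) j = r *\<^sub>R E u j"
proof -
  note g = has_weak_grad_scale[OF D_weak_grad[OF assms(1)], of r]
  have e: "r *\<^sub>R u = cls (\<lambda>x. r * den u x)" using cls_scale[OF den_L2, of r u] by (simp add: cls_den)
  show "r *\<^sub>R u \<in> D" unfolding e by (rule cls_weak_grad(1)[OF g])
  have "E (r *\<^sub>R u) j = cls (\<lambda>x. (r *\<^sub>R wgrad (den u) x) $ j)" unfolding e by (rule cls_weak_grad(2)[OF g])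
  also have "\<dots> = r *\<^sub>R E u j"
    unfolding E_def using has_weak_gradD(2)[OF D_weak_grad] assms by (simp add: cls_scale)
  finally show "E (r *\<^sub>R u) j = r *\<^sub>R E u j" .
qed

lemma E_diff: "u \<in> D \<Longrightarrow> v \<in> D \<Longrightarrow> E (u - v) j = E u j - E v j"
  using E_add(2)[of u "(-1) *\<^sub>R v" j] E_scale[of v "-1"] by simp

lemma ex_mult_mult: "(ex a x * y) * (ex b x * z) = ex (a + b) x * (y * z)"
proof -
  have "(ex a x * y) * (ex b x * z) = (ex a x * ex b x) * (y * z)" by (simp only: mult_ac)
  then show ?thesis by (simp only: ex_mult(1))
qed

lemma inner_cls: "v \<in> L2 \<Longrightarrow> w \<in> L2 \<Longrightarrow> cls v \<bullet> cls w = torus_integral (\<lambda>x. ex (-1) x * (v x * w x))"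
  unfolding cls_def by (simp add: inner_abs_l2 exL2 ex_mult_mult)

lemma integrable_ex_mult: "v \<in> L2 \<Longrightarrow> w \<in> L2 \<Longrightarrow> integrable cell (\<lambda>x. ex c x * (v x * w x))"
  using L2_mult_integrable[OF exL2[of v c], of w] by (simp add: mult.assoc)

lemma q_cls:
  assumes F: "has_weak_grad v F" and G: "has_weak_grad w G"
  shows "q (cls v) (cls w) = torus_integral (\<lambda>x. (ex (-1) x *\<^sub>R (As *v F x)) \<bullet> G x)"
proof -
  have "(ex (-1) x *\<^sub>R (As *v F x)) \<bullet> G x = (\<Sum>j\<in>UNIV. \<Sum>k\<in>UNIV. As $ j $ k * (ex (-1) x * (G x $ j * F x $ k)))" for x
    by (simp add: inner_commute[of _ "G x"] sum_matrix_vector sum_distrib_left mult_ac)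
  then show ?thesis
    unfolding q_def cls_weak_grad(2)[OF F] cls_weak_grad(2)[OF G]
    using has_weak_gradD(2)[OF F] has_weak_gradD(2)[OF G]
    by (simp add: inner_cls torus_integral_eq integrable_ex_mult)
qed

text \<open>The pointwise ellipticity integrated against the weight \<pi>_*. It gives nonnegativity
  of the form and control of every component of E, hence closedness.\<close>

lemma q_ge:
  assumes u: "u \<in> D" shows "c0 * (\<Sum>j\<in>UNIV. (norm (E u j))\<^sup>2) \<le> q u u"
proof -
  let ?G = "wgrad (den u)"
  note G = D_weak_grad[OF u]
  note GL = has_weak_gradD(2)[OF G]
  have int: "integrable cell (\<lambda>x. ex (-1) x * (?G x $ j * ?G x $ k))" for j k
    by (intro integrable_ex_mult GL)
  have "c0 * (\<Sum>j\<in>UNIV. (norm (E u j))\<^sup>2) = torus_integral (\<lambda>x. c0 * (\<Sum>j\<in>UNIV. ex (-1) x * (?G x $ j * ?G x $ j)))"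
    using int by (simp add: power2_norm_eq_inner E_def inner_cls GL torus_integral_eq)
  also have "\<dots> \<le> torus_integral (\<lambda>x. \<Sum>j\<in>UNIV. \<Sum>k\<in>UNIV. As $ j $ k * (ex (-1) x * (?G x $ j * ?G x $ k)))"
    unfolding torus_integral_eq
  proof (rule integral_mono)
    fix x
    have "ex (-1) x * (c0 * (?G x \<bullet> ?G x)) \<le> ex (-1) x * (?G x \<bullet> (As *v ?G x))"
      by (intro mult_left_mono ell less_imp_le[OF ex_pos])
    then show "c0 * (\<Sum>j\<in>UNIV. ex (-1) x * (?G x $ j * ?G x $ j))
        \<le> (\<Sum>j\<in>UNIV. \<Sum>k\<in>UNIV. As $ j $ k * (ex (-1) x * (?G x $ j * ?G x $ k)))"
      by (simp add: inner_vec_def[of "?G x" "?G x"] sum_matrix_vector sum_distrib_left mult_ac)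
  qed (use int in simp_all)
  also have "\<dots> = q u u"
    using int by (simp add: q_def E_def inner_cls GL torus_integral_eq)
  finally show ?thesis .
qed

lemma norm_E_le:
  assumes "u \<in> D" shows "(norm (E u j))\<^sup>2 \<le> q u u / c0"
proof -
  have "(norm (E u j))\<^sup>2 \<le> (\<Sum>j\<in>UNIV. (norm (E u j))\<^sup>2)" by (rule member_le_sum) auto
  also have "\<dots> \<le> q u u / c0" using q_ge[OF assms] c0 by (simp add: field_simps)
  finally show ?thesis .
qed

lemma sym_form: "sym_form D q"
proof
  show "subspace D"
  proof (rule subspaceI)
    have "has_weak_grad (\<lambda>x. 0) (\<lambda>x. 0 :: real^'d)" by (simp add: has_weak_grad_def L2_zero torus_integral_eq)
    from cls_weak_grad(1)[OF this] show "0 \<in> D" by (simp add: cls_def abs_l2_zero)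
  qed (simp_all add: E_add E_scale)
  show "q (x + y) z = q x z + q y z" if "x \<in> D" "y \<in> D" for x y z
    unfolding q_def by (simp add: E_add that inner_add_right distrib_left sum.distrib)
  show "q (c *\<^sub>R x) z = c * q x z" if "x \<in> D" for c x z
    unfolding q_def by (simp add: E_scale that sum_distrib_left mult.left_commute)
  show "q x y = q y x" for x y
    unfolding q_def by (subst sum.swap) (simp add: As_sym inner_commute)
  show "0 \<le> q x x" if "x \<in> D" for x
    using q_ge[OF that] c0 by (meson mult_nonneg_nonneg less_imp_le order_trans sum_nonneg zero_le_power2)
qed

lemma closed_form: "closed_form D q"
proof -
  interpret sym_form D q by (rule sym_form)
  show ?thesis
  proof
    fix X :: "nat \<Rightarrow> 'd l2"
    assume X: "\<And>n. X n \<in> D" and C: "Cauchy X"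
      and qC: "\<And>e. e > 0 \<Longrightarrow> \<exists>N. \<forall>m\<ge>N. \<forall>n\<ge>N. q (X m - X n) (X m - X n) < e"
    have "Cauchy (\<lambda>n. E (X n) j)" for j
    proof (rule CauchyI)
      fix e :: real assume e: "0 < e"
      then obtain N where N: "\<And>m n. m \<ge> N \<Longrightarrow> n \<ge> N \<Longrightarrow> q (X m - X n) (X m - X n) < c0 * e\<^sup>2"
        using qC[of "c0 * e\<^sup>2"] c0 by auto
      have "norm (E (X m) j - E (X n) j) < e" if "m \<ge> N" "n \<ge> N" for m n
      proof (rule power2_less_imp_less)
        have "(norm (E (X m - X n) j))\<^sup>2 \<le> q (X m - X n) (X m - X n) / c0" by (intro norm_E_le D_diff X)
        also have "\<dots> < e\<^sup>2" using N[OF that] c0 by (simp add: field_simps)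
        finally show "(norm (E (X m) j - E (X n) j))\<^sup>2 < e\<^sup>2" by (simp add: E_diff X)
      qed (use e in simp)
      then show "\<exists>N. \<forall>m\<ge>N. \<forall>n\<ge>N. norm (E (X m) j - E (X n) j) < e" by blast
    qed
    then have "\<exists>e. (\<lambda>n. E (X n) j) \<longlonglongrightarrow> e" for j using Cauchy_convergent convergent_def by blast
    then obtain e where e: "\<And>j. (\<lambda>n. E (X n) j) \<longlonglongrightarrow> e j" by metis
    obtain x where x: "X \<longlonglongrightarrow> x" using Cauchy_convergent[OF C] convergent_def by blast
    define G where "G x = (\<chi> j. den (e j) x)" for x
    \<comment> \<open>Removing the weight is a bounded multiplication operator, so limits of the
      weighted classes pass to unweighted functions, where weak gradients are known to be
      closed.\<close>
    have un: "abs_l2 f = mult_l2 (ex (1/2)) (cls f)" if "f \<in> L2" for f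
      unfolding cls_def using that by (simp add: mult_l2_abs multiplier_ex exL2 ex_mult ex_0)
    have lim: "(\<lambda>n. mult_l2 (ex (1/2)) (Y n)) \<longlonglongrightarrow> mult_l2 (ex (1/2)) y" if "Y \<longlonglongrightarrow> y" for Y :: "nat \<Rightarrow> 'd l2" and y
      using bounded_linear.tendsto[OF bounded_linear_mult_l2[OF multiplier_ex] that] .
    have G: "has_weak_grad (den x) G"
    proof (rule has_weak_grad_closed[OF D_weak_grad[OF X]])
      show "(\<lambda>n. abs_l2 (den (X n))) \<longlonglongrightarrow> abs_l2 (den x)"
        by (simp add: un den_L2 cls_den lim x)
      show "(\<lambda>n. abs_l2 (\<lambda>x. wgrad (den (X n)) x $ j)) \<longlonglongrightarrow> abs_l2 (\<lambda>x. G x $ j)" for j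
        using lim[OF e, of j] has_weak_gradD(2)[OF D_weak_grad[OF X], where j = j]
        by (simp add: un E_def G_def den_L2 cls_den)
    qed (simp_all add: den_L2 G_def)
    have xD: "x \<in> D" using cls_weak_grad(1)[OF G] by (simp add: cls_den)
    have Ex: "E x j = e j" for j using cls_weak_grad(2)[OF G, of j] by (simp add: cls_den G_def)
    have "(\<lambda>n. \<Sum>j\<in>UNIV. \<Sum>k\<in>UNIV. As $ j $ k * ((E (X n) j - e j) \<bullet> (E (X n) k - e k)))
        \<longlonglongrightarrow> (\<Sum>j\<in>UNIV. \<Sum>k\<in>UNIV. As $ j $ k * ((e j - e j) \<bullet> (e k - e k)))"
      by (intro tendsto_intros e)
    then have "(\<lambda>n. q (X n - x) (X n - x)) \<longlonglongrightarrow> 0"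
      by (simp add: q_def E_diff X xD Ex)
    then show "\<exists>x\<in>D. X \<longlonglongrightarrow> x \<and> (\<lambda>n. q (X n - x) (X n - x)) \<longlonglongrightarrow> 0" using x xD by blast
  qed
qed

sublocale closed_form D q
  by (rule closed_form)

subsection \<open>Translation between densities and classes\<close>

definition emb :: "(real^'d \<Rightarrow> real) \<Rightarrow> 'd l2" where
  "emb \<mu> = abs_l2 (\<lambda>x. ex (1/2) x * \<mu> x)"

lemma emb_cls: "emb \<mu> = cls (\<lambda>x. ex 1 x * \<mu> x)"
  by (simp add: emb_def cls_def ex_mult)

lemma weak_grad_emb:
  assumes "\<mu> \<in> H1"
  shows "has_weak_grad (\<lambda>x. ex 1 x * \<mu> x) (\<lambda>x. ex 1 x *\<^sub>R (wgrad \<mu> x + \<mu> x *\<^sub>R grad V x))"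
  using has_weak_grad_ex[OF wgrad[OF assms], of 1] by (simp add: scaleR_add_right mult.commute)

lemma emb_D: "\<mu> \<in> H1 \<Longrightarrow> emb \<mu> \<in> D"
  unfolding emb_cls by (rule cls_weak_grad(1)[OF weak_grad_emb])

definition unemb :: "'d l2 \<Rightarrow> real^'d \<Rightarrow> real" where
  "unemb u x = ex (-1/2) x * rep_l2 u x"

lemma emb_unemb: "emb (unemb u) = u"
  by (simp add: emb_def unemb_def ex_mult ex_0 abs_l2_rep)

lemma unemb_L2: "unemb u \<in> L2"
  unfolding unemb_def by (intro exL2 rep_l2_in_L2)

lemma unemb_H1: assumes "u \<in> D" shows "unemb u \<in> H1"
proof -
  have "(\<lambda>x. ex (-1) x * den u x) \<in> H1" using assms by (intro H1_ex) (simp add: D_def)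
  then show ?thesis by (simp add: den_def unemb_def[abs_def] ex_mult)
qed

lemma emb_diff: "\<mu> \<in> L2 \<Longrightarrow> \<nu> \<in> L2 \<Longrightarrow> emb \<mu> - emb \<nu> = emb (\<lambda>x. \<mu> x - \<nu> x)"
  unfolding emb_def by (simp add: abs_l2_diff exL2 right_diff_distrib)

lemma Kdist_emb: assumes "\<mu> \<in> L2" "\<nu> \<in> L2" shows "Kdist V \<mu> \<nu> = norm (emb \<mu> - emb \<nu>)"
proof -
  have "(\<mu> x - \<nu> x)\<^sup>2 / pi_star V x = (ex (1/2) x * (\<mu> x - \<nu> x))\<^sup>2" for x
    by (simp add: power_mult_distrib power2_eq_square[of "ex _ _"] ex_mult)
      (simp add: ex_def pi_star_def exp_minus divide_inverse mult.commute)
  then show ?thesis unfolding emb_diff[OF assms] unfolding emb_def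
    using assms by (simp add: norm_abs_l2 exL2 L2_diff Kdist_def L2_norm_def)
qed

text \<open>Since V \<ge> 0, the weight exp (V / 2) is at least 1.\<close>

lemma L2_norm_le_emb: assumes "\<mu> \<in> L2" "\<nu> \<in> L2" shows "L2_norm (\<lambda>x. \<mu> x - \<nu> x) \<le> norm (emb \<mu> - emb \<nu>)"
proof -
  have "torus_integral (\<lambda>x. (\<mu> x - \<nu> x)\<^sup>2) \<le> torus_integral (\<lambda>x. (ex (1/2) x * (\<mu> x - \<nu> x))\<^sup>2)"
    unfolding torus_integral_eq
  proof (rule integral_mono)
    fix x
    have "1 \<le> ex (1/2) x" using V_bd[of x] by (simp add: ex_def)
    then have "1\<^sup>2 \<le> (ex (1/2) x)\<^sup>2" by (intro power_mono) auto
    then have "1 * (\<mu> x - \<nu> x)\<^sup>2 \<le> (ex (1/2) x)\<^sup>2 * (\<mu> x - \<nu> x)\<^sup>2" by (intro mult_right_mono) auto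
    then show "(\<mu> x - \<nu> x)\<^sup>2 \<le> (ex (1/2) x * (\<mu> x - \<nu> x))\<^sup>2" by (simp add: power_mult_distrib)
  qed (use L2D(4)[OF L2_diff[OF assms]] L2D(4)[OF exL2[OF L2_diff[OF assms]]] in auto)
  then show ?thesis unfolding emb_diff[OF assms] unfolding emb_def
    using assms by (simp add: norm_abs_l2 exL2 L2_diff L2_norm_def)
qed

lemma norm_emb_le:
  obtains C where "\<And>\<mu> \<nu>. \<mu> \<in> L2 \<Longrightarrow> \<nu> \<in> L2 \<Longrightarrow> norm (emb \<mu> - emb \<nu>) \<le> L2_norm (\<lambda>x. \<mu> x - \<nu> x) * C"
proof -
  obtain C where C: "\<And>u. norm (mult_l2 (ex (1/2)) u) \<le> norm u * C"
    using bounded_linear.bounded[OF bounded_linear_mult_l2[OF multiplier_ex]] by blast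
  have "norm (emb \<mu> - emb \<nu>) \<le> L2_norm (\<lambda>x. \<mu> x - \<nu> x) * C" if "\<mu> \<in> L2" "\<nu> \<in> L2" for \<mu> \<nu>
    unfolding emb_diff[OF that] unfolding emb_def
    using C[of "abs_l2 (\<lambda>x. \<mu> x - \<nu> x)"] that
    by (simp add: mult_l2_abs multiplier_ex L2_diff norm_abs_l2)
  then show ?thesis by (rule that)
qed

lemma Qfun_emb: assumes "\<mu> \<in> H1" shows "Qfun As V \<mu> = 1/2 * q (emb \<mu>) (emb \<mu>)"
proof -
  have e: "\<mu> y / pi_star V y = ex 1 y * \<mu> y" for y
    by (simp add: pi_star_def ex_def exp_minus divide_inverse mult.commute)
  note g = wgrad[OF H1I[OF weak_grad_emb[OF assms]]]
  show ?thesis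
    unfolding Qfun_def emb_cls q_cls[OF g g] e by (simp add: pi_star_def ex_def)
qed

lemma inner_emb_cls: "\<mu> \<in> L2 \<Longrightarrow> \<phi> \<in> L2 \<Longrightarrow> emb \<mu> \<bullet> cls \<phi> = torus_integral (\<lambda>x. \<mu> x * \<phi> x)"
  unfolding emb_def cls_def by (simp add: inner_abs_l2 exL2 ex_mult_mult ex_0)

text \<open>The factor e^(-V) of the form cancels e^V from the gradient of \<mu> / \<pi>_*. The test
  function enters through \<open>cls\<close>, not \<open>emb\<close>, because the pairing of \<mu>
  with \<phi> carries no weight.\<close>

lemma FP_form_emb:
  assumes "\<mu> \<in> H1" "\<phi> \<in> H1"
  shows "FP_form As DV \<mu> \<phi> = q (emb \<mu>) (cls \<phi>)"
proof -
  let ?a = "\<lambda>x. wgrad \<mu> x + \<mu> x *\<^sub>R grad V x"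
  have GL: "(\<lambda>x. ?a x $ j) \<in> L2" for j
    using L2_add[OF wgrad_L2[OF assms(1), of j] multiplier_L2[OF multiplier_pd_V[of j] H1_L2[OF assms(1)]]]
    by (simp add: grad_def mult.commute)
  have "q (emb \<mu>) (cls \<phi>) = torus_integral (\<lambda>x. (ex (-1) x *\<^sub>R (As *v (ex 1 x *\<^sub>R ?a x))) \<bullet> wgrad \<phi> x)"
    unfolding emb_cls by (rule q_cls[OF weak_grad_emb[OF assms(1)] wgrad[OF assms(2)]])
  also have "\<dots> = torus_integral (\<lambda>x. (As *v ?a x) \<bullet> wgrad \<phi> x)"
    by (simp add: matrix_vector_mult_scaleR ex_mult ex_0 flip: scaleR_scaleR mult.assoc)
  also have "\<dots> = FP_form As DV \<mu> \<phi>"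
  proof -
    \<comment> \<open>The integrand with \<open>DV\<close> is measurable only through its almost
      everywhere equality with this one, by completeness of the Lebesgue measure.\<close>
    have m: "(\<lambda>x. (As *v ?a x) \<bullet> wgrad \<phi> x) \<in> borel_measurable cell"
      unfolding inner_commute[of _ "wgrad \<phi> _"] sum_matrix_vector
      using L2D(3)[OF wgrad_L2[OF assms(2)]] L2D(3)[OF GL] by (intro borel_measurable_sum borel_measurable_times) auto
    have ae: "AE x in lebesgue. (As *v ?a x) \<bullet> wgrad \<phi> x = (As *v (wgrad \<mu> x + \<mu> x *\<^sub>R DV x)) \<bullet> wgrad \<phi> x"
      using grad_V_DV by eventually_elim simp
    have ae': "AE x in lebesgue. indicator (cbox 0 One) x *\<^sub>R ((As *v ?a x) \<bullet> wgrad \<phi> x)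
        = indicator (cbox 0 One) x *\<^sub>R ((As *v (wgrad \<mu> x + \<mu> x *\<^sub>R DV x)) \<bullet> wgrad \<phi> x)"
      using ae by eventually_elim simp
    have "(\<lambda>x. indicator (cbox 0 One) x *\<^sub>R ((As *v ?a x) \<bullet> wgrad \<phi> x)) \<in> borel_measurable lebesgue"
      using m by (subst (asm) borel_measurable_restrict_space_iff) auto
    then show ?thesis
      unfolding FP_form_def torus_integral_def set_lebesgue_integral_def
      using borel_measurable_AE[OF _ ae'] ae' by (intro integral_cong_AE) auto
  qed
  finally show ?thesis by simp
qed

subsection \<open>The scheme\<close>

lemma moreau_emb:
  assumes "\<mu> \<in> H1" "\<nu> \<in> L2"
  shows "Qfun As V \<mu> + 1 / (2 * \<tau>) * (Kdist V \<mu> \<nu>)\<^sup>2 = moreau \<tau> (emb \<nu>) (emb \<mu>)"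
  using assms by (simp add: moreau_def Qfun_emb Kdist_emb H1_L2)

text \<open>\<open>emb\<close> maps \<open>H1\<close> onto \<open>D\<close>, and the functional sees
  a density only through its class; hence minimisers are unique up to null sets.\<close>

lemma is_arg_min_emb:
  assumes \<tau>: "\<tau> > 0" and \<nu>: "\<nu> \<in> L2"
  shows "is_arg_min (\<lambda>\<mu>. Qfun As V \<mu> + 1 / (2 * \<tau>) * (Kdist V \<mu> \<nu>)\<^sup>2) (\<lambda>\<mu>. \<mu> \<in> H1) \<mu> \<longleftrightarrow>
    \<mu> \<in> H1 \<and> emb \<mu> = res \<tau> (emb \<nu>)"
proof -
  have "is_arg_min (\<lambda>\<mu>. Qfun As V \<mu> + 1 / (2 * \<tau>) * (Kdist V \<mu> \<nu>)\<^sup>2) (\<lambda>\<mu>. \<mu> \<in> H1) \<mu> \<longleftrightarrow>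
      \<mu> \<in> H1 \<and> (\<forall>\<mu>'\<in>H1. moreau \<tau> (emb \<nu>) (emb \<mu>) \<le> moreau \<tau> (emb \<nu>) (emb \<mu>'))"
    unfolding is_arg_min_linorder using moreau_emb[OF _ \<nu>] by auto
  also have "\<dots> \<longleftrightarrow> \<mu> \<in> H1 \<and> is_arg_min (moreau \<tau> (emb \<nu>)) (\<lambda>u. u \<in> D) (emb \<mu>)"
    unfolding is_arg_min_linorder using emb_D unemb_H1 emb_unemb by (metis (no_types, lifting))
  finally show ?thesis by (simp add: is_arg_min_eq_res[OF \<tau>])
qed

lemma min_scheme_iff:
  assumes \<tau>: "\<tau> > 0" and \<mu>0: "\<mu>0 \<in> H1"
  shows "min_scheme As V \<mu>0 \<tau> m \<longleftrightarrow> m 0 = \<mu>0 \<and> (\<forall>n. m n \<in> H1 \<and> emb (m n) = (res \<tau> ^^ n) (emb \<mu>0))"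
proof (intro iffI)
  assume s: "min_scheme As V \<mu>0 \<tau> m"
  have "m n \<in> H1 \<and> emb (m n) = (res \<tau> ^^ n) (emb \<mu>0)" for n
  proof (induction n)
    case 0 then show ?case using s \<mu>0 by (simp add: min_scheme_def)
  next
    case (Suc n)
    have "is_arg_min (\<lambda>\<mu>. Qfun As V \<mu> + 1 / (2 * \<tau>) * (Kdist V \<mu> (m n))\<^sup>2) (\<lambda>\<mu>. \<mu> \<in> H1) (m (Suc n))"
      using s[unfolded min_scheme_def, THEN conjunct2, rule_format, of "Suc n"] by simp
    then show ?case using Suc is_arg_min_emb[OF \<tau>, of "m n"] by (simp add: H1_L2)
  qed
  then show "m 0 = \<mu>0 \<and> (\<forall>n. m n \<in> H1 \<and> emb (m n) = (res \<tau> ^^ n) (emb \<mu>0))"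
    using s by (simp add: min_scheme_def)
next
  assume s: "m 0 = \<mu>0 \<and> (\<forall>n. m n \<in> H1 \<and> emb (m n) = (res \<tau> ^^ n) (emb \<mu>0))"
  have "is_arg_min (\<lambda>\<mu>. Qfun As V \<mu> + 1 / (2 * \<tau>) * (Kdist V \<mu> (m (n - 1)))\<^sup>2) (\<lambda>\<mu>. \<mu> \<in> H1) (m n)" if n: "n \<ge> 1" for n
  proof -
    have e: "emb (m n) = res \<tau> (emb (m (n - 1)))" using s n by (cases n) auto
    have "m (n - 1) \<in> L2" using s H1_L2 by blast
    then show ?thesis by (subst is_arg_min_emb[OF \<tau>]) (use e s in blast)+
  qed
  then show "min_scheme As V \<mu>0 \<tau> m" using s by (simp add: min_scheme_def)
qed

lemma ex_min_scheme:
  assumes \<tau>: "\<tau> > 0" and \<mu>0: "\<mu>0 \<in> H1"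
  shows "\<exists>m. min_scheme As V \<mu>0 \<tau> m"
proof
  \<comment> \<open>At index 0 the scheme asks for \<mu>0 itself, whereas \<open>unemb\<close> would
    return a possibly different representative of its class.\<close>
  show "min_scheme As V \<mu>0 \<tau> (\<lambda>n. if n = 0 then \<mu>0 else unemb ((res \<tau> ^^ n) (emb \<mu>0)))"
    unfolding min_scheme_iff[OF assms]
    using \<mu>0 res_power_D[OF \<tau> emb_D[OF \<mu>0]] by (auto simp: emb_unemb unemb_H1 simp del: funpow.simps)
qed

lemma min_scheme_discrete_FP:
  assumes \<tau>: "\<tau> > 0" and \<mu>0: "\<mu>0 \<in> H1" and m: "min_scheme As V \<mu>0 \<tau> m" and n: "n \<ge> 1"
  shows "discrete_FP_weak As DV \<tau> (m n) (m (n - 1))"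
proof -
  have H: "m k \<in> H1" and e: "emb (m k) = (res \<tau> ^^ k) (emb \<mu>0)" for k using m min_scheme_iff[OF \<tau> \<mu>0] by auto
  have r: "emb (m n) = res \<tau> (emb (m (n - 1)))" using n by (cases n) (auto simp: e)
  have "torus_integral (\<lambda>x. (m n x - m (n - 1) x) / \<tau> * \<phi> x) + FP_form As DV (m n) \<phi> = 0" if \<phi>: "\<phi> \<in> H1" for \<phi>
  proof -
    have cD: "cls \<phi> \<in> D" by (rule cls_weak_grad(1)[OF wgrad[OF \<phi>]])
    have "(emb (m (n - 1)) - emb (m n)) \<bullet> cls \<phi> = \<tau> * FP_form As DV (m n) \<phi>"
      using res_eq[OF \<tau> cD, of "emb (m (n - 1))"] unfolding r[symmetric] FP_form_emb[OF H \<phi>] .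
    moreover have "torus_integral (\<lambda>x. (m n x - m (n - 1) x) / \<tau> * \<phi> x) = (emb (m n) - emb (m (n - 1))) \<bullet> cls \<phi> / \<tau>"
      by (simp add: emb_diff inner_emb_cls L2_diff H1_L2 H \<phi> torus_integral_eq mult.commute)
    ultimately show ?thesis using \<tau> by (simp add: inner_diff_left field_simps)
  qed
  then show ?thesis using H by (simp add: discrete_FP_weak_def)
qed

end

context fokker_planck begin

subsection \<open>Existence and uniqueness of weak solutions\<close>

text \<open>Negative times are included: the index \<open>nat\<close> of a nonpositive ceiling is 0,
  so the flow is constantly v there.\<close>

lemma flow_D: assumes "v \<in> D" shows "flow v t \<in> D"
proof (cases "t > 0")
  case False
  then have "t / inverse (real (Suc n)) \<le> 0" for n by (intro divide_nonpos_pos) auto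
  then have "nat \<lceil>t / inverse (real (Suc n))\<rceil> = 0" for n by simp
  then have "flow v t = v" by (simp add: flow_def euler_def)
  then show ?thesis using assms by simp
qed (rule flow_D_approx(1)[OF assms])

lemma continuous_on_q_flow:
  assumes v: "v \<in> D" and w: "w \<in> D" shows "continuous_on {0<..} (\<lambda>t. q (flow v t) w)"
proof (rule continuous_at_imp_continuous_on, rule ballI)
  fix s :: real assume "s \<in> {0<..}"
  then have "((\<lambda>t. q (flow v t) w) \<longlongrightarrow> q (flow v s) w) (at s)"
    by (intro q_tendsto(1) flow_D v w flow_q_tendsto) auto
  then show "isCont (\<lambda>t. q (flow v t) w) s" by (simp add: isCont_def)
qed

lemma continuous_on_E_flow:
  assumes v: "v \<in> D" shows "continuous_on {0<..} (\<lambda>t. E (flow v t) j)"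
proof (rule continuous_at_imp_continuous_on, rule ballI)
  fix s :: real assume s: "s \<in> {0<..}"
  have "((\<lambda>t. E (flow v t) j) \<longlongrightarrow> E (flow v s) j) (at s)"
  proof (rule Lim_null[THEN iffD2], rule tendsto_norm_zero_cancel, rule tendsto_sandwich[where f = "\<lambda>_. 0"])
    have "norm (E (flow v t) j - E (flow v s) j) \<le> sqrt (q (flow v t - flow v s) (flow v t - flow v s) / c0)" for t
      using norm_E_le[OF D_diff[OF flow_D[OF v] flow_D[OF v]], of t s j]
      by (intro real_le_rsqrt) (simp add: E_diff flow_D v)
    then show "\<forall>\<^sub>F t in at s. norm (E (flow v t) j - E (flow v s) j)
        \<le> sqrt (q (flow v t - flow v s) (flow v t - flow v s) / c0)" by simp
    have "((\<lambda>t. sqrt (q (flow v t - flow v s) (flow v t - flow v s) / c0)) \<longlongrightarrow> sqrt (0 / c0)) (at s)"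
      using s c0 by (intro tendsto_intros flow_q_tendsto v) auto
    then show "((\<lambda>t. sqrt (q (flow v t - flow v s) (flow v t - flow v s) / c0)) \<longlongrightarrow> 0) (at s)" by simp
  qed auto
  then show "isCont (\<lambda>t. E (flow v t) j) s" by (simp add: isCont_def)
qed

lemma multiplier_ex_pd_V: "multiplier (\<lambda>x. ex c x * pd j V x)"
  by (intro multiplier_mult multiplier_ex multiplier_pd_V)

text \<open>The product rule for \<mu> = e^(-V) w, written with bounded operators applied to E u j
  and u. It makes the unweighted gradient continuous in time.\<close>

lemma wgrad_unemb:
  assumes u: "u \<in> D"
  shows "abs_l2 (\<lambda>x. wgrad (unemb u) x $ j)
    = mult_l2 (ex (-1/2)) (E u j) - mult_l2 (\<lambda>x. ex (-1/2) x * pd j V x) u"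
proof -
  note GL = has_weak_gradD(2)[OF D_weak_grad[OF u], of j]
  have e: "(\<lambda>x. ex (-1) x * den u x) = unemb u" by (simp add: fun_eq_iff den_def unemb_def ex_mult)
  note g = has_weak_grad_ex[OF D_weak_grad[OF u], of "-1", unfolded e]
  have 1: "mult_l2 (ex (-1/2)) (E u j) = abs_l2 (\<lambda>x. ex (-1) x * wgrad (den u) x $ j)"
    unfolding E_def cls_def by (simp add: mult_l2_abs multiplier_ex exL2 GL ex_mult)
  have 2: "mult_l2 (\<lambda>x. ex (-1/2) x * pd j V x) u = abs_l2 (\<lambda>x. ex (-1/2) x * pd j V x * rep_l2 u x)"
    by (simp add: mult_l2_def)
  have L: "(\<lambda>x. ex (-1) x * wgrad (den u) x $ j) \<in> L2" "(\<lambda>x. ex (-1/2) x * pd j V x * rep_l2 u x) \<in> L2"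
    by (intro exL2 GL) (rule multiplier_L2[OF multiplier_ex_pd_V rep_l2_in_L2])
  have ae: "AE x in cell. wgrad (unemb u) x $ j = ex (-1) x * wgrad (den u) x $ j - ex (-1/2) x * pd j V x * rep_l2 u x"
    using wgrad_AE[OF g]
  proof eventually_elim
    case (elim x)
    have "den u x * ex (-1) x = ex (-1/2) x * rep_l2 u x" by (simp add: den_def mult.commute[of _ "ex (-1) x"] ex_mult)
    then have "den u x * (ex (-1) x * pd j V x) = ex (-1/2) x * pd j V x * rep_l2 u x"
      by (metis mult.assoc mult.commute)
    then show ?case by (simp add: elim grad_def)
  qed
  show ?thesis
    unfolding 1 2 abs_l2_diff[OF L]
    by (rule abs_l2_eq_iff[OF wgrad_L2[OF H1I[OF g]] L2_diff[OF L], THEN iffD2, OF ae])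
qed

text \<open>The energy of the gradient coincides for t > 0 with the continuous function R, which
  gives measurability, and R is bounded on (0, T] because the form energy does not exceed its
  initial value.\<close>

lemma flow_energy_integrable:
  assumes v: "v \<in> D" and T: "T > 0"
    and \<mu>: "\<And>t. 0 < t \<Longrightarrow> \<mu> t = unemb (flow v t)"
  shows "set_integrable lebesgue {0..T} (\<lambda>t. torus_integral (\<lambda>x. (norm (wgrad (\<mu> t) x))\<^sup>2))"
proof -
  define P where "P t = torus_integral (\<lambda>x. (norm (wgrad (\<mu> t) x))\<^sup>2)" for t
  let ?M = "mult_l2 (ex (-1/2))" and ?N = "\<lambda>j. mult_l2 (\<lambda>x. ex (-1/2) x * pd j V x)"
  define S where "S j t = ?M (E (flow v t) j) - ?N j (flow v t)" for j t
  define R where "R t = (\<Sum>j\<in>UNIV. (norm (S j t))\<^sup>2)" for t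
  note bM = bounded_linear_mult_l2[OF multiplier_ex] and bN = bounded_linear_mult_l2[OF multiplier_ex_pd_V]
  have PR: "P t = R t" if t: "0 < t" for t
  proof -
    have H: "unemb (flow v t) \<in> H1" by (intro unemb_H1 flow_D v)
    note GL = wgrad_L2[OF H]
    have "(norm y)\<^sup>2 = (\<Sum>j\<in>UNIV. (y $ j)\<^sup>2)" for y :: "real^'d"
      by (simp add: power2_norm_eq_inner inner_vec_def) (simp add: power2_eq_square)
    then have "P t = (\<Sum>j\<in>UNIV. torus_integral (\<lambda>x. (wgrad (unemb (flow v t)) x $ j)\<^sup>2))"
      using L2D(4)[OF GL] by (simp add: P_def \<mu>[OF t] torus_integral_eq)
    also have "\<dots> = R t"
    proof -
      have "S j t = abs_l2 (\<lambda>x. wgrad (unemb (flow v t)) x $ j)" for j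
        unfolding S_def by (rule wgrad_unemb[OF flow_D[OF v], symmetric])
      then show ?thesis unfolding R_def
        by (simp add: norm_abs_l2 GL L2_norm_def torus_integral_eq)
    qed
    finally show ?thesis .
  qed
  have fc: "continuous_on {0<..} (flow v)" by (rule continuous_on_subset[OF continuous_on_flow[OF v]]) auto
  have Rc: "continuous_on {0<..} R"
    unfolding R_def S_def
    by (intro continuous_intros bounded_linear.continuous_on[OF bM] bounded_linear.continuous_on[OF bN]
        continuous_on_E_flow v fc)
  have "\<exists>B. \<forall>t\<in>{0<..T}. norm (S j t) \<le> B" for j
  proof -
    have "norm (E (flow v t) j) \<le> sqrt (q v v / c0)" if "t \<in> {0<..T}" for t
    proof (rule real_le_rsqrt)
      have "q (flow v t) (flow v t) / c0 \<le> q v v / c0" using q_flow_le[OF v, of t] that c0 by (intro divide_right_mono) auto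
      then show "(norm (E (flow v t) j))\<^sup>2 \<le> q v v / c0" using norm_E_le[OF flow_D[OF v], of t j] by linarith
    qed
    then have 1: "bounded ((\<lambda>t. E (flow v t) j) ` {0<..T})" unfolding bounded_iff by blast
    have "compact (flow v ` {0..T})"
      by (intro compact_continuous_image continuous_on_subset[OF continuous_on_flow[OF v]]) auto
    then have 2: "bounded (flow v ` {0<..T})" by (rule bounded_subset[OF compact_imp_bounded]) auto
    have "bounded ((\<lambda>t. S j t) ` {0<..T})"
      unfolding S_def
      using bounded_linear_image[OF 1 bM] bounded_linear_image[OF 2 bN]
      by (intro bounded_minus_comp) (simp_all add: image_image)
    then show ?thesis unfolding bounded_iff by blast
  qed
  then obtain B where B: "\<And>j t. t \<in> {0<..T} \<Longrightarrow> norm (S j t) \<le> B j" by metis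
  have Rb: "norm (R t) \<le> (\<Sum>j\<in>UNIV. (B j)\<^sup>2)" if "t \<in> {0<..T}" for t
    unfolding R_def using B[OF that] by (auto simp: abs_of_nonneg sum_nonneg intro!: sum_mono power_mono)
  have m: "(\<lambda>t. indicator {0<..T} t *\<^sub>R R t) \<in> borel_measurable lebesgue"
  proof -
    have "(\<lambda>t. indicator {0<..T} t *\<^sub>R R t) \<in> borel_measurable borel"
      by (rule borel_measurable_continuous_on_indicator[OF _ continuous_on_subset[OF Rc]]) auto
    then show ?thesis by (simp add: measurable_completion)
  qed
  have "integrable lebesgue (\<lambda>t. indicator {0<..T} t *\<^sub>R (indicator {0<..T} t *\<^sub>R R t))"
  proof (rule integrableI_bounded_set_indicator[where B = "\<Sum>j\<in>UNIV. (B j)\<^sup>2"])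
    show "emeasure lebesgue {0<..T} < \<infinity>" by (simp add: emeasure_lborel_Ioc T less_imp_le)
    show "AE t in lebesgue. t \<in> {0<..T} \<longrightarrow> norm (indicator {0<..T} t *\<^sub>R R t) \<le> (\<Sum>j\<in>UNIV. (B j)\<^sup>2)"
      using Rb by (intro AE_I2) auto
  qed (use m in auto)
  \<comment> \<open>The time 0, about which nothing is known here, is a null set.\<close>
  moreover have "integrable lebesgue (\<lambda>t. indicator {0<..T} t *\<^sub>R (indicator {0<..T} t *\<^sub>R R t)) \<longleftrightarrow>
      integrable lebesgue (\<lambda>t. indicator {0..T} t *\<^sub>R P t)"
  proof (rule integrable_discrete_difference[where X = "{0}"])
    fix t :: real assume "t \<notin> {0}"
    then show "indicator {0<..T} t *\<^sub>R (indicator {0<..T} t *\<^sub>R R t) = indicator {0..T} t *\<^sub>R P t"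
      by (auto simp: indicator_def PR)
  qed auto
  ultimately show ?thesis by (simp add: set_integrable_def P_def)
qed

lemma FP_weak_solution_flow:
  assumes \<mu>0: "\<mu>0 \<in> H1"
  shows "FP_weak_solution As DV \<mu>0 (\<lambda>t. if t = 0 then \<mu>0 else unemb (flow (emb \<mu>0) t))"
proof -
  define \<mu> where "\<mu> t = (if t = 0 then \<mu>0 else unemb (flow (emb \<mu>0) t))" for t :: real
  define v where "v = emb \<mu>0"
  have v: "v \<in> D" unfolding v_def by (rule emb_D[OF \<mu>0])
  have e: "emb (\<mu> t) = flow v t" for t by (simp add: \<mu>_def v_def[symmetric] emb_unemb flow_0[OF v])
  have L: "\<mu> t \<in> L2" for t by (simp add: \<mu>_def unemb_L2 H1_L2 \<mu>0)
  have H: "\<mu> t \<in> H1" for t by (simp add: \<mu>_def \<mu>0 unemb_H1 flow_D v v_def[symmetric])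
  have "((\<lambda>t. L2_norm (\<lambda>x. \<mu> t x - \<mu> s x)) \<longlongrightarrow> 0) (at s within {0..})" if s: "s \<ge> 0" for s
  proof (rule tendsto_sandwich[where f = "\<lambda>_. 0"])
    show "\<forall>\<^sub>F t in at s within {0..}. L2_norm (\<lambda>x. \<mu> t x - \<mu> s x) \<le> norm (flow v t - flow v s)"
      using L2_norm_le_emb[OF L L] by (simp add: e)
    have "(flow v \<longlongrightarrow> flow v s) (at s within {0..})"
      using continuous_on_flow[OF v] s by (auto simp: continuous_on_def)
    then show "((\<lambda>t. norm (flow v t - flow v s)) \<longlongrightarrow> 0) (at s within {0..})"
      using tendsto_norm_zero Lim_null by blast
  qed (auto simp: L2_norm_def torus_integral_eq)
  moreover have "set_integrable lebesgue {0..T} (\<lambda>t. torus_integral (\<lambda>x. (norm (wgrad (\<mu> t) x))\<^sup>2))" if "T > 0" for T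
    by (rule flow_energy_integrable[OF v that]) (simp add: \<mu>_def v_def)
  moreover have "(LINT t:{0<..}|lebesgue. deriv \<eta> t * torus_integral (\<lambda>x. \<mu> t x * \<phi> x)) =
        (LINT t:{0<..}|lebesgue. \<eta> t * FP_form As DV (\<mu> t) \<phi>)"
    if \<phi>: "\<phi> \<in> H1" and \<eta>: "smooth \<eta>" "0 < a" "\<forall>t. t \<notin> {a..b} \<longrightarrow> \<eta> t = 0" for \<phi> \<eta> and a b :: real
  proof -
    have w: "cls \<phi> \<in> D" by (rule cls_weak_grad(1)[OF wgrad[OF \<phi>]])
    have "(LINT t:{0<..}|lebesgue. deriv \<eta> t * (flow v t \<bullet> cls \<phi>)) = (LINT t:{0<..}|lebesgue. \<eta> t * q (flow v t) (cls \<phi>))"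
      using \<eta>(3) has_derivative_imp_weak_derivative[where b = b,
          OF flow_has_real_derivative[OF v w] continuous_on_q_flow[OF v w] \<eta>(1,2)] by blast
    then show ?thesis
      by (simp add: FP_form_emb H \<phi> e inner_emb_cls[OF L H1_L2[OF \<phi>], symmetric])
  qed
  moreover have "\<mu> 0 = \<mu>0" by (simp add: \<mu>_def)
  ultimately have "FP_weak_solution As DV \<mu>0 \<mu>"
    unfolding FP_weak_solution_def using L H by (intro conjI allI impI ballI AE_I2) (blast | simp)+
  then show ?thesis by (simp add: \<mu>_def[abs_def])
qed

lemma FP_weak_solution_unique:
  assumes \<mu>0: "\<mu>0 \<in> H1" and sol: "FP_weak_solution As DV \<mu>0 \<mu>" and t: "0 \<le> t"
  shows "emb (\<mu> t) = flow (emb \<mu>0) t"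
proof -
  define v where "v = emb \<mu>0"
  have v: "v \<in> D" unfolding v_def by (rule emb_D[OF \<mu>0])
  have L: "\<mu> t \<in> L2" if "t \<ge> 0" for t using sol that by (simp add: FP_weak_solution_def)
  have H: "AE t in lebesgue. t > 0 \<longrightarrow> \<mu> t \<in> H1" using sol by (simp add: FP_weak_solution_def)
  obtain C where C: "\<And>\<mu> \<nu>. \<mu> \<in> L2 \<Longrightarrow> \<nu> \<in> L2 \<Longrightarrow> norm (emb \<mu> - emb \<nu>) \<le> L2_norm (\<lambda>x. \<mu> x - \<nu> x) * C"
    using norm_emb_le by blast
  have cont: "continuous_on {0..} (\<lambda>t. emb (\<mu> t))"
    unfolding continuous_on_def
  proof
    fix s :: real assume s: "s \<in> {0..}"
    show "((\<lambda>t. emb (\<mu> t)) \<longlongrightarrow> emb (\<mu> s)) (at s within {0..})"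
    proof (rule Lim_null[THEN iffD2], rule tendsto_norm_zero_cancel, rule tendsto_sandwich[where f = "\<lambda>_. 0"])
      show "\<forall>\<^sub>F t in at s within {0..}. norm (emb (\<mu> t) - emb (\<mu> s)) \<le> L2_norm (\<lambda>x. \<mu> t x - \<mu> s x) * C"
        using C L s by (auto simp: eventually_at_filter)
      have "((\<lambda>t. L2_norm (\<lambda>x. \<mu> t x - \<mu> s x)) \<longlongrightarrow> 0) (at s within {0..})"
        using sol s by (simp add: FP_weak_solution_def)
      from tendsto_mult_right[OF this, of C]
      show "((\<lambda>t. L2_norm (\<lambda>x. \<mu> t x - \<mu> s x) * C) \<longlongrightarrow> 0) (at s within {0..})" by simp
    qed auto
  qed
  have cont0: "continuous_on {0<..} (\<lambda>t. emb (\<mu> t))" by (rule continuous_on_subset[OF cont]) auto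
  define u where "u t = emb (\<mu> t) - flow v t" for t
  have "u t = 0"
  proof (rule evolution_unique[OF _ _ _ t])
    show "continuous_on {0..} u" unfolding u_def by (intro continuous_intros cont continuous_on_flow v)
    have "AE x in cell. \<mu> 0 x = \<mu>0 x" using sol by (intro AE_cell) (simp add: FP_weak_solution_def)
    then have "AE x in cell. ex (1/2) x * \<mu> 0 x = ex (1/2) x * \<mu>0 x" by eventually_elim simp
    then have "emb (\<mu> 0) = v"
      unfolding v_def emb_def by (subst abs_l2_eq_iff) (auto intro: exL2 L H1_L2 \<mu>0)
    then show "u 0 = 0" by (simp add: u_def flow_0[OF v])
    fix s :: real and w assume s: "s > 0"
    \<comment> \<open>For this test vector q z \<rho> is the inner product of z with w - \<rho>, so
      the right-hand side of the equation loses its gradient and becomes continuous in time.\<close>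
    define \<rho> where "\<rho> = res 1 w"
    have \<rho>: "\<rho> \<in> D" unfolding \<rho>_def by (rule res_D) simp
    have q\<rho>: "q z \<rho> = (w - \<rho>) \<bullet> z" if "z \<in> D" for z
      using res_eq[OF zero_less_one that, of w] q_sym[OF that \<rho>] by (simp add: \<rho>_def)
    have \<phi>: "den \<rho> \<in> H1" using \<rho> by (simp add: D_def)
    have "((\<lambda>t. emb (\<mu> t) \<bullet> \<rho>) has_real_derivative - ((w - \<rho>) \<bullet> emb (\<mu> s))) (at s)"
    proof (rule weak_derivative_imp_has_derivative[OF _ _ _ s])
      show "continuous_on {0<..} (\<lambda>t. emb (\<mu> t) \<bullet> \<rho>)" by (intro continuous_intros cont0)
      show ck: "continuous_on {0<..} (\<lambda>t. (w - \<rho>) \<bullet> emb (\<mu> t))" by (intro continuous_intros cont0)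
      fix \<eta> :: "real \<Rightarrow> real" and a b :: real
      assume \<eta>: "smooth \<eta>" "0 < a" "\<And>t. t \<notin> {a..b} \<Longrightarrow> \<eta> t = 0"
      have "(LINT t:{0<..}|lebesgue. deriv \<eta> t * (emb (\<mu> t) \<bullet> \<rho>))
          = (LINT t:{0<..}|lebesgue. deriv \<eta> t * torus_integral (\<lambda>x. \<mu> t x * den \<rho> x))"
      proof (rule set_lebesgue_integral_cong)
        show "\<forall>t. t \<in> {0<..} \<longrightarrow> deriv \<eta> t * (emb (\<mu> t) \<bullet> \<rho>) = deriv \<eta> t * torus_integral (\<lambda>x. \<mu> t x * den \<rho> x)"
          using inner_emb_cls[OF L den_L2] by (simp add: cls_den)
      qed auto
      also have "\<dots> = (LINT t:{0<..}|lebesgue. \<eta> t * FP_form As DV (\<mu> t) (den \<rho>))"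
        using sol \<phi> \<eta> unfolding FP_weak_solution_def by blast
      also have "\<dots> = (LINT t:{0<..}|lebesgue. \<eta> t * ((w - \<rho>) \<bullet> emb (\<mu> t)))"
      proof -
        \<comment> \<open>A solution lies in \<open>H1\<close> only for almost every time; elsewhere
          \<open>FP_form\<close> has no meaning, and the two integrands need not agree.\<close>
        have ae: "AE t in lebesgue. indicator {0<..} t *\<^sub>R (\<eta> t * ((w - \<rho>) \<bullet> emb (\<mu> t)))
            = indicator {0<..} t *\<^sub>R (\<eta> t * FP_form As DV (\<mu> t) (den \<rho>))"
          using H
        proof eventually_elim
          case (elim t)
          then show ?case
            using q\<rho>[OF emb_D] FP_form_emb[OF _ \<phi>] by (cases "t > 0") (simp_all add: cls_den)
        qed
        have "Ck 0 \<eta>" using \<eta>(1) by (simp only: smooth_def)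
        then have "continuous_on {0<..} \<eta>" using continuous_on_subset by auto
        then have "(\<lambda>t. indicator {0<..} t *\<^sub>R (\<eta> t * ((w - \<rho>) \<bullet> emb (\<mu> t)))) \<in> borel_measurable borel"
          by (intro borel_measurable_continuous_on_indicator continuous_intros ck) auto
        then have m: "(\<lambda>t. indicator {0<..} t *\<^sub>R (\<eta> t * ((w - \<rho>) \<bullet> emb (\<mu> t)))) \<in> borel_measurable lebesgue"
          by (simp add: measurable_completion)
        show ?thesis unfolding set_lebesgue_integral_def
          by (rule integral_cong_AE[symmetric, OF m borel_measurable_AE[OF m ae] ae])
      qed
      finally show "(LINT t:{0<..}|lebesgue. deriv \<eta> t * (emb (\<mu> t) \<bullet> \<rho>))
          = (LINT t:{0<..}|lebesgue. \<eta> t * ((w - \<rho>) \<bullet> emb (\<mu> t)))" .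
    qed
    from DERIV_diff[OF this flow_has_real_derivative[OF v \<rho> s]]
    have "((\<lambda>t. u t \<bullet> \<rho>) has_real_derivative - ((w - \<rho>) \<bullet> u s)) (at s)"
      by (simp add: u_def inner_diff_left inner_diff_right q\<rho> flow_D v algebra_simps)
    moreover have "(w - \<rho>) \<bullet> u s = (u s - res 1 (u s)) \<bullet> w"
      using res_symmetric[of 1 w "u s"] by (simp add: \<rho>_def inner_diff_left inner_diff_right inner_commute)
    moreover have "u t \<bullet> \<rho> = res 1 (u t) \<bullet> w" for t
      using res_symmetric[of 1 "u t" w] by (simp add: \<rho>_def)
    ultimately show "((\<lambda>t. res 1 (u t) \<bullet> w) has_real_derivative - ((u s - res 1 (u s)) \<bullet> w)) (at s)"
      by simp
  qed
  then show ?thesis by (simp add: u_def v_def)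
qed

text \<open>By uniqueness the class of any solution is the flow, so the convergence of the Euler
  approximations applies, and V \<ge> 0 brings it back to the unweighted norm.\<close>

lemma min_scheme_converges:
  assumes \<mu>0: "\<mu>0 \<in> H1" and m: "\<And>\<tau>. \<tau> > 0 \<Longrightarrow> min_scheme As V \<mu>0 \<tau> (m \<tau>)"
    and sol: "FP_weak_solution As DV \<mu>0 \<mu>" and t: "t > 0"
  shows "((\<lambda>\<tau>. L2_norm (\<lambda>x. interpolant \<tau> (m \<tau>) t x - \<mu> t x)) \<longlongrightarrow> 0) (at_right 0)"
proof (rule tendsto_sandwich[where f = "\<lambda>_. 0"])
  let ?v = "emb \<mu>0"
  have L: "\<mu> t \<in> L2" using sol t by (simp add: FP_weak_solution_def)
  have "L2_norm (\<lambda>x. interpolant \<tau> (m \<tau>) t x - \<mu> t x) \<le> norm (euler ?v \<tau> t - flow ?v t)" if \<tau>: "\<tau> > 0" for \<tau>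
  proof -
    have "m \<tau> n \<in> H1" "emb (m \<tau> n) = (res \<tau> ^^ n) ?v" for n
      using m[OF \<tau>] min_scheme_iff[OF \<tau> \<mu>0] by auto
    then show ?thesis
      using L2_norm_le_emb[OF H1_L2 L, of "interpolant \<tau> (m \<tau>) t"] FP_weak_solution_unique[OF \<mu>0 sol, of t] t
      by (simp add: interpolant_def euler_def)
  qed
  then show "\<forall>\<^sub>F \<tau> in at_right 0. L2_norm (\<lambda>x. interpolant \<tau> (m \<tau>) t x - \<mu> t x) \<le> norm (euler ?v \<tau> t - flow ?v t)"
    by (auto simp: eventually_at_filter)
  show "((\<lambda>\<tau>. norm (euler ?v \<tau> t - flow ?v t)) \<longlongrightarrow> 0) (at_right 0)"
    using euler_tendsto[OF emb_D[OF \<mu>0], of t] t by (intro tendsto_norm_zero Lim_null[THEN iffD1]) auto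
qed (auto simp: L2_norm_def torus_integral_eq)

end

text \<open>Minimisers, and solutions at each time, are fixed only up to null sets, so the
  statements cover every choice; the existence clauses keep them from being vacuous.\<close>

theorem theorem1p7:
  fixes A :: "real^'d \<Rightarrow> real^'d^'d"
    and X :: "real^'d \<Rightarrow> real^'d"
    and Veps :: "real \<Rightarrow> real^'d \<Rightarrow> real"
    and V :: "real^'d \<Rightarrow> real"
    and DV :: "real^'d \<Rightarrow> real^'d"
    and \<mu>0 :: "real^'d \<Rightarrow> real"
    and As :: "real^'d^'d"
    and \<Lambda>0 \<Lambda>1 L :: real
  assumes "periodic A"
    and "\<And>j k. Ck 2 (\<lambda>x. A x $ j $ k)"
    and "\<Lambda>0 > 0" and "\<Lambda>1 > 0"
    and "\<And>x. loewner_le (\<Lambda>0 *\<^sub>R mat 1) (A x)"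
    and "\<And>x. loewner_le (A x) (\<Lambda>1 *\<^sub>R mat 1)"
    and "L > 0"
    and "\<And>\<epsilon>. \<epsilon> > 0 \<Longrightarrow> periodic (Veps \<epsilon>) \<and> Ck 1 (Veps \<epsilon>)"
    and "\<And>\<epsilon> x. \<epsilon> > 0 \<Longrightarrow> 0 \<le> Veps \<epsilon> x \<and> Veps \<epsilon> x \<le> L \<and> norm (grad (Veps \<epsilon>) x) \<le> L"
    and "uniform_limit UNIV Veps V (at_right 0)"
    and "AE x in lebesgue. (V has_derivative (\<lambda>h. DV x \<bullet> h)) (at x)"
    and "corrector A X"
    and "As = effective_matrix A X"
    and "\<mu>0 \<in> H1"
  shows "(\<forall>\<tau>>0. \<exists>m. min_scheme As V \<mu>0 \<tau> m) \<and>
    (\<forall>\<tau>>0. \<forall>m. min_scheme As V \<mu>0 \<tau> m \<longrightarrow>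
       (\<forall>n\<ge>1. discrete_FP_weak As DV \<tau> (m n) (m (n - 1)))) \<and>
    (\<exists>\<mu>. FP_weak_solution As DV \<mu>0 \<mu>) \<and>
    (\<forall>m \<mu>. (\<forall>\<tau>>0. min_scheme As V \<mu>0 \<tau> (m \<tau>)) \<and> FP_weak_solution As DV \<mu>0 \<mu> \<longrightarrow>
       (\<forall>t>0. ((\<lambda>\<tau>. L2_norm (\<lambda>x. interpolant \<tau> (m \<tau>) t x - \<mu> t x)) \<longlongrightarrow> 0) (at_right 0)))"
proof -
  \<comment> \<open>Pointwise limits already transfer periodicity, the bounds and the Lipschitz
    constant from the approximating potentials to V.\<close>
  have lim: "((\<lambda>\<epsilon>. Veps \<epsilon> x) \<longlongrightarrow> V x) (at_right 0)" for x
    by (rule tendsto_uniform_limitI[OF assms(10)]) simp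
  have pos: "\<forall>\<^sub>F \<epsilon> in at_right 0. P \<epsilon>" if "\<And>\<epsilon>::real. \<epsilon> > 0 \<Longrightarrow> P \<epsilon>" for P
    using that by (auto simp: eventually_at_filter)
  have sym: "transpose (A x) = A x" and low: "\<Lambda>0 * (\<xi> \<bullet> \<xi>) \<le> \<xi> \<bullet> (A x *v \<xi>)" for x \<xi>
    using assms(5)[of x] by (auto simp: loewner_le_def scaleR_matrix_vector_assoc[symmetric])
  interpret fokker_planck As V DV L \<Lambda>0
  proof
    show "As $ j $ k = As $ k $ j" for j k
      unfolding assms(13)
      by (rule effective_matrix_elliptic(1)[OF assms(1,2) sym low less_imp_le[OF assms(3)] assms(12)])
    show "\<Lambda>0 * (\<xi> \<bullet> \<xi>) \<le> \<xi> \<bullet> (As *v \<xi>)" for \<xi>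
      unfolding assms(13)
      by (rule effective_matrix_elliptic(2)[OF assms(1,2) sym low less_imp_le[OF assms(3)] assms(12)])
    show "periodic V"
      unfolding periodic_def
    proof (intro allI)
      fix x and j :: 'd
      have "\<forall>\<^sub>F \<epsilon> in at_right 0. Veps \<epsilon> (x + axis j 1) = Veps \<epsilon> x"
        using assms(8) by (intro pos) (simp add: periodic_def)
      then have "((\<lambda>\<epsilon>. Veps \<epsilon> x) \<longlongrightarrow> V (x + axis j 1)) (at_right 0)"
        by (rule Lim_transform_eventually[OF lim])
      then show "V (x + axis j 1) = V x" using tendsto_unique[OF trivial_limit_at_right_real _ lim] by blast
    qed
    show "\<bar>V x - V y\<bar> \<le> L * dist x y" for x y
    proof (rule tendsto_upperbound[OF tendsto_rabs[OF tendsto_diff[OF lim lim]]])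
      show "\<forall>\<^sub>F \<epsilon> in at_right 0. \<bar>Veps \<epsilon> x - Veps \<epsilon> y\<bar> \<le> L * dist x y"
      proof (rule pos)
        fix \<epsilon> :: real assume \<epsilon>: "\<epsilon> > 0"
        have "Ck (Suc 0) (Veps \<epsilon>)" using assms(8)[OF \<epsilon>] by (simp only: One_nat_def)
        then show "\<bar>Veps \<epsilon> x - Veps \<epsilon> y\<bar> \<le> L * dist x y"
          using assms(9)[OF \<epsilon>] by (intro grad_bound_Lipschitz Ck_SucD(1)[of 0]) auto
      qed
    qed simp
    show "0 \<le> V x" for x
      by (rule tendsto_lowerbound[OF lim pos]) (use assms(9) in auto)
    show "V x \<le> L" for x
      by (rule tendsto_upperbound[OF lim pos]) (use assms(9) in auto)
  qed (use assms in auto)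
  show ?thesis
    using ex_min_scheme[OF _ assms(14)] min_scheme_discrete_FP[OF _ assms(14)]
      FP_weak_solution_flow[OF assms(14)] min_scheme_converges[OF assms(14)] by blast
qed

end
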